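(* Let $\mathcal{E}$ be a regular ($\mathsf{Pos}$-enriched) category. Then $\mathcal{E}_{ex/reg}$ is a regular category and the canonical functor $\Gamma\colon\mathcal{E}\to\mathcal{E}_{ex/reg}$ is a fully order-faithful regular functor.
   Context: All categories and functors are enriched over the cartesian closed category $\mathsf{Pos}$ of posets and monotone maps: each hom-set is partially ordered, composition is monotone in each variable, functors preserve the order on morphisms. Limits are weighted ($\mathsf{Pos}$-enriched); in particular the projections of products and pullbacks are jointly order-monomorphic, where a family $(p_i)$ with common domain is jointly order-monomorphic if $p_iu\le p_iv$ for all $i$ implies $u\le v$. A functor is fully order-faithful if it is full and $Ff\le Fg$ implies $f\le g$ for all parallel $f,g$. A morphism $m\colon X\to Y$ is an $\mathsf{ff}$-morphism if $mf\le mg$ implies $f\le g$ for all $f,g\colon Z\to X$. A morphism $e\colon A\to B$ of a category $\mathcal{C}$ is an $\mathsf{so}$-morphism if for every $\mathsf{ff}$-morphism $m\colon X\to Y$ the canonical square from $\mathcal{C}(B,X)$ to $\mathcal{C}(A,X)$, $\mathcal{C}(B,Y)$ over $\mathcal{C}(A,Y)$ (composing with $e$ and $m$) is a pullback in $\mathsf{Pos}$. The comma object $f/g$ of $f\colon X\to Z$, $g\colon Y\to Z$ is given by jointly order-monomorphic $c_0\colon f/g\to X$, $c_1\colon f/g\to Y$ with $fc_0\le gc_1$, such that any $u_0,u_1$ with $fu_0\le gu_1$ factor as $u_0=c_0u$, $u_1=c_1u$. A category is regular if it has all finite weighted limits, every morphism factors as an $\mathsf{so}$-morphism followed by an $\mathsf{ff}$-morphism,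 and $\mathsf{so}$-morphisms are stable under pullback. A regular functor between regular categories is a functor preserving finite limits and $\mathsf{so}$-morphisms. A relation $R\colon X\looparrowright Y$ in a regular category is a subobject of $X\times Y$ represented by an $\mathsf{ff}$-morphism $\langle r_0,r_1\rangle\colon R\rightarrowtail X\times Y$; relations are ordered by inclusion. For $x\colon A\to X$, $y\colon A\to Y$ write $(x,y)\in_A R$ if $\langle x,y\rangle$ factors through $\langle r_0,r_1\rangle$. The composite $SR\colon X\looparrowright Z$ of $R\colon X\looparrowright Y$ and $S\colon Y\looparrowright Z$ is the $\mathsf{ff}$-part of the $(\mathsf{so},\mathsf{ff})$-factorization of $\langle r_0t_0,s_1t_1\rangle$, where $(T,t_0,t_1)$ is the pullback of $r_1$ and $s_0$. $R$ is weakening-closed if $x'\le x$, $(x,y)\in_A R$, $y\le y'$ imply $(x',y')\in_A R$. $I_X:=1_X/1_X$. For $f\colon X\to Y$, $f_*:=f/1_Y\colon X\looparrowright Y$, i.e. $(x,y)\in_A f_*\iff fx\le y$. A congruence on $X$ is a weakening-closed relation $E\colon X\looparrowright X$ that is reflexive and transitive (equivalently $EE\subseteq E$ and $I_X\subseteq E$). $Q_w(\mathcal{E})$ is the locally posetal bicategory with objects the pairs $(X,E)$, $E$ a congruence on $X\in\mathcal{E}$; morphisms $(X,E)\to(Y,F)$ the relations $\Phi\colon X\looparrowright Y$ in $\mathcal{E}$ with $F\Phi E=\Phi$, ordered by inclusion; composition that of relations; identity on $(X,E)$ the relation $E$. The category $\mathcal{E}_{ex/reg}$ has the same objects; its morphisms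 $(X,E)\to(Y,F)$ are the morphisms $R_*\colon(X,E)\to(Y,F)$ of $Q_w(\mathcal{E})$ having a right adjoint, i.e. for which there is $R^*\colon(Y,F)\to(X,E)$ in $Q_w(\mathcal{E})$ with $R^*R_*\supseteq E$ and $R_*R^*\subseteq F$; the order is $R_*\le S_*:\iff R_*\supseteq S_*$. The functor $\Gamma\colon\mathcal{E}\to\mathcal{E}_{ex/reg}$ sends $X$ to $(X,I_X)$ and $f\colon X\to Y$ to $f_*$. *)

theory Defs
  imports Main
begin

section \<open>Categories and functors enriched in posets\<close>

record ('o, 'a) pos_cat =
  Ob :: "'o set"
  Arr :: "'a set"
  src :: "'a \<Rightarrow> 'o"
  tgt :: "'a \<Rightarrow> 'o"
  ident :: "'o \<Rightarrow> 'a"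
  cmp :: "'a \<Rightarrow> 'a \<Rightarrow> 'a" (infixl \<open>\<cdot>\<index>\<close> 70)
  leq :: "'a \<Rightarrow> 'a \<Rightarrow> bool" (infix \<open>\<sqsubseteq>\<index>\<close> 50)

definition hom :: "('o, 'a, 'z) pos_cat_scheme \<Rightarrow> 'o \<Rightarrow> 'o \<Rightarrow> 'a set" where
  "hom C X Y = {f \<in> Arr C. src C f = X \<and> tgt C f = Y}"

text \<open>Nothing is assumed about \<^const>\<open>cmp\<close> on non-composable and about \<^const>\<open>leq\<close> on
  non-parallel arrows.\<close>

locale pos_category =
  fixes C :: "('o, 'a, 'z) pos_cat_scheme" (structure)
  assumes src_Ob: "f \<in> Arr C \<Longrightarrow> src C f \<in> Ob C"
    and tgt_Ob: "f \<in> Arr C \<Longrightarrow> tgt C f \<in> Ob C"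
    and ident_hom: "X \<in> Ob C \<Longrightarrow> ident C X \<in> hom C X X"
    and cmp_hom: "\<lbrakk>f \<in> hom C X Y; g \<in> hom C Y Z\<rbrakk> \<Longrightarrow> g \<cdot> f \<in> hom C X Z"
    and ident_right: "f \<in> hom C X Y \<Longrightarrow> f \<cdot> ident C X = f"
    and ident_left: "f \<in> hom C X Y \<Longrightarrow> ident C Y \<cdot> f = f"
    and cmp_assoc: "\<lbrakk>f \<in> hom C W X; g \<in> hom C X Y; h \<in> hom C Y Z\<rbrakk>
          \<Longrightarrow> (h \<cdot> g) \<cdot> f = h \<cdot> (g \<cdot> f)"
    and leq_refl: "f \<in> hom C X Y \<Longrightarrow> f \<sqsubseteq> f"
    and leq_antisym: "\<lbrakk>f \<in> hom C X Y; g \<in> hom C X Y; f \<sqsubseteq> g; g \<sqsubseteq> f\<rbrakk> \<Longrightarrow> f = g"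
    and leq_trans: "\<lbrakk>f \<in> hom C X Y; g \<in> hom C X Y; h \<in> hom C X Y; f \<sqsubseteq> g; g \<sqsubseteq> h\<rbrakk>
          \<Longrightarrow> f \<sqsubseteq> h"
    and cmp_mono: "\<lbrakk>f \<in> hom C X Y; f' \<in> hom C X Y; g \<in> hom C Y Z; g' \<in> hom C Y Z;
          f \<sqsubseteq> f'; g \<sqsubseteq> g'\<rbrakk> \<Longrightarrow> g \<cdot> f \<sqsubseteq> g' \<cdot> f'"

record ('o, 'a, 'p, 'b) pos_fun =
  fob :: "'o \<Rightarrow> 'p"
  far :: "'a \<Rightarrow> 'b"

locale pos_functor = dom: pos_category C + cod: pos_category D
  for C :: "('o, 'a) pos_cat" and D :: "('p, 'b) pos_cat" and F :: "('o, 'a, 'p, 'b) pos_fun" +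
  assumes fob_Ob: "X \<in> Ob C \<Longrightarrow> fob F X \<in> Ob D"
    and far_hom: "f \<in> hom C X Y \<Longrightarrow> far F f \<in> hom D (fob F X) (fob F Y)"
    and far_ident: "X \<in> Ob C \<Longrightarrow> far F (ident C X) = ident D (fob F X)"
    and far_cmp: "\<lbrakk>f \<in> hom C X Y; g \<in> hom C Y Z\<rbrakk>
          \<Longrightarrow> far F (g \<cdot>\<^bsub>C\<^esub> f) = far F g \<cdot>\<^bsub>D\<^esub> far F f"
    and far_mono: "\<lbrakk>f \<in> hom C X Y; g \<in> hom C X Y; f \<sqsubseteq>\<^bsub>C\<^esub> g\<rbrakk>
          \<Longrightarrow> far F f \<sqsubseteq>\<^bsub>D\<^esub> far F g"

definition fully_order_faithful ::
  "('o, 'a) pos_cat \<Rightarrow> ('p, 'b) pos_cat \<Rightarrow> ('o, 'a, 'p, 'b) pos_fun \<Rightarrow> bool" where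
  "fully_order_faithful C D F \<longleftrightarrow>
    (\<forall>X \<in> Ob C. \<forall>Y \<in> Ob C. \<forall>k \<in> hom D (fob F X) (fob F Y). \<exists>f \<in> hom C X Y. far F f = k) \<and>
    (\<forall>X \<in> Ob C. \<forall>Y \<in> Ob C. \<forall>f \<in> hom C X Y. \<forall>g \<in> hom C X Y.
        far F f \<sqsubseteq>\<^bsub>D\<^esub> far F g \<longrightarrow> f \<sqsubseteq>\<^bsub>C\<^esub> g)"

section \<open>Finite weighted limits\<close>

text \<open>A weight on \<open>J\<close> is a \<open>Pos\<close>-functor from \<open>J\<close> to posets and monotone maps.\<close>

record ('j, 'u, 'w) weight =
  wob :: "'j \<Rightarrow> 'w set"
  wle :: "'j \<Rightarrow> 'w \<Rightarrow> 'w \<Rightarrow> bool"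
  war :: "'u \<Rightarrow> 'w \<Rightarrow> 'w"

locale pos_weight = pos_category J
  for J :: "('j, 'u) pos_cat" and W :: "('j, 'u, 'w) weight" +
  assumes wle_refl: "\<lbrakk>j \<in> Ob J; w \<in> wob W j\<rbrakk> \<Longrightarrow> wle W j w w"
    and wle_antisym: "\<lbrakk>j \<in> Ob J; w \<in> wob W j; w' \<in> wob W j; wle W j w w'; wle W j w' w\<rbrakk>
          \<Longrightarrow> w = w'"
    and wle_trans: "\<lbrakk>j \<in> Ob J; w \<in> wob W j; w' \<in> wob W j; w'' \<in> wob W j;
          wle W j w w'; wle W j w' w''\<rbrakk> \<Longrightarrow> wle W j w w''"
    and war_wob: "\<lbrakk>u \<in> hom J i j; w \<in> wob W i\<rbrakk> \<Longrightarrow> war W u w \<in> wob W j"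
    and war_wle: "\<lbrakk>u \<in> hom J i j; w \<in> wob W i; w' \<in> wob W i; wle W i w w'\<rbrakk>
          \<Longrightarrow> wle W j (war W u w) (war W u w')"
    and war_ident: "\<lbrakk>j \<in> Ob J; w \<in> wob W j\<rbrakk> \<Longrightarrow> war W (ident J j) w = w"
    and war_cmp: "\<lbrakk>u \<in> hom J i j; v \<in> hom J j k; w \<in> wob W i\<rbrakk>
          \<Longrightarrow> war W (v \<cdot>\<^bsub>J\<^esub> u) w = war W v (war W u w)"
    and war_leq: "\<lbrakk>u \<in> hom J i j; v \<in> hom J i j; u \<sqsubseteq>\<^bsub>J\<^esub> v; w \<in> wob W i\<rbrakk>
          \<Longrightarrow> wle W j (war W u w) (war W v w)"

text \<open>\<open>W\<close>-cylinders over \<open>D\<close> with vertex \<open>X\<close>, i.e.\ \<open>Pos\<close>-natural transformations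
  from \<open>W\<close> to \<open>C(X, D -)\<close>; the leg at \<open>w \<in> W j\<close> is \<open>c j w\<close>.\<close>

definition is_cylinder ::
  "('o, 'a) pos_cat \<Rightarrow> ('j, 'u) pos_cat \<Rightarrow> ('j, 'u, 'w) weight \<Rightarrow> ('j, 'u, 'o, 'a) pos_fun
    \<Rightarrow> 'o \<Rightarrow> ('j \<Rightarrow> 'w \<Rightarrow> 'a) \<Rightarrow> bool" where
  "is_cylinder C J W D X c \<longleftrightarrow>
    (\<forall>j \<in> Ob J. \<forall>w \<in> wob W j. c j w \<in> hom C X (fob D j)) \<and>
    (\<forall>j \<in> Ob J. \<forall>w \<in> wob W j. \<forall>w' \<in> wob W j. wle W j w w' \<longrightarrow> c j w \<sqsubseteq>\<^bsub>C\<^esub> c j w') \<and>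
    (\<forall>i \<in> Ob J. \<forall>j \<in> Ob J. \<forall>u \<in> hom J i j. \<forall>w \<in> wob W i.
        far D u \<cdot>\<^bsub>C\<^esub> c i w = c j (war W u w))"

text \<open>The representation \<open>C(X, L) \<cong> [J, Pos](W, C(X, D -))\<close>, an isomorphism of posets natural
  in \<open>X\<close>, expressed through its unit \<open>c\<close>.\<close>

definition is_weighted_limit ::
  "('o, 'a) pos_cat \<Rightarrow> ('j, 'u) pos_cat \<Rightarrow> ('j, 'u, 'w) weight \<Rightarrow> ('j, 'u, 'o, 'a) pos_fun
    \<Rightarrow> 'o \<Rightarrow> ('j \<Rightarrow> 'w \<Rightarrow> 'a) \<Rightarrow> bool" where
  "is_weighted_limit C J W D L c \<longleftrightarrow> L \<in> Ob C \<and> is_cylinder C J W D L c \<and>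
    (\<forall>X \<in> Ob C. \<forall>d. is_cylinder C J W D X d \<longrightarrow>
        (\<exists>!h. h \<in> hom C X L \<and> (\<forall>j \<in> Ob J. \<forall>w \<in> wob W j. c j w \<cdot>\<^bsub>C\<^esub> h = d j w))) \<and>
    (\<forall>X \<in> Ob C. \<forall>h \<in> hom C X L. \<forall>k \<in> hom C X L.
        (\<forall>j \<in> Ob J. \<forall>w \<in> wob W j. c j w \<cdot>\<^bsub>C\<^esub> h \<sqsubseteq>\<^bsub>C\<^esub> c j w \<cdot>\<^bsub>C\<^esub> k) \<longrightarrow> h \<sqsubseteq>\<^bsub>C\<^esub> k)"

text \<open>A weight is finite if its indexing category has finitely many objects and finite
  hom-posets and its values are finite posets. Every such weight is isomorphic to one carried
  by natural numbers, so quantifying over weights of type \<^typ>\<open>(nat, nat, nat) weight\<close> loses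
  no generality.\<close>

definition finite_weight :: "('j, 'u) pos_cat \<Rightarrow> ('j, 'u, 'w) weight \<Rightarrow> bool" where
  "finite_weight J W \<longleftrightarrow> pos_weight J W \<and> finite (Ob J) \<and> finite (Arr J) \<and>
    (\<forall>j \<in> Ob J. finite (wob W j))"

definition has_finite_weighted_limits :: "('o, 'a) pos_cat \<Rightarrow> bool" where
  "has_finite_weighted_limits C \<longleftrightarrow>
    (\<forall>(J :: (nat, nat) pos_cat) (W :: (nat, nat, nat) weight) D.
        finite_weight J W \<and> pos_functor J C D \<longrightarrow> (\<exists>L c. is_weighted_limit C J W D L c))"

definition preserves_finite_weighted_limits ::
  "('o, 'a) pos_cat \<Rightarrow> ('p, 'b) pos_cat \<Rightarrow> ('o, 'a, 'p, 'b) pos_fun \<Rightarrow> bool" where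
  "preserves_finite_weighted_limits C C' F \<longleftrightarrow>
    (\<forall>(J :: (nat, nat) pos_cat) (W :: (nat, nat, nat) weight) D L c.
        finite_weight J W \<and> pos_functor J C D \<and> is_weighted_limit C J W D L c \<longrightarrow>
        is_weighted_limit C' J W \<lparr>fob = \<lambda>j. fob F (fob D j), far = \<lambda>u. far F (far D u)\<rparr>
          (fob F L) (\<lambda>j w. far F (c j w)))"

definition jointly_order_mono :: "('o, 'a) pos_cat \<Rightarrow> 'a \<Rightarrow> 'a \<Rightarrow> bool" where
  "jointly_order_mono C p q \<longleftrightarrow> p \<in> Arr C \<and> q \<in> Arr C \<and> src C p = src C q \<and>
    (\<forall>Z \<in> Ob C. \<forall>u \<in> hom C Z (src C p). \<forall>v \<in> hom C Z (src C p).
        p \<cdot>\<^bsub>C\<^esub> u \<sqsubseteq>\<^bsub>C\<^esub> p \<cdot>\<^bsub>C\<^esub> v \<and> q \<cdot>\<^bsub>C\<^esub> u \<sqsubseteq>\<^bsub>C\<^esub> q \<cdot>\<^bsub>C\<^esub> v \<longrightarrow> u \<sqsubseteq>\<^bsub>C\<^esub> v)"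

definition is_product :: "('o, 'a) pos_cat \<Rightarrow> 'o \<Rightarrow> 'o \<Rightarrow> 'a \<Rightarrow> 'a \<Rightarrow> bool" where
  "is_product C X Y p q \<longleftrightarrow> jointly_order_mono C p q \<and> tgt C p = X \<and> tgt C q = Y \<and>
    (\<forall>Z \<in> Ob C. \<forall>u \<in> hom C Z X. \<forall>v \<in> hom C Z Y.
        \<exists>h \<in> hom C Z (src C p). p \<cdot>\<^bsub>C\<^esub> h = u \<and> q \<cdot>\<^bsub>C\<^esub> h = v)"

definition is_pullback :: "('o, 'a) pos_cat \<Rightarrow> 'a \<Rightarrow> 'a \<Rightarrow> 'a \<Rightarrow> 'a \<Rightarrow> bool" where
  "is_pullback C f g p q \<longleftrightarrow> f \<in> Arr C \<and> g \<in> Arr C \<and> tgt C f = tgt C g \<and>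
    jointly_order_mono C p q \<and> tgt C p = src C f \<and> tgt C q = src C g \<and>
    f \<cdot>\<^bsub>C\<^esub> p = g \<cdot>\<^bsub>C\<^esub> q \<and>
    (\<forall>Z \<in> Ob C. \<forall>u \<in> hom C Z (src C f). \<forall>v \<in> hom C Z (src C g). f \<cdot>\<^bsub>C\<^esub> u = g \<cdot>\<^bsub>C\<^esub> v \<longrightarrow>
        (\<exists>h \<in> hom C Z (src C p). p \<cdot>\<^bsub>C\<^esub> h = u \<and> q \<cdot>\<^bsub>C\<^esub> h = v))"

definition is_comma :: "('o, 'a) pos_cat \<Rightarrow> 'a \<Rightarrow> 'a \<Rightarrow> 'a \<Rightarrow> 'a \<Rightarrow> bool" where
  "is_comma C f g c\<^sub>0 c\<^sub>1 \<longleftrightarrow> f \<in> Arr C \<and> g \<in> Arr C \<and> tgt C f = tgt C g \<and>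
    jointly_order_mono C c\<^sub>0 c\<^sub>1 \<and> tgt C c\<^sub>0 = src C f \<and> tgt C c\<^sub>1 = src C g \<and>
    f \<cdot>\<^bsub>C\<^esub> c\<^sub>0 \<sqsubseteq>\<^bsub>C\<^esub> g \<cdot>\<^bsub>C\<^esub> c\<^sub>1 \<and>
    (\<forall>Z \<in> Ob C. \<forall>u \<in> hom C Z (src C f). \<forall>v \<in> hom C Z (src C g). f \<cdot>\<^bsub>C\<^esub> u \<sqsubseteq>\<^bsub>C\<^esub> g \<cdot>\<^bsub>C\<^esub> v \<longrightarrow>
        (\<exists>h \<in> hom C Z (src C c\<^sub>0). c\<^sub>0 \<cdot>\<^bsub>C\<^esub> h = u \<and> c\<^sub>1 \<cdot>\<^bsub>C\<^esub> h = v))"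

section \<open>Regular categories and regular functors\<close>

definition ff :: "('o, 'a) pos_cat \<Rightarrow> 'a \<Rightarrow> bool" where
  "ff C m \<longleftrightarrow> m \<in> Arr C \<and>
    (\<forall>Z \<in> Ob C. \<forall>f \<in> hom C Z (src C m). \<forall>g \<in> hom C Z (src C m).
        m \<cdot>\<^bsub>C\<^esub> f \<sqsubseteq>\<^bsub>C\<^esub> m \<cdot>\<^bsub>C\<^esub> g \<longrightarrow> f \<sqsubseteq>\<^bsub>C\<^esub> g)"

text \<open>For \<open>e : A \<rightarrow> B\<close> and \<open>m : X \<rightarrow> Y\<close>, the comparison map from \<open>C(B, X)\<close> to the pullback
  \<open>C(A, X) \<times>\<^bsub>C(A, Y)\<^esub> C(B, Y)\<close> of posets has to be an isomorphism of posets, i.e.\ bijective and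
  order-reflecting (it is monotone in any case).\<close>

definition so :: "('o, 'a) pos_cat \<Rightarrow> 'a \<Rightarrow> bool" where
  "so C e \<longleftrightarrow> e \<in> Arr C \<and>
    (\<forall>m. ff C m \<longrightarrow>
      bij_betw (\<lambda>h. (h \<cdot>\<^bsub>C\<^esub> e, m \<cdot>\<^bsub>C\<^esub> h)) (hom C (tgt C e) (src C m))
        {(f, g). f \<in> hom C (src C e) (src C m) \<and> g \<in> hom C (tgt C e) (tgt C m) \<and>
          m \<cdot>\<^bsub>C\<^esub> f = g \<cdot>\<^bsub>C\<^esub> e} \<and>
      (\<forall>h \<in> hom C (tgt C e) (src C m). \<forall>k \<in> hom C (tgt C e) (src C m).
        h \<cdot>\<^bsub>C\<^esub> e \<sqsubseteq>\<^bsub>C\<^esub> k \<cdot>\<^bsub>C\<^esub> e \<and> m \<cdot>\<^bsub>C\<^esub> h \<sqsubseteq>\<^bsub>C\<^esub> m \<cdot>\<^bsub>C\<^esub> k \<longrightarrow> h \<sqsubseteq>\<^bsub>C\<^esub> k))"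

locale regular_category = pos_category C for C :: "('o, 'a) pos_cat" +
  assumes finite_limits: "has_finite_weighted_limits C"
    and factorization: "f \<in> Arr C \<Longrightarrow>
          \<exists>e m. so C e \<and> ff C m \<and> src C e = src C f \<and> tgt C e = src C m \<and> tgt C m = tgt C f \<and>
            m \<cdot>\<^bsub>C\<^esub> e = f"
    and so_stable: "\<lbrakk>is_pullback C e g p q; so C e\<rbrakk> \<Longrightarrow> so C q"

locale regular_functor = dom: regular_category C + cod: regular_category D + pos_functor C D F
  for C :: "('o, 'a) pos_cat" and D :: "('p, 'b) pos_cat" and F :: "('o, 'a, 'p, 'b) pos_fun" +
  assumes preserves_limits: "preserves_finite_weighted_limits C D F"
    and preserves_so: "so C e \<Longrightarrow> so D (far F e)"

section \<open>Relations\<close>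

text \<open>Relations are subobjects of a chosen product; by uniqueness of products up to isomorphism
  the choice is immaterial. Meaningful only if the products exist.\<close>

definition prj :: "('o, 'a) pos_cat \<Rightarrow> 'o \<Rightarrow> 'o \<Rightarrow> 'a \<times> 'a" where
  "prj C X Y = (SOME pq. is_product C X Y (fst pq) (snd pq))"

definition prj0 :: "('o, 'a) pos_cat \<Rightarrow> 'o \<Rightarrow> 'o \<Rightarrow> 'a" where
  "prj0 C X Y = fst (prj C X Y)"

definition prj1 :: "('o, 'a) pos_cat \<Rightarrow> 'o \<Rightarrow> 'o \<Rightarrow> 'a" where
  "prj1 C X Y = snd (prj C X Y)"

definition prod_ob :: "('o, 'a) pos_cat \<Rightarrow> 'o \<Rightarrow> 'o \<Rightarrow> 'o" where
  "prod_ob C X Y = src C (prj0 C X Y)"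

definition pairing :: "('o, 'a) pos_cat \<Rightarrow> 'o \<Rightarrow> 'o \<Rightarrow> 'a \<Rightarrow> 'a \<Rightarrow> 'a" where
  "pairing C X Y x y = (THE h. h \<in> hom C (src C x) (prod_ob C X Y) \<and>
      prj0 C X Y \<cdot>\<^bsub>C\<^esub> h = x \<and> prj1 C X Y \<cdot>\<^bsub>C\<^esub> h = y)"

definition factors_through :: "('o, 'a) pos_cat \<Rightarrow> 'a \<Rightarrow> 'a \<Rightarrow> bool" where
  "factors_through C f m \<longleftrightarrow> (\<exists>h \<in> hom C (src C f) (src C m). m \<cdot>\<^bsub>C\<^esub> h = f)"

text \<open>A subobject of \<open>Z\<close> is the set of all \<open>ff\<close>-morphisms representing it, i.e.\ a class of
  \<open>ff\<close>-morphisms into \<open>Z\<close> modulo mutual factorization.\<close>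

definition subobjects :: "('o, 'a) pos_cat \<Rightarrow> 'o \<Rightarrow> 'a set set" where
  "subobjects C Z = {{n. ff C n \<and> tgt C n = Z \<and> factors_through C m n \<and> factors_through C n m} |
      m. ff C m \<and> tgt C m = Z}"

definition Rel :: "('o, 'a) pos_cat \<Rightarrow> 'o \<Rightarrow> 'o \<Rightarrow> 'a set set" where
  "Rel C X Y = subobjects C (prod_ob C X Y)"

definition rel_le :: "('o, 'a) pos_cat \<Rightarrow> 'a set \<Rightarrow> 'a set \<Rightarrow> bool" where
  "rel_le C R S \<longleftrightarrow> (\<exists>r \<in> R. \<exists>s \<in> S. factors_through C r s)"

text \<open>\<open>(x, y) \<in>\<^sub>A R\<close> for \<open>R : X \<looparrowright> Y\<close>, where \<open>A\<close> is the common domain of \<open>x\<close> and \<open>y\<close>.\<close>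

definition rel_mem :: "('o, 'a) pos_cat \<Rightarrow> 'o \<Rightarrow> 'o \<Rightarrow> 'a \<Rightarrow> 'a \<Rightarrow> 'a set \<Rightarrow> bool" where
  "rel_mem C X Y x y R \<longleftrightarrow> (\<exists>r \<in> R. factors_through C (pairing C X Y x y) r)"

text \<open>The composite \<open>S R : X \<looparrowright> Z\<close> of \<open>R : X \<looparrowright> Y\<close> and \<open>S : Y \<looparrowright> Z\<close>. The choices of
  representatives, pullback and factorization only affect the representative \<open>m\<close> of the
  composite; collecting all of them yields the full class.\<close>

definition rel_comp ::
  "('o, 'a) pos_cat \<Rightarrow> 'o \<Rightarrow> 'o \<Rightarrow> 'o \<Rightarrow> 'a set \<Rightarrow> 'a set \<Rightarrow> 'a set" where
  "rel_comp C X Y Z S R = {m. ff C m \<and> tgt C m = prod_ob C X Z \<and>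
      (\<exists>r \<in> R. \<exists>s \<in> S. \<exists>t\<^sub>0 t\<^sub>1 e.
        is_pullback C (prj1 C X Y \<cdot>\<^bsub>C\<^esub> r) (prj0 C Y Z \<cdot>\<^bsub>C\<^esub> s) t\<^sub>0 t\<^sub>1 \<and>
        so C e \<and> src C e = src C t\<^sub>0 \<and> tgt C e = src C m \<and>
        m \<cdot>\<^bsub>C\<^esub> e = pairing C X Z ((prj0 C X Y \<cdot>\<^bsub>C\<^esub> r) \<cdot>\<^bsub>C\<^esub> t\<^sub>0) ((prj1 C Y Z \<cdot>\<^bsub>C\<^esub> s) \<cdot>\<^bsub>C\<^esub> t\<^sub>1))}"

text \<open>The relation \<open>f/g : X \<looparrowright> Y\<close> for \<open>f : X \<rightarrow> Z\<close> and \<open>g : Y \<rightarrow> Z\<close>, again as the class of all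
  its representatives.\<close>

definition comma_rel :: "('o, 'a) pos_cat \<Rightarrow> 'a \<Rightarrow> 'a \<Rightarrow> 'a set" where
  "comma_rel C f g =
    {pairing C (src C f) (src C g) c\<^sub>0 c\<^sub>1 | c\<^sub>0 c\<^sub>1. is_comma C f g c\<^sub>0 c\<^sub>1}"

definition id_rel :: "('o, 'a) pos_cat \<Rightarrow> 'o \<Rightarrow> 'a set" where
  "id_rel C X = comma_rel C (ident C X) (ident C X)"

definition lower_star :: "('o, 'a) pos_cat \<Rightarrow> 'a \<Rightarrow> 'a set" where
  "lower_star C f = comma_rel C f (ident C (tgt C f))"

definition weakening_closed :: "('o, 'a) pos_cat \<Rightarrow> 'o \<Rightarrow> 'o \<Rightarrow> 'a set \<Rightarrow> bool" where
  "weakening_closed C X Y R \<longleftrightarrow>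
    (\<forall>A \<in> Ob C. \<forall>x \<in> hom C A X. \<forall>x' \<in> hom C A X. \<forall>y \<in> hom C A Y. \<forall>y' \<in> hom C A Y.
        x' \<sqsubseteq>\<^bsub>C\<^esub> x \<and> rel_mem C X Y x y R \<and> y \<sqsubseteq>\<^bsub>C\<^esub> y' \<longrightarrow> rel_mem C X Y x' y' R)"

definition congruence :: "('o, 'a) pos_cat \<Rightarrow> 'o \<Rightarrow> 'a set \<Rightarrow> bool" where
  "congruence C X E \<longleftrightarrow> E \<in> Rel C X X \<and> weakening_closed C X X E \<and>
    rel_le C (id_rel C X) E \<and> rel_le C (rel_comp C X X X E E) E"

section \<open>The exact completion\<close>

text \<open>The locally posetal bicategory \<open>Q\<^sub>w(C)\<close>, as a category enriched in posets. An arrow is a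
  relation together with its domain and codomain.\<close>

type_synonym ('o, 'a) cong = "'o \<times> 'a set"
type_synonym ('o, 'a) cong_arr = "('o, 'a) cong \<times> ('o, 'a) cong \<times> 'a set"

definition Qw :: "('o, 'a) pos_cat \<Rightarrow> (('o, 'a) cong, ('o, 'a) cong_arr) pos_cat" where
  "Qw C = \<lparr>
     Ob = {(X, E). X \<in> Ob C \<and> congruence C X E},
     Arr = {((X, E), (Y, F), \<Phi>). X \<in> Ob C \<and> congruence C X E \<and> Y \<in> Ob C \<and> congruence C Y F \<and>
       \<Phi> \<in> Rel C X Y \<and> rel_comp C X Y Y F (rel_comp C X X Y \<Phi> E) = \<Phi>},
     src = \<lambda>(XE, YF, \<Phi>). XE,
     tgt = \<lambda>(XE, YF, \<Phi>). YF,
     ident = \<lambda>(X, E). ((X, E), (X, E), E),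
     cmp = \<lambda>((Y, F), (Z, G), \<Psi>) ((X, E), _, \<Phi>). ((X, E), (Z, G), rel_comp C X Y Z \<Psi> \<Phi>),
     leq = \<lambda>(_, _, \<Phi>) (_, _, \<Psi>). rel_le C \<Phi> \<Psi>\<rparr>"

definition has_right_adjoint :: "('o, 'a) pos_cat \<Rightarrow> 'a \<Rightarrow> bool" where
  "has_right_adjoint Q f \<longleftrightarrow> (\<exists>g \<in> hom Q (tgt Q f) (src Q f).
      ident Q (src Q f) \<sqsubseteq>\<^bsub>Q\<^esub> g \<cdot>\<^bsub>Q\<^esub> f \<and> f \<cdot>\<^bsub>Q\<^esub> g \<sqsubseteq>\<^bsub>Q\<^esub> ident Q (tgt Q f))"

definition ex_reg :: "('o, 'a) pos_cat \<Rightarrow> (('o, 'a) cong, ('o, 'a) cong_arr) pos_cat" where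
  "ex_reg C = (Qw C)\<lparr>
     Arr := {f \<in> Arr (Qw C). has_right_adjoint (Qw C) f},
     leq := \<lambda>f g. g \<sqsubseteq>\<^bsub>Qw C\<^esub> f\<rparr>"

definition Gamma :: "('o, 'a) pos_cat \<Rightarrow> ('o, 'a, ('o, 'a) cong, ('o, 'a) cong_arr) pos_fun" where
  "Gamma C = \<lparr>
     fob = \<lambda>X. (X, id_rel C X),
     far = \<lambda>f. ((src C f, id_rel C (src C f)), (tgt C f, id_rel C (tgt C f)), lower_star C f)\<rparr>"

end

theory Submission
  imports Defs
begin

text \<open>A relation in a regular category \<open>C\<close> is determined by its generalized elements, and
  membership is local: it can be checked after precomposition with an \<open>so\<close>-morphism. A composite of
  relations therefore holds iff it has an intermediate element locally. In this internal language
  an arrow \<open>f : (X, E) \<rightarrow> (Y, F)\<close> of \<open>ex_reg C\<close> is a bimodule such that every \<open>x\<close> locally has a value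
  \<open>y\<close>, that is \<open>f(x, y)\<close> and \<open>f\<^sup>*(y, x)\<close>; then \<open>f(x, y') \<longleftrightarrow> F(y, y')\<close>. Consequently \<open>f\<close> is an
  \<open>ff\<close>-morphism iff \<open>f\<^sup>* f = E\<close>, an \<open>so\<close>-morphism iff every \<open>y\<close> is locally a value, and it factors
  through \<open>(X, f\<^sup>* f)\<close>. The product of \<open>(X, E)\<close> and \<open>(Y, F)\<close> is carried by \<open>X \<times> Y\<close>, the inserter of
  \<open>f\<close> and \<open>g\<close> by the subobject of all \<open>x\<close> with \<open>(g\<^sup>* f)(x, x)\<close>; these constructions restrict to those of
  \<open>C\<close> along \<open>\<Gamma>\<close>. Fullness of \<open>\<Gamma>\<close> holds because an \<open>so\<close>-morphism is the quotient of its kernel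
  congruence.\<close>

section \<open>Finite weighted limits from terminal objects, products and inserters\<close>

text \<open>Two obstacles shape the argument. A regular category must have limits for every finite
  weight, and a regular functor must preserve every one of them; both demands are reduced to
  terminal objects, binary products and inserters, because a weighted limit over posets is a
  universal family of legs subject to finitely many inequalities. The second obstacle is that
  composition of relations goes through an image: an element of a composite has an intermediate
  element only after restriction along an \<open>so\<close>-morphism. Such covers compose and, by
  stability, pull back, so they behave like the covers of a Grothendieck topology, and a statement
  about arrows of the completion is proved on a cover and then descended by orthogonality of
  \<open>so\<close> and \<open>ff\<close>. Values make this manageable: once a value of each arrow
  involved is fixed, composition is substitution and the existential quantifiers disappear. Arrows
  of the completion are moreover tested on points, that is on arrows from \<open>Gamma\<close> of a
  stage, which recovers generalized elements from universal properties.\<close>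

lemma homI: "f \<in> Arr C \<Longrightarrow> f \<in> hom C (src C f) (tgt C f)"
  by (simp add: hom_def)

context pos_category begin

lemma hom_Ob: "f \<in> hom C X Y \<Longrightarrow> X \<in> Ob C" "f \<in> hom C X Y \<Longrightarrow> Y \<in> Ob C"
  using src_Ob tgt_Ob by (auto simp: hom_def)

lemma hom_src: "f \<in> hom C X Y \<Longrightarrow> src C f = X"
  and hom_tgt: "f \<in> hom C X Y \<Longrightarrow> tgt C f = Y"
  and hom_Arr: "f \<in> hom C X Y \<Longrightarrow> f \<in> Arr C"
  by (auto simp: hom_def)

lemma cmp_mono_left: "\<lbrakk>f \<in> hom C X Y; g \<in> hom C Y Z; g' \<in> hom C Y Z; g \<sqsubseteq> g'\<rbrakk> \<Longrightarrow> g \<cdot> f \<sqsubseteq> g' \<cdot> f"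
  and cmp_mono_right: "\<lbrakk>f \<in> hom C X Y; f' \<in> hom C X Y; g \<in> hom C Y Z; f \<sqsubseteq> f'\<rbrakk> \<Longrightarrow> g \<cdot> f \<sqsubseteq> g \<cdot> f'"
  using cmp_mono leq_refl by blast+

end

text \<open>The notions of limit, \<open>ff\<close> and \<open>so\<close> are typed for
  \<open>('o, 'a) pos_cat\<close>, whereas \<open>pos_category\<close> also admits record
  extensions; fixing the type makes these notions available inside a locale.\<close>

locale poset_category = pos_category C for C :: "('o, 'a) pos_cat" (structure)

sublocale pos_functor \<subseteq> dom: poset_category C ..
sublocale pos_functor \<subseteq> cod: poset_category D ..
sublocale regular_category \<subseteq> poset_category C ..

definition is_terminal :: "('o, 'a) pos_cat \<Rightarrow> 'o \<Rightarrow> bool" where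
  "is_terminal C T \<longleftrightarrow> T \<in> Ob C \<and> (\<forall>X \<in> Ob C. \<exists>h. h \<in> hom C X T) \<and>
    (\<forall>X \<in> Ob C. \<forall>h \<in> hom C X T. \<forall>k \<in> hom C X T. h \<sqsubseteq>\<^bsub>C\<^esub> k)"

text \<open>The inserter is the universal arrow on which \<open>f\<close> lies below
  \<open>g\<close>. That \<open>i\<close> is an \<open>ff\<close>-morphism contains both the
  uniqueness of factorizations and the order part of the limit.\<close>

definition is_inserter :: "('o, 'a) pos_cat \<Rightarrow> 'a \<Rightarrow> 'a \<Rightarrow> 'a \<Rightarrow> bool" where
  "is_inserter C f g i \<longleftrightarrow> ff C i \<and> tgt C i = src C f \<and> f \<cdot>\<^bsub>C\<^esub> i \<sqsubseteq>\<^bsub>C\<^esub> g \<cdot>\<^bsub>C\<^esub> i \<and>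
    (\<forall>Z \<in> Ob C. \<forall>x \<in> hom C Z (src C f). f \<cdot>\<^bsub>C\<^esub> x \<sqsubseteq>\<^bsub>C\<^esub> g \<cdot>\<^bsub>C\<^esub> x \<longrightarrow>
        (\<exists>h \<in> hom C Z (src C i). i \<cdot>\<^bsub>C\<^esub> h = x))"

text \<open>A condition \<open>(k, f, k', g)\<close> on a cone \<open>c\<close> stands for \<open>f c\<^sub>k \<le> g c\<^sub>k\<^sub>'\<close>. Finite weighted
  limits are exactly the universal cones over finite families subject to finitely many conditions.\<close>

type_synonym ('k, 'a) ineq = "'k \<times> 'a \<times> 'k \<times> 'a"

definition wf_ineqs :: "('o, 'a) pos_cat \<Rightarrow> 'k set \<Rightarrow> ('k \<Rightarrow> 'o) \<Rightarrow> ('k, 'a) ineq set \<Rightarrow> bool" where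
  "wf_ineqs C K D Q \<longleftrightarrow> (\<forall>(k, f, k', g) \<in> Q. k \<in> K \<and> k' \<in> K \<and>
      (\<exists>Z. f \<in> hom C (D k) Z \<and> g \<in> hom C (D k') Z))"

definition is_cone ::
  "('o, 'a) pos_cat \<Rightarrow> 'k set \<Rightarrow> ('k \<Rightarrow> 'o) \<Rightarrow> ('k, 'a) ineq set \<Rightarrow> 'o \<Rightarrow> ('k \<Rightarrow> 'a) \<Rightarrow> bool" where
  "is_cone C K D Q X c \<longleftrightarrow> (\<forall>k \<in> K. c k \<in> hom C X (D k)) \<and>
    (\<forall>(k, f, k', g) \<in> Q. f \<cdot>\<^bsub>C\<^esub> c k \<sqsubseteq>\<^bsub>C\<^esub> g \<cdot>\<^bsub>C\<^esub> c k')"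

text \<open>Mediating arrows are only asked to exist: the last clause makes the legs jointly
  order-monomorphic, and uniqueness then follows by antisymmetry.\<close>

definition is_ineq_limit ::
  "('o, 'a) pos_cat \<Rightarrow> 'k set \<Rightarrow> ('k \<Rightarrow> 'o) \<Rightarrow> ('k, 'a) ineq set \<Rightarrow> 'o \<Rightarrow> ('k \<Rightarrow> 'a) \<Rightarrow> bool" where
  "is_ineq_limit C K D Q L c \<longleftrightarrow> L \<in> Ob C \<and> is_cone C K D Q L c \<and>
    (\<forall>X \<in> Ob C. \<forall>d. is_cone C K D Q X d \<longrightarrow> (\<exists>h \<in> hom C X L. \<forall>k \<in> K. c k \<cdot>\<^bsub>C\<^esub> h = d k)) \<and>
    (\<forall>X \<in> Ob C. \<forall>h \<in> hom C X L. \<forall>h' \<in> hom C X L.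
        (\<forall>k \<in> K. c k \<cdot>\<^bsub>C\<^esub> h \<sqsubseteq>\<^bsub>C\<^esub> c k \<cdot>\<^bsub>C\<^esub> h') \<longrightarrow> h \<sqsubseteq>\<^bsub>C\<^esub> h')"

definition map_ineqs :: "('a \<Rightarrow> 'b) \<Rightarrow> ('k, 'a) ineq set \<Rightarrow> ('k, 'b) ineq set" where
  "map_ineqs F Q = (\<lambda>(k, f, k', g). (k, F f, k', F g)) ` Q"

lemma is_ineq_limitD:
  assumes "is_ineq_limit C K D Q L c"
  shows "L \<in> Ob C" "is_cone C K D Q L c"
    and "\<And>k. k \<in> K \<Longrightarrow> c k \<in> hom C L (D k)"
    and "\<And>X d. \<lbrakk>X \<in> Ob C; is_cone C K D Q X d\<rbrakk> \<Longrightarrow> \<exists>h \<in> hom C X L. \<forall>k \<in> K. c k \<cdot>\<^bsub>C\<^esub> h = d k"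
    and "\<And>X h h'. \<lbrakk>X \<in> Ob C; h \<in> hom C X L; h' \<in> hom C X L;
           \<And>k. k \<in> K \<Longrightarrow> c k \<cdot>\<^bsub>C\<^esub> h \<sqsubseteq>\<^bsub>C\<^esub> c k \<cdot>\<^bsub>C\<^esub> h'\<rbrakk> \<Longrightarrow> h \<sqsubseteq>\<^bsub>C\<^esub> h'"
  using assms by (auto simp: is_ineq_limit_def is_cone_def)

text \<open>Well-formedness confines the conditions to indices in \<open>K\<close>, so the values of
  the cone elsewhere are not seen. This matters because a functor is known to commute with
  composition only at indices where the cone has legs.\<close>

lemma is_ineq_limit_cong:
  assumes "\<And>k. k \<in> K \<Longrightarrow> c k = c' k" and "wf_ineqs C K D Q"
  shows "is_ineq_limit C K D Q L c \<longleftrightarrow> is_ineq_limit C K D Q L c'"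
proof -
  have "c k = c' k \<and> c k' = c' k'" if "(k, f, k', g) \<in> Q" for k f k' g
    using that assms by (auto simp: wf_ineqs_def)
  then have "is_cone C K D Q L c \<longleftrightarrow> is_cone C K D Q L c'"
    unfolding is_cone_def using assms(1) by (intro conj_cong ball_cong) auto
  then show ?thesis unfolding is_ineq_limit_def using assms(1) by simp
qed

lemma (in poset_category) cone_precomp:
  assumes "is_cone C K D Q L c" "wf_ineqs C K D Q" "h \<in> hom C X L"
  shows "is_cone C K D Q X (\<lambda>k. c k \<cdot> h)"
  unfolding is_cone_def
proof (intro conjI ballI, goal_cases)
  case (1 k) then show ?case using assms cmp_hom by (auto simp: is_cone_def)
next
  case (2 q)
  obtain k f k' g where q: "q = (k, f, k', g)" by (cases q) auto
  obtain Z where f: "f \<in> hom C (D k) Z" "g \<in> hom C (D k') Z" "k \<in> K" "k' \<in> K"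
    using assms(2) 2 q by (fastforce simp: wf_ineqs_def)
  have c: "c k \<in> hom C L (D k)" "c k' \<in> hom C L (D k')" "f \<cdot> c k \<sqsubseteq> g \<cdot> c k'"
    using assms(1) 2 q f by (auto simp: is_cone_def)
  have "(f \<cdot> c k) \<cdot> h \<sqsubseteq> (g \<cdot> c k') \<cdot> h"
    using cmp_mono_left[OF assms(3)] cmp_hom f c by blast
  then show ?case using cmp_assoc[OF assms(3)] f c q by auto
qed

lemma (in poset_category) ineq_limit_empty:
  assumes "is_terminal C T"
  shows "is_ineq_limit C {} D {} T c"
  using assms by (auto simp: is_ineq_limit_def is_terminal_def is_cone_def)

text \<open>One more index without conditions is one more binary product; the old legs are
  precomposed with the first projection.\<close>

lemma (in poset_category) ineq_limit_product:
  assumes "is_ineq_limit C K D {} L c" "is_product C L (D k) p q" "k \<notin> K"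
  shows "is_ineq_limit C (insert k K) D {} (src C p) (\<lambda>i. if i = k then q else c i \<cdot> p)"
    (is "is_ineq_limit C ?K D {} ?P ?d")
proof -
  note L = is_ineq_limitD[OF assms(1)]
  have pq: "p \<in> hom C ?P L" "q \<in> hom C ?P (D k)" and jm: "jointly_order_mono C p q"
    using assms(2) by (auto simp: is_product_def jointly_order_mono_def hom_def)
  have dh: "?d i \<in> hom C ?P (D i)" if "i \<in> ?K" for i
    using that pq cmp_hom L(3) by auto
  have uni: "\<exists>h \<in> hom C X ?P. \<forall>i \<in> ?K. ?d i \<cdot> h = x i"
    if X: "X \<in> Ob C" "\<And>i. i \<in> ?K \<Longrightarrow> x i \<in> hom C X (D i)" for X x
  proof -
    have "is_cone C K D {} X x" using X by (auto simp: is_cone_def)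
    then obtain u where u: "u \<in> hom C X L" "\<forall>i \<in> K. c i \<cdot> u = x i"
      using L(4) X by blast
    obtain h where h: "h \<in> hom C X ?P" "p \<cdot> h = u" "q \<cdot> h = x k"
      using assms(2) X u by (fastforce simp: is_product_def)
    have "?d i \<cdot> h = x i" if "i \<in> ?K" for i
    proof (cases "i = k")
      case False
      then have "(c i \<cdot> p) \<cdot> h = c i \<cdot> (p \<cdot> h)" using cmp_assoc[OF h(1) pq(1)] L(3) that by auto
      then show ?thesis using h u False that by auto
    qed (use h in auto)
    then show ?thesis using h by blast
  qed
  have ord: "h \<sqsubseteq> h'" if X: "X \<in> Ob C" "h \<in> hom C X ?P" "h' \<in> hom C X ?P"
      "\<forall>i \<in> ?K. ?d i \<cdot> h \<sqsubseteq> ?d i \<cdot> h'" for X h h'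
  proof -
    have "c i \<cdot> (p \<cdot> h) \<sqsubseteq> c i \<cdot> (p \<cdot> h')" if "i \<in> K" for i
    proof -
      have "(c i \<cdot> p) \<cdot> h \<sqsubseteq> (c i \<cdot> p) \<cdot> h'" using bspec[OF X(4), of i] that assms(3) by (auto split: if_splits)
      then show ?thesis using cmp_assoc[OF _ pq(1)] L(3)[OF that] X by metis
    qed
    then have "p \<cdot> h \<sqsubseteq> p \<cdot> h'" using L(5) X pq cmp_hom by blast
    moreover have "q \<cdot> h \<sqsubseteq> q \<cdot> h'" using X by force
    ultimately show ?thesis using jm X pq by (auto simp: jointly_order_mono_def)
  qed
  show ?thesis unfolding is_ineq_limit_def is_cone_def
  proof (intro conjI ballI allI impI)
    fix X d assume "X \<in> Ob C" "(\<forall>i \<in> ?K. d i \<in> hom C X (D i)) \<and> (\<forall>(k, f, k', g) \<in> {}. f \<cdot> d k \<sqsubseteq> g \<cdot> d k')"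
    then show "\<exists>h \<in> hom C X ?P. \<forall>i \<in> ?K. ?d i \<cdot> h = d i" using uni by blast
  qed (use hom_Ob(1)[OF pq(1)] dh ord in blast)+
qed

text \<open>Both sides of the new condition become parallel arrows out of the limit already built,
  so imposing it amounts to taking their inserter there. The older conditions survive by
  \<open>cone_precomp\<close>.\<close>

lemma (in poset_category) ineq_limit_inserter:
  assumes "is_ineq_limit C K D Q L c" "wf_ineqs C K D (insert (k, f, k', g) Q)"
    and "is_inserter C (f \<cdot> c k) (g \<cdot> c k') i"
  shows "is_ineq_limit C K D (insert (k, f, k', g) Q) (src C i) (\<lambda>k. c k \<cdot> i)"
proof -
  note L = is_ineq_limitD[OF assms(1)]
  obtain Z where f: "f \<in> hom C (D k) Z" "g \<in> hom C (D k') Z" "k \<in> K" "k' \<in> K"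
    and wf: "wf_ineqs C K D Q"
    using assms(2) by (auto simp: wf_ineqs_def)
  have fc: "f \<cdot> c k \<in> hom C L Z" "g \<cdot> c k' \<in> hom C L Z" using f L(3) cmp_hom by blast+
  have i: "ff C i" "i \<in> hom C (src C i) L" "(f \<cdot> c k) \<cdot> i \<sqsubseteq> (g \<cdot> c k') \<cdot> i"
    using assms(3) fc by (auto simp: is_inserter_def ff_def hom_def)
  have "f \<cdot> (c k \<cdot> i) \<sqsubseteq> g \<cdot> (c k' \<cdot> i)"
    using i cmp_assoc[OF i(2)] L(3) f by metis
  then have cone: "is_cone C K D (insert (k, f, k', g) Q) (src C i) (\<lambda>k. c k \<cdot> i)"
    using cone_precomp[OF L(2) wf i(2)] by (auto simp: is_cone_def)
  have uni: "\<exists>h \<in> hom C X (src C i). \<forall>j \<in> K. (c j \<cdot> i) \<cdot> h = x j"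
    if X: "X \<in> Ob C" "is_cone C K D (insert (k, f, k', g) Q) X x" for X x
  proof -
    have "is_cone C K D Q X x" using X by (auto simp: is_cone_def)
    then obtain u where u: "u \<in> hom C X L" "\<forall>j \<in> K. c j \<cdot> u = x j"
      using L(4) X by blast
    have "f \<cdot> x k \<sqsubseteq> g \<cdot> x k'" using X by (auto simp: is_cone_def)
    then have "(f \<cdot> c k) \<cdot> u \<sqsubseteq> (g \<cdot> c k') \<cdot> u" using cmp_assoc[OF u(1)] L(3) f u by metis
    then obtain h where h: "h \<in> hom C X (src C i)" "i \<cdot> h = u"
      using assms(3) X(1) u(1) hom_src[OF fc(1)] unfolding is_inserter_def by metis
    have "(c j \<cdot> i) \<cdot> h = x j" if "j \<in> K" for j
      using cmp_assoc[OF h(1) i(2) L(3)[OF that]] h u that by auto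
    then show ?thesis using h by blast
  qed
  have ord: "h \<sqsubseteq> h'" if X: "X \<in> Ob C" "h \<in> hom C X (src C i)" "h' \<in> hom C X (src C i)"
      "\<And>j. j \<in> K \<Longrightarrow> (c j \<cdot> i) \<cdot> h \<sqsubseteq> (c j \<cdot> i) \<cdot> h'" for X h h'
  proof -
    have "c j \<cdot> (i \<cdot> h) \<sqsubseteq> c j \<cdot> (i \<cdot> h')" if "j \<in> K" for j
      using cmp_assoc[OF _ i(2) L(3)[OF that]] X(2,3) X(4)[OF that] by metis
    then have "i \<cdot> h \<sqsubseteq> i \<cdot> h'" using L(5) X i cmp_hom by blast
    then show ?thesis using i X by (auto simp: ff_def)
  qed
  show ?thesis unfolding is_ineq_limit_def
    using cone uni ord hom_Ob(1)[OF i(2)] by simp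
qed

lemma is_inserterD:
  assumes "is_inserter C f g i" "f \<in> hom C X Y"
  shows "i \<in> hom C (src C i) X"
  using assms by (auto simp: is_inserter_def ff_def hom_def)

context pos_functor begin

lemma wf_map_ineqs:
  assumes "wf_ineqs C K E Q"
  shows "wf_ineqs D K (\<lambda>k. fob F (E k)) (map_ineqs (far F) Q)"
  using assms far_hom by (fastforce simp: wf_ineqs_def map_ineqs_def)

text \<open>The limit and its image are built in the same induction, on the indices and then on the
  conditions. Hence it is enough to have one preserved terminal object, one preserved product for
  each pair of objects and one preserved inserter for each parallel pair.\<close>

lemma ineq_limits_preserved:
  fixes E :: "'k \<Rightarrow> 'o"
  assumes terminal: "\<exists>T. is_terminal C T \<and> is_terminal D (fob F T)"
    and product: "\<And>X Y. \<lbrakk>X \<in> Ob C; Y \<in> Ob C\<rbrakk> \<Longrightarrow>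
      \<exists>p q. is_product C X Y p q \<and> is_product D (fob F X) (fob F Y) (far F p) (far F q)"
    and inserter: "\<And>X Y f g. \<lbrakk>f \<in> hom C X Y; g \<in> hom C X Y\<rbrakk> \<Longrightarrow>
      \<exists>i. is_inserter C f g i \<and> is_inserter D (far F f) (far F g) (far F i)"
    and K: "finite K" "\<And>k. k \<in> K \<Longrightarrow> E k \<in> Ob C"
    and Q: "finite Q" "wf_ineqs C K E Q"
  shows "\<exists>L c. is_ineq_limit C K E Q L c \<and>
    is_ineq_limit D K (\<lambda>k. fob F (E k)) (map_ineqs (far F) Q) (fob F L) (\<lambda>k. far F (c k))"
  using Q
proof (induction Q rule: finite_induct)
  case empty
  show ?case unfolding map_ineqs_def image_empty
    using K
  proof (induction K rule: finite_induct)
    case empty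
    then show ?case using terminal dom.ineq_limit_empty cod.ineq_limit_empty by blast
  next
    case (insert k K)
    then obtain L c where Lc: "is_ineq_limit C K E {} L c"
      "is_ineq_limit D K (\<lambda>k. fob F (E k)) {} (fob F L) (\<lambda>k. far F (c k))" by auto
    obtain p q where pq: "is_product C L (E k) p q"
      "is_product D (fob F L) (fob F (E k)) (far F p) (far F q)"
      using product is_ineq_limitD(1)[OF Lc(1)] insert.prems by blast
    have p: "p \<in> hom C (src C p) L"
      using pq by (auto simp: is_product_def jointly_order_mono_def hom_def)
    have src: "src D (far F p) = fob F (src C p)" using far_hom[OF p] by (simp add: hom_def)
    have eq: "far F (if i = k then q else c i \<cdot>\<^bsub>C\<^esub> p) =
        (if i = k then far F q else far F (c i) \<cdot>\<^bsub>D\<^esub> far F p)" if "i \<in> insert k K" for i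
      using that far_cmp[OF p] is_ineq_limitD(3)[OF Lc(1)] by auto
    note lim = cod.ineq_limit_product[OF Lc(2) pq(2) insert.hyps(2)]
    have "is_ineq_limit D (insert k K) (\<lambda>k. fob F (E k)) {} (fob F (src C p))
        (\<lambda>i. far F (if i = k then q else c i \<cdot>\<^bsub>C\<^esub> p))"
      using lim eq unfolding src by (simp add: is_ineq_limit_def is_cone_def)
    then show ?case
      using dom.ineq_limit_product[OF Lc(1) pq(1) insert.hyps(2)] by blast
  qed
next
  case (insert q Q)
  obtain k f k' g where q: "q = (k, f, k', g)" by (cases q) auto
  have wf: "wf_ineqs C K E Q" using insert.prems by (simp add: wf_ineqs_def)
  then obtain L c where Lc: "is_ineq_limit C K E Q L c"
    "is_ineq_limit D K (\<lambda>k. fob F (E k)) (map_ineqs (far F) Q) (fob F L) (\<lambda>k. far F (c k))"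
    using insert.IH by blast
  obtain Z where f: "f \<in> hom C (E k) Z" "g \<in> hom C (E k') Z" "k \<in> K" "k' \<in> K"
    using insert.prems q by (auto simp: wf_ineqs_def)
  note c = is_ineq_limitD(3)[OF Lc(1)]
  have fc: "f \<cdot>\<^bsub>C\<^esub> c k \<in> hom C L Z" "g \<cdot>\<^bsub>C\<^esub> c k' \<in> hom C L Z"
    using f c dom.cmp_hom by blast+
  obtain i where i: "is_inserter C (f \<cdot>\<^bsub>C\<^esub> c k) (g \<cdot>\<^bsub>C\<^esub> c k') i"
    "is_inserter D (far F f \<cdot>\<^bsub>D\<^esub> far F (c k)) (far F g \<cdot>\<^bsub>D\<^esub> far F (c k')) (far F i)"
    using inserter[OF fc] far_cmp c f by metis
  have ih: "i \<in> hom C (src C i) L" using is_inserterD[OF i(1) fc(1)] .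
  have src: "src D (far F i) = fob F (src C i)" using far_hom[OF ih] by (simp add: hom_def)
  have ins: "map_ineqs (far F) (Set.insert q Q) =
      Set.insert (k, far F f, k', far F g) (map_ineqs (far F) Q)"
    by (simp add: map_ineqs_def q)
  have eq: "far F (c j \<cdot>\<^bsub>C\<^esub> i) = far F (c j) \<cdot>\<^bsub>D\<^esub> far F i" if "j \<in> K" for j
    using far_cmp[OF ih] c that by blast
  have wfD: "wf_ineqs D K (\<lambda>k. fob F (E k)) (map_ineqs (far F) (Set.insert q Q))"
    using wf_map_ineqs insert.prems by blast
  have lim: "is_ineq_limit D K (\<lambda>k. fob F (E k)) (map_ineqs (far F) (Set.insert q Q))
      (fob F (src C i)) (\<lambda>j. far F (c j) \<cdot>\<^bsub>D\<^esub> far F i)"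
    using cod.ineq_limit_inserter[OF Lc(2) wfD[unfolded ins] i(2)] unfolding src ins .
  have "is_ineq_limit D K (\<lambda>k. fob F (E k)) (map_ineqs (far F) (Set.insert q Q))
      (fob F (src C i)) (\<lambda>j. far F (c j \<cdot>\<^bsub>C\<^esub> i))"
    using lim is_ineq_limit_cong[where c = "\<lambda>j. far F (c j \<cdot>\<^bsub>C\<^esub> i)", OF eq wfD] by blast
  then show ?case
    using dom.ineq_limit_inserter[OF Lc(1) insert.prems[unfolded q] i(1)] unfolding q by blast
qed

end

section \<open>Uniqueness of limits up to isomorphism\<close>

lemma (in poset_category) ineq_limit_iso:
  assumes lim: "is_ineq_limit C K D Q L c" and wf: "wf_ineqs C K D Q"
    and iso: "i \<in> hom C L' L" "i' \<in> hom C L L'" "i \<cdot> i' = ident C L" "i' \<cdot> i = ident C L'"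
    and c': "\<And>k. k \<in> K \<Longrightarrow> c' k = c k \<cdot> i"
  shows "is_ineq_limit C K D Q L' c'"
proof -
  note L = is_ineq_limitD[OF lim]
  have "is_cone C K D Q L' (\<lambda>k. c k \<cdot> i)" using cone_precomp L wf iso by blast
  then have cone: "is_cone C K D Q L' c'"
    using c' wf unfolding is_cone_def wf_ineqs_def by fastforce
  have ass: "c' k \<cdot> h = c k \<cdot> (i \<cdot> h)" if "k \<in> K" "h \<in> hom C X L'" for k h X
    using cmp_assoc[OF that(2) iso(1)] L(3) c' that by metis
  have uni: "\<exists>h \<in> hom C X L'. \<forall>k \<in> K. c' k \<cdot> h = d k"
    if X: "X \<in> Ob C" "is_cone C K D Q X d" for X d
  proof -
    obtain h where h: "h \<in> hom C X L" "\<forall>k \<in> K. c k \<cdot> h = d k" using L(4) X by blast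
    have h': "i' \<cdot> h \<in> hom C X L'" using cmp_hom h iso by blast
    have "i \<cdot> (i' \<cdot> h) = h" using cmp_assoc[OF h(1) iso(2,1)] iso ident_left h by metis
    then show ?thesis using h' h ass by metis
  qed
  have ord: "h \<sqsubseteq> h'" if X: "X \<in> Ob C" "h \<in> hom C X L'" "h' \<in> hom C X L'"
      "\<forall>k \<in> K. c' k \<cdot> h \<sqsubseteq> c' k \<cdot> h'" for X h h'
  proof -
    have "c k \<cdot> (i \<cdot> h) \<sqsubseteq> c k \<cdot> (i \<cdot> h')" if "k \<in> K" for k
      using X that ass by metis
    then have "i \<cdot> h \<sqsubseteq> i \<cdot> h'" using L(5) X iso cmp_hom by blast
    then have "i' \<cdot> (i \<cdot> h) \<sqsubseteq> i' \<cdot> (i \<cdot> h')" using cmp_mono_right iso X cmp_hom by metis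
    then show ?thesis
      using cmp_assoc[OF _ iso(1,2)] iso X ident_left by metis
  qed
  show ?thesis unfolding is_ineq_limit_def using cone uni ord hom_Ob iso by blast
qed

text \<open>Preservation concerns every limit, while the induction yields a single one; the
  comparison isomorphism transports the result from that one to all others.\<close>

lemma (in poset_category) ineq_limit_unique:
  assumes lim: "is_ineq_limit C K D Q L c" "is_ineq_limit C K D Q L' c'" and wf: "wf_ineqs C K D Q"
  obtains i i' where "i \<in> hom C L' L" "i' \<in> hom C L L'" "i \<cdot> i' = ident C L" "i' \<cdot> i = ident C L'"
    "\<And>k. k \<in> K \<Longrightarrow> c' k = c k \<cdot> i"
proof -
  note L = is_ineq_limitD[OF lim(1)] and L' = is_ineq_limitD[OF lim(2)]
  obtain i where i: "i \<in> hom C L' L" "\<forall>k \<in> K. c k \<cdot> i = c' k" using L(4)[OF L'(1,2)] by blast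
  obtain i' where i': "i' \<in> hom C L L'" "\<forall>k \<in> K. c' k \<cdot> i' = c k" using L'(4)[OF L(1,2)] by blast
  \<comment> \<open>An endomorphism compatible with the legs is compared with the identity in both
    directions; this serves for the two composites of \<open>i\<close> and
    \<open>i'\<close>.\<close>
  have eq: "h = ident C M" if "is_ineq_limit C K D Q M d" "h \<in> hom C M M" "\<forall>k\<in>K. d k \<cdot> h = d k" for M d h
  proof -
    note M = is_ineq_limitD[OF that(1)]
    have id: "ident C M \<in> hom C M M" "\<And>k. k \<in> K \<Longrightarrow> d k \<cdot> ident C M = d k"
      using ident_hom M ident_right by blast+
    have "h \<sqsubseteq> ident C M" "ident C M \<sqsubseteq> h"
      using M(5)[OF M(1)] that id leq_refl M(3) by metis+
    then show ?thesis using leq_antisym that id by blast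
  qed
  have "c k \<cdot> (i \<cdot> i') = c k" if "k \<in> K" for k
    using cmp_assoc[OF i'(1) i(1) L(3)[OF that]] i i' that by metis
  then have 1: "i \<cdot> i' = ident C L" using eq[OF lim(1)] cmp_hom i i' by blast
  have "c' k \<cdot> (i' \<cdot> i) = c' k" if "k \<in> K" for k
    using cmp_assoc[OF i(1) i'(1) L'(3)[OF that]] i i' that by metis
  then have 2: "i' \<cdot> i = ident C L'" using eq[OF lim(2)] cmp_hom i i' by blast
  show ?thesis using that i i' 1 2 by metis
qed

text \<open>A cylinder is a cone indexed by the elements of the weight. The first set expresses that
  legs are monotone in the element; the other two are the opposite inequalities that together say
  naturality. Identities are inserted wherever a bare leg occurs, since a condition always has an
  arrow in front of each leg.\<close>

definition weight_ineqs ::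
  "('o, 'a) pos_cat \<Rightarrow> ('j, 'u) pos_cat \<Rightarrow> ('j, 'u, 'w) weight \<Rightarrow> ('j, 'u, 'o, 'a) pos_fun
    \<Rightarrow> ('j \<times> 'w, 'a) ineq set" where
  "weight_ineqs C J W D =
     (\<lambda>(j, w, w'). ((j, w), ident C (fob D j), (j, w'), ident C (fob D j))) `
        {(j, w, w'). j \<in> Ob J \<and> w \<in> wob W j \<and> w' \<in> wob W j \<and> wle W j w w'} \<union>
     (\<lambda>(u, w). ((src J u, w), far D u, (tgt J u, war W u w), ident C (fob D (tgt J u)))) `
        Sigma (Arr J) (\<lambda>u. wob W (src J u)) \<union>
     (\<lambda>(u, w). ((tgt J u, war W u w), ident C (fob D (tgt J u)), (src J u, w), far D u)) `
        Sigma (Arr J) (\<lambda>u. wob W (src J u))"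

locale weighted_diagram = pos_functor J C D + pos_weight J W
  for J :: "('j, 'u) pos_cat" and C :: "('o, 'a) pos_cat" and D :: "('j, 'u, 'o, 'a) pos_fun"
    and W :: "('j, 'u, 'w) weight"
begin

abbreviation "els \<equiv> Sigma (Ob J) (wob W)"

lemma wf_weight_ineqs: "wf_ineqs C els (\<lambda>k. fob D (fst k)) (weight_ineqs C J W D)"
proof -
  have "ident C (fob D j) \<in> hom C (fob D j) (fob D j)" if "j \<in> Ob J" for j
    using that cod.ident_hom fob_Ob by blast
  moreover have "far D u \<in> hom C (fob D (src J u)) (fob D (tgt J u))" "src J u \<in> Ob J" "tgt J u \<in> Ob J"
    if "u \<in> Arr J" for u
    using far_hom[OF homI] dom.src_Ob dom.tgt_Ob that by simp_all
  moreover have "war W u w \<in> wob W (tgt J u)" if "u \<in> Arr J" "w \<in> wob W (src J u)" for u w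
    using war_wob[OF homI] that by simp
  moreover have "wf_ineqs C els E Q \<longleftrightarrow> (\<forall>(k, f, k', g) \<in> Q. k \<in> els \<and> k' \<in> els \<and>
      f \<in> Arr C \<and> g \<in> Arr C \<and> src C f = E k \<and> src C g = E k' \<and> tgt C f = tgt C g)" for E Q
    unfolding wf_ineqs_def hom_def by auto
  ultimately show ?thesis
    unfolding weight_ineqs_def by (simp add: ball_Un hom_def split_beta)
qed

lemma cylinder_iff_cone:
  "is_cylinder C J W D X c \<longleftrightarrow> is_cone C els (\<lambda>k. fob D (fst k)) (weight_ineqs C J W D) X (case_prod c)"
proof (cases "\<forall>j \<in> Ob J. \<forall>w \<in> wob W j. c j w \<in> hom C X (fob D j)")
  case False
  then show ?thesis by (auto simp: is_cylinder_def is_cone_def)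
next
  case c: True
  have id: "ident C (fob D j) \<cdot>\<^bsub>C\<^esub> c j w = c j w" if "j \<in> Ob J" "w \<in> wob W j" for j w
    using that c cod.ident_left by blast
  have eq: "far D u \<cdot>\<^bsub>C\<^esub> c i w = c j (war W u w) \<longleftrightarrow>
      far D u \<cdot>\<^bsub>C\<^esub> c i w \<sqsubseteq>\<^bsub>C\<^esub> ident C (fob D j) \<cdot>\<^bsub>C\<^esub> c j (war W u w) \<and>
      ident C (fob D j) \<cdot>\<^bsub>C\<^esub> c j (war W u w) \<sqsubseteq>\<^bsub>C\<^esub> far D u \<cdot>\<^bsub>C\<^esub> c i w"
    if "i \<in> Ob J" "j \<in> Ob J" "u \<in> hom J i j" "w \<in> wob W i" for i j u w
  proof -
    have "far D u \<cdot>\<^bsub>C\<^esub> c i w \<in> hom C X (fob D j)" "c j (war W u w) \<in> hom C X (fob D j)"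
      using that c far_hom cod.cmp_hom war_wob by blast+
    then show ?thesis
      using cod.leq_antisym cod.leq_refl cod.ident_left by metis
  qed
  have "is_cylinder C J W D X c \<longleftrightarrow>
    (\<forall>j \<in> Ob J. \<forall>w \<in> wob W j. \<forall>w' \<in> wob W j. wle W j w w' \<longrightarrow>
        ident C (fob D j) \<cdot>\<^bsub>C\<^esub> c j w \<sqsubseteq>\<^bsub>C\<^esub> ident C (fob D j) \<cdot>\<^bsub>C\<^esub> c j w') \<and>
    (\<forall>u \<in> Arr J. \<forall>w \<in> wob W (src J u).
        far D u \<cdot>\<^bsub>C\<^esub> c (src J u) w \<sqsubseteq>\<^bsub>C\<^esub> ident C (fob D (tgt J u)) \<cdot>\<^bsub>C\<^esub> c (tgt J u) (war W u w) \<and>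
        ident C (fob D (tgt J u)) \<cdot>\<^bsub>C\<^esub> c (tgt J u) (war W u w) \<sqsubseteq>\<^bsub>C\<^esub> far D u \<cdot>\<^bsub>C\<^esub> c (src J u) w)"
  proof -
    have "(\<forall>i \<in> Ob J. \<forall>j \<in> Ob J. \<forall>u \<in> hom J i j. P i j u) \<longleftrightarrow> (\<forall>u \<in> Arr J. P (src J u) (tgt J u) u)" for P
      using homI dom.src_Ob dom.tgt_Ob by (auto simp: hom_def)
    then show ?thesis unfolding is_cylinder_def using c id eq homI dom.src_Ob dom.tgt_Ob by simp
  qed
  also have "\<dots> \<longleftrightarrow> is_cone C els (\<lambda>k. fob D (fst k)) (weight_ineqs C J W D) X (case_prod c)"
    unfolding is_cone_def weight_ineqs_def using c by (auto simp: ball_Un)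
  finally show ?thesis .
qed

lemma weighted_limit_iff:
  "is_weighted_limit C J W D L c \<longleftrightarrow>
    is_ineq_limit C els (\<lambda>k. fob D (fst k)) (weight_ineqs C J W D) L (case_prod c)"
    (is "?l \<longleftrightarrow> ?r")
proof
  assume l: ?l
  have "\<exists>h \<in> hom C X L. \<forall>k \<in> els. case_prod c k \<cdot>\<^bsub>C\<^esub> h = d k"
    if "X \<in> Ob C" "is_cone C els (\<lambda>k. fob D (fst k)) (weight_ineqs C J W D) X d" for X d
  proof -
    have "is_cylinder C J W D X (curry d)" using that(2) cylinder_iff_cone by simp
    then have "\<exists>!h. h \<in> hom C X L \<and> (\<forall>j \<in> Ob J. \<forall>w \<in> wob W j. c j w \<cdot>\<^bsub>C\<^esub> h = curry d j w)"
      using that(1) l unfolding is_weighted_limit_def by blast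
    then show ?thesis by fastforce
  qed
  moreover have "h \<sqsubseteq>\<^bsub>C\<^esub> k" if "X \<in> Ob C" "h \<in> hom C X L" "k \<in> hom C X L"
    "\<forall>e \<in> els. case_prod c e \<cdot>\<^bsub>C\<^esub> h \<sqsubseteq>\<^bsub>C\<^esub> case_prod c e \<cdot>\<^bsub>C\<^esub> k" for X h k
  proof -
    have "\<forall>j \<in> Ob J. \<forall>w \<in> wob W j. c j w \<cdot>\<^bsub>C\<^esub> h \<sqsubseteq>\<^bsub>C\<^esub> c j w \<cdot>\<^bsub>C\<^esub> k" using that(4) by auto
    then show ?thesis using l that(1-3) unfolding is_weighted_limit_def by blast
  qed
  moreover have "L \<in> Ob C" "is_cylinder C J W D L c"
    using l by (simp_all add: is_weighted_limit_def)
  ultimately show ?r using cylinder_iff_cone unfolding is_ineq_limit_def by blast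
next
  assume r: ?r
  note R = is_ineq_limitD[OF r]
  have "\<exists>!h. h \<in> hom C X L \<and> (\<forall>j \<in> Ob J. \<forall>w \<in> wob W j. c j w \<cdot>\<^bsub>C\<^esub> h = d j w)"
    if X: "X \<in> Ob C" "is_cylinder C J W D X d" for X d
  proof -
    obtain h where h: "h \<in> hom C X L" "\<forall>k \<in> els. case_prod c k \<cdot>\<^bsub>C\<^esub> h = case_prod d k"
      using R(4) X cylinder_iff_cone by blast
    have d: "d j w \<in> hom C X (fob D j)" if "j \<in> Ob J" "w \<in> wob W j" for j w
      using X that by (simp add: is_cylinder_def)
    have "h' = h" if h': "h' \<in> hom C X L" "\<forall>j \<in> Ob J. \<forall>w \<in> wob W j. c j w \<cdot>\<^bsub>C\<^esub> h' = d j w" for h'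
    proof -
      have "h \<sqsubseteq>\<^bsub>C\<^esub> h'" "h' \<sqsubseteq>\<^bsub>C\<^esub> h"
        by (rule R(5)[OF X(1)]; use h h' d cod.leq_refl in fastforce)+
      then show ?thesis using cod.leq_antisym h h' by blast
    qed
    then show ?thesis using h(1) h(2)[simplified] by (intro ex1I[of _ h] conjI) blast+
  qed
  moreover have "h \<sqsubseteq>\<^bsub>C\<^esub> k" if "X \<in> Ob C" "h \<in> hom C X L" "k \<in> hom C X L"
    "\<forall>j \<in> Ob J. \<forall>w \<in> wob W j. c j w \<cdot>\<^bsub>C\<^esub> h \<sqsubseteq>\<^bsub>C\<^esub> c j w \<cdot>\<^bsub>C\<^esub> k" for X h k
    by (rule R(5)[OF that(1-3)]) (use that(4) in auto)
  ultimately show ?l unfolding is_weighted_limit_def using R(1,2) cylinder_iff_cone by blast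
qed

lemma finite_weight_ineqs:
  assumes "finite (Ob J)" "finite (Arr J)" "\<forall>j \<in> Ob J. finite (wob W j)"
  shows "finite els" "finite (weight_ineqs C J W D)"
proof -
  show els: "finite els" using assms by blast
  have "{(j, w, w'). j \<in> Ob J \<and> w \<in> wob W j \<and> w' \<in> wob W j \<and> wle W j w w'} \<subseteq>
      Sigma (Ob J) (\<lambda>j. wob W j \<times> wob W j)" by auto
  moreover have "finite (Sigma (Arr J) (\<lambda>u. wob W (src J u)))"
    using assms dom.src_Ob by blast
  ultimately show "finite (weight_ineqs C J W D)"
    unfolding weight_ineqs_def using assms by (meson finite_SigmaI finite_UnI finite_cartesian_product
        finite_imageI finite_subset)
qed

end

text \<open>Existence and preservation come out of one argument because a limit is constructed
  together with its image. For the identity functor the assumptions only ask that the three kinds of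
  limit exist.\<close>

lemma (in pos_functor) preserves_finite_weighted_limitsI:
  assumes terminal: "\<exists>T. is_terminal C T \<and> is_terminal D (fob F T)"
    and product: "\<And>X Y. \<lbrakk>X \<in> Ob C; Y \<in> Ob C\<rbrakk> \<Longrightarrow>
      \<exists>p q. is_product C X Y p q \<and> is_product D (fob F X) (fob F Y) (far F p) (far F q)"
    and inserter: "\<And>X Y f g. \<lbrakk>f \<in> hom C X Y; g \<in> hom C X Y\<rbrakk> \<Longrightarrow>
      \<exists>i. is_inserter C f g i \<and> is_inserter D (far F f) (far F g) (far F i)"
  shows "has_finite_weighted_limits C" "preserves_finite_weighted_limits C D F"
proof -
  have main: "(\<exists>L c. is_weighted_limit C J W G L c) \<and> (\<forall>L c. is_weighted_limit C J W G L c \<longrightarrow>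
      is_weighted_limit D J W \<lparr>fob = \<lambda>j. fob F (fob G j), far = \<lambda>u. far F (far G u)\<rparr>
        (fob F L) (\<lambda>j w. far F (c j w)))"
    if fw: "finite_weight J W" and G: "pos_functor J C G"
    for J :: "(nat, nat) pos_cat" and W :: "(nat, nat, nat) weight" and G
  proof -
    let ?FG = "\<lparr>fob = \<lambda>j. fob F (fob G j), far = \<lambda>u. far F (far G u)\<rparr>"
    interpret G: pos_functor J C G by fact
    interpret W: pos_weight J W using fw by (simp add: finite_weight_def)
    interpret WC: weighted_diagram J C G W ..
    interpret FG: pos_functor J D ?FG
      by unfold_locales
        (auto simp: G.fob_Ob fob_Ob G.far_ident far_ident G.far_cmp
          intro: far_hom G.far_hom far_cmp far_mono G.far_mono)
    interpret WD: weighted_diagram J D ?FG W ..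
    have fin: "finite (Ob J)" "finite (Arr J)" "\<forall>j \<in> Ob J. finite (wob W j)"
      using fw by (simp_all add: finite_weight_def)
    have "far F (ident C (fob G j)) = ident D (fob F (fob G j))" if "j \<in> Ob J" for j
      using that far_ident G.fob_Ob by blast
    \<comment> \<open>The inserted identities go to identities, so the image of the conditions is
      the set of conditions of the composite diagram.\<close>
    then have eq: "map_ineqs (far F) (weight_ineqs C J W G) = weight_ineqs D J W ?FG"
      unfolding map_ineqs_def weight_ineqs_def image_Un image_image
      using G.dom.tgt_Ob by (intro arg_cong2[where f = "(\<union>)"] image_cong) auto
    have ob: "\<And>k. k \<in> WC.els \<Longrightarrow> fob G (fst k) \<in> Ob C" using G.fob_Ob by auto
    obtain L c where Lc: "is_ineq_limit C WC.els (\<lambda>k. fob G (fst k)) (weight_ineqs C J W G) L c"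
      "is_ineq_limit D WC.els (\<lambda>k. fob F (fob G (fst k))) (weight_ineqs D J W ?FG)
         (fob F L) (\<lambda>k. far F (c k))"
      using ineq_limits_preserved[OF terminal _ _ WC.finite_weight_ineqs(1)[OF fin] ob
          WC.finite_weight_ineqs(2)[OF fin] WC.wf_weight_ineqs] product inserter
      unfolding eq by blast
    have "is_weighted_limit C J W G L (curry c)" using WC.weighted_limit_iff Lc by simp
    moreover have "is_weighted_limit D J W ?FG (fob F L') (\<lambda>j w. far F (c' j w))"
      if "is_weighted_limit C J W G L' c'" for L' c'
    proof -
      have L': "is_ineq_limit C WC.els (\<lambda>k. fob G (fst k)) (weight_ineqs C J W G) L' (case_prod c')"
        using that WC.weighted_limit_iff by blast
      obtain i i' where i: "i \<in> hom C L' L" "i' \<in> hom C L L'" "i \<cdot>\<^bsub>C\<^esub> i' = ident C L"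
        "i' \<cdot>\<^bsub>C\<^esub> i = ident C L'" "\<And>k. k \<in> WC.els \<Longrightarrow> case_prod c' k = c k \<cdot>\<^bsub>C\<^esub> i"
        using dom.ineq_limit_unique[OF Lc(1) L' WC.wf_weight_ineqs] by metis
      have inv: "far F i \<cdot>\<^bsub>D\<^esub> far F i' = ident D (fob F L)"
        "far F i' \<cdot>\<^bsub>D\<^esub> far F i = ident D (fob F L')"
        using far_cmp[OF i(1,2)] far_cmp[OF i(2,1)] i(3,4) far_ident
          is_ineq_limitD(1)[OF Lc(1)] is_ineq_limitD(1)[OF L'] by metis+
      have "far F (case_prod c' k) = far F (c k) \<cdot>\<^bsub>D\<^esub> far F i" if "k \<in> WC.els" for k
        using far_cmp[OF i(1) is_ineq_limitD(3)[OF Lc(1) that]] i(5)[OF that] by simp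
      then have "is_ineq_limit D WC.els (\<lambda>k. fob F (fob G (fst k))) (weight_ineqs D J W ?FG)
         (fob F L') (\<lambda>k. far F (case_prod c' k))"
        using cod.ineq_limit_iso[OF Lc(2) _ far_hom[OF i(1)] far_hom[OF i(2)] inv]
          WD.wf_weight_ineqs by simp
      then show ?thesis
        using WD.weighted_limit_iff[of "fob F L'" "\<lambda>j w. far F (c' j w)"]
        by (simp add: case_prod_unfold)
    qed
    ultimately show ?thesis by blast
  qed
  show "has_finite_weighted_limits C" unfolding has_finite_weighted_limits_def using main by blast
  show "preserves_finite_weighted_limits C D F"
    unfolding preserves_finite_weighted_limits_def using main by blast
qed

abbreviation id_fun :: "('o, 'a, 'o, 'a) pos_fun" where
  "id_fun \<equiv> \<lparr>fob = \<lambda>X. X, far = \<lambda>f. f\<rparr>"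

lemma (in poset_category) id_functor:
  shows "pos_functor C C id_fun"
  by unfold_locales simp_all

context poset_category
begin

lemma has_finite_weighted_limitsI:
  assumes "\<exists>T. is_terminal C T"
    and "\<And>X Y. \<lbrakk>X \<in> Ob C; Y \<in> Ob C\<rbrakk> \<Longrightarrow> \<exists>p q. is_product C X Y p q"
    and "\<And>X Y f g. \<lbrakk>f \<in> hom C X Y; g \<in> hom C X Y\<rbrakk> \<Longrightarrow> \<exists>i. is_inserter C f g i"
  shows "has_finite_weighted_limits C"
  using pos_functor.preserves_finite_weighted_limitsI(1)[OF id_functor] assms by simp

end

section \<open>Elementary facts on regular categories\<close>

definition par_cat :: "nat set \<Rightarrow> nat set \<Rightarrow> (nat, nat) pos_cat" where
  "par_cat V A = \<lparr>Ob = V, Arr = V \<union> A, src = \<lambda>u. if u < 2 then u else 0,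
     tgt = \<lambda>u. if u < 2 then u else 1, ident = \<lambda>j. j, cmp = \<lambda>g f. if f < 2 then g else f, leq = (=)\<rparr>"

text \<open>In \<open>par_cat\<close> the numbers 0 and 1 are the objects and also their identities,
  2 and 3 the parallel arrows from 0 to 1. With both arrows present the weight sends 0 to a point
  and 1 to the chain 0 below 1, arrow 2 picking the bottom and arrow 3 the top: the weight for
  inserters. Without arrows every value is a point, which gives the product of two objects and, for
  no objects, the terminal object.\<close>

definition par_weight :: "nat set \<Rightarrow> (nat, nat, nat) weight" where
  "par_weight A = \<lparr>wob = \<lambda>j. if A = {} \<or> j = 0 then {0} else {0, 1}, wle = \<lambda>_. (\<le>),
     war = \<lambda>u w. if u = 2 then 0 else if u = 3 then 1 else w\<rparr>"

definition par_diag :: "('o, 'a) pos_cat \<Rightarrow> 'o \<Rightarrow> 'o \<Rightarrow> 'a \<Rightarrow> 'a \<Rightarrow> (nat, nat, 'o, 'a) pos_fun" where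
  "par_diag C X Y f g = \<lparr>fob = \<lambda>j. if j = 0 then X else Y,
     far = \<lambda>u. if u = 0 then ident C X else if u = 1 then ident C Y else if u = 2 then f else g\<rparr>"

lemma hom_par_cat:
  assumes "V \<subseteq> {0, 1}" "A \<subseteq> {2, 3}"
  shows "u \<in> hom (par_cat V A) i j \<longleftrightarrow> u \<in> V \<and> i = u \<and> j = u \<or> u \<in> A \<and> i = 0 \<and> j = 1"
  using assms by (auto simp: par_cat_def hom_def)

lemma finite_par_weight:
  assumes V: "V \<subseteq> {0, 1}" and A: "A \<subseteq> {2, 3}" and VA: "A = {} \<or> V = {0, 1}"
  shows "finite_weight (par_cat V A) (par_weight A)"
proof -
  have v: "u = 0 \<or> u = 1" if "u \<in> V" for u using V that by auto
  have a: "u = 2 \<or> u = 3" if "u \<in> A" for u using A that by auto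
  have uv: "0 \<in> V" "1 \<in> V" if "u \<in> A" for u using VA that by auto
  note h = hom_par_cat[OF V A]
  have "pos_weight (par_cat V A) (par_weight A)"
    by (unfold_locales; (unfold h)?; (elim disjE conjE)?)
      (auto simp: par_cat_def par_weight_def dest: v a uv split: if_splits)
  moreover have "finite V" "finite A" using assms finite_subset by blast+
  ultimately show ?thesis
    by (simp add: finite_weight_def par_cat_def par_weight_def)
qed

context poset_category
begin

lemma par_diag_functor:
  assumes "V \<subseteq> {0, 1}" "A \<subseteq> {2, 3}" "A = {} \<or> V = {0, 1}" "V = {} \<or> X \<in> Ob C \<and> Y \<in> Ob C"
    "A \<noteq> {} \<Longrightarrow> f \<in> hom C X Y \<and> g \<in> hom C X Y"
  shows "pos_functor (par_cat V A) C (par_diag C X Y f g)"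
proof -
  have cat: "pos_category (par_cat V A)"
    using finite_par_weight[OF assms(1-3)] by (simp add: finite_weight_def pos_weight_def)
  have v: "u = 0 \<or> u = 1" if "u \<in> V" for u using assms(1) that by auto
  have a: "u = 2 \<or> u = 3" if "u \<in> A" for u using assms(2) that by auto
  have uv: "0 \<in> V" "1 \<in> V" if "u \<in> A" for u using assms(3) that by auto
  note h = hom_par_cat[OF assms(1,2)]
  have idV: "ident C X \<in> hom C X X" "ident C Y \<in> hom C Y Y" if "u \<in> V" for u
    using assms(4) ident_hom that by auto
  have fg: "f \<in> hom C X Y" "g \<in> hom C X Y" if "u \<in> A" for u
    using assms(5) that by auto
  have far: "far (par_diag C X Y f g) u \<in> hom C (fob (par_diag C X Y f g) i) (fob (par_diag C X Y f g) j)"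
    if "u \<in> hom (par_cat V A) i j" for u i j
    using that unfolding h using v[of u] a[of u] idV[of u] fg[of u] by (auto simp: par_diag_def)
  interpret J: pos_category "par_cat V A" by (rule cat)
  show ?thesis
  proof (unfold_locales, goal_cases)
    case (1 j) then show ?case using assms(1,4) by (auto simp: par_cat_def par_diag_def)
  next
    case 2 then show ?case by (rule far)
  next
    case (3 j) then show ?case using assms(1) by (auto simp: par_cat_def par_diag_def)
  next
    case (4 u i j w k)
    note F = far[OF 4(1)] far[OF 4(2)]
    show ?case
    proof (cases "u \<in> A")
      case True
      then have "w = 1" "w \<cdot>\<^bsub>par_cat V A\<^esub> u = u" "j = 1"
        using 4 a[of u] a[of w] v[of w] unfolding h by (auto simp: par_cat_def)
      then show ?thesis using ident_left[OF F(1)] by (simp add: par_diag_def)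
    next
      case False
      then have "w \<cdot>\<^bsub>par_cat V A\<^esub> u = w" "far (par_diag C X Y f g) u = ident C (fob (par_diag C X Y f g) j)"
        using 4(1) v[of u] unfolding h by (auto simp: par_cat_def par_diag_def)
      then show ?thesis using ident_right[OF F(2)] by simp
    qed
  next
    case (5 u i j w)
    then show ?case using leq_refl[OF far[OF 5(1)]] by (simp add: par_cat_def)
  qed
qed

lemma par_limit:
  assumes "has_finite_weighted_limits C"
    and "V \<subseteq> {0, 1}" "A \<subseteq> {2, 3}" "A = {} \<or> V = {0, 1}" "V = {} \<or> X \<in> Ob C \<and> Y \<in> Ob C"
    "A \<noteq> {} \<Longrightarrow> f \<in> hom C X Y \<and> g \<in> hom C X Y"
  obtains L c where "is_weighted_limit C (par_cat V A) (par_weight A) (par_diag C X Y f g) L c"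
  using assms(1) finite_par_weight[OF assms(2-4)] par_diag_functor[OF assms(2-6)]
  unfolding has_finite_weighted_limits_def by blast

lemma terminal_exists:
  assumes "has_finite_weighted_limits C"
  shows "\<exists>T. is_terminal C T"
proof -
  obtain L c where
    "is_weighted_limit C (par_cat {} {}) (par_weight {}) (par_diag C undefined undefined undefined undefined) L c"
    using par_limit[OF assms, of "{}" "{}" undefined undefined undefined undefined] by auto
  then have "is_terminal C L"
    by (auto simp: is_weighted_limit_def is_cylinder_def par_cat_def is_terminal_def)
  then show ?thesis ..
qed

lemma product_exists:
  assumes "has_finite_weighted_limits C" "X \<in> Ob C" "Y \<in> Ob C"
  shows "\<exists>p q. is_product C X Y p q"
proof -
  let ?J = "par_cat {0, 1} {}" and ?W = "par_weight {}" and ?D = "par_diag C X Y undefined undefined"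
  obtain L c where lim: "is_weighted_limit C ?J ?W ?D L c"
    using par_limit[OF assms(1), of "{0, 1}" "{}" X Y undefined undefined] assms by auto
  have homJ: "hom ?J i j = (if i = j \<and> i \<in> {0, 1} then {i} else {})" for i j
    by (auto simp: par_cat_def hom_def)
  have cyl: "is_cylinder C ?J ?W ?D Z d \<longleftrightarrow> d 0 0 \<in> hom C Z X \<and> d 1 0 \<in> hom C Z Y" for Z d
    unfolding is_cylinder_def homJ using ident_left leq_refl
    by (auto simp: par_cat_def par_weight_def par_diag_def)
  have c: "L \<in> Ob C" "c 0 0 \<in> hom C L X" "c 1 0 \<in> hom C L Y"
    using lim cyl by (auto simp: is_weighted_limit_def)
  have "\<exists>h \<in> hom C Z L. c 0 0 \<cdot> h = u \<and> c 1 0 \<cdot> h = v"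
    if "Z \<in> Ob C" "u \<in> hom C Z X" "v \<in> hom C Z Y" for Z u v
  proof -
    have "is_cylinder C ?J ?W ?D Z (\<lambda>j w. if j = 0 then u else v)" using cyl that by simp
    then have "\<exists>h. h \<in> hom C Z L \<and> (\<forall>j \<in> Ob ?J. \<forall>w \<in> wob ?W j. c j w \<cdot> h = (\<lambda>j w. if j = 0 then u else v) j w)"
      using lim that(1) unfolding is_weighted_limit_def by blast
    then show ?thesis by (auto simp: par_cat_def par_weight_def)
  qed
  moreover have "h \<sqsubseteq> k" if "Z \<in> Ob C" "h \<in> hom C Z L" "k \<in> hom C Z L"
    "c 0 0 \<cdot> h \<sqsubseteq> c 0 0 \<cdot> k" "c 1 0 \<cdot> h \<sqsubseteq> c 1 0 \<cdot> k" for Z h k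
    using lim that unfolding is_weighted_limit_def by (simp add: par_cat_def par_weight_def)
  ultimately have "is_product C X Y (c 0 0) (c 1 0)"
    using c unfolding is_product_def jointly_order_mono_def
    by (simp add: hom_src[OF c(2)] hom_src[OF c(3)] hom_tgt[OF c(2)] hom_tgt[OF c(3)] hom_Arr[OF c(2)] hom_Arr[OF c(3)]
        del: One_nat_def)
  then show ?thesis by blast
qed

lemma inserter_exists:
  assumes "has_finite_weighted_limits C" and f: "f \<in> hom C X Y" "g \<in> hom C X Y"
  shows "\<exists>i. is_inserter C f g i"
proof -
  let ?J = "par_cat {0, 1} {2, 3}" and ?W = "par_weight {2, 3}" and ?D = "par_diag C X Y f g"
  have XY: "X \<in> Ob C" "Y \<in> Ob C" using hom_Ob f by blast+
  obtain L c where lim: "is_weighted_limit C ?J ?W ?D L c"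
    using par_limit[OF assms(1), of "{0, 1}" "{2, 3}" X Y f g] f XY by auto
  have homJ: "hom ?J i j = (if i = j \<and> i \<in> {0, 1} then {i} else if i = 0 \<and> j = 1 then {2, 3} else {})"
    for i j by (auto simp: par_cat_def hom_def)
  \<comment> \<open>Naturality along arrows 2 and 3 forces the two legs at object 1 to be the
    composites of the leg at 0 with \<open>f\<close> and \<open>g\<close>; monotonicity along 0
    below 1 becomes the inequality of the inserter.\<close>
  have cyl: "is_cylinder C ?J ?W ?D Z d \<longleftrightarrow> d 0 0 \<in> hom C Z X \<and> d 1 0 = f \<cdot> d 0 0 \<and> d 1 1 = g \<cdot> d 0 0 \<and>
     f \<cdot> d 0 0 \<sqsubseteq> g \<cdot> d 0 0" (is "?l \<longleftrightarrow> ?r") for Z d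
  proof
    assume ?l
    then show ?r unfolding is_cylinder_def homJ
      by (auto simp: par_cat_def par_weight_def par_diag_def)
  next
    assume r: ?r
    have "f \<cdot> d 0 0 \<in> hom C Z Y" "g \<cdot> d 0 0 \<in> hom C Z Y" using r f cmp_hom by blast+
    then show ?l using r unfolding is_cylinder_def homJ
      using ident_left leq_refl
      by (auto simp: par_cat_def par_weight_def par_diag_def)
  qed
  have c: "L \<in> Ob C" "c 0 0 \<in> hom C L X" "c 1 0 = f \<cdot> c 0 0" "c 1 1 = g \<cdot> c 0 0" "f \<cdot> c 0 0 \<sqsubseteq> g \<cdot> c 0 0"
    using lim cyl by (auto simp: is_weighted_limit_def)
  have "\<exists>h \<in> hom C Z L. c 0 0 \<cdot> h = x"
    if "Z \<in> Ob C" "x \<in> hom C Z X" "f \<cdot> x \<sqsubseteq> g \<cdot> x" for Z x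
  proof -
    have "is_cylinder C ?J ?W ?D Z (\<lambda>j w. if j = 0 then x else if w = 0 then f \<cdot> x else g \<cdot> x)"
      using cyl that by simp
    then have "\<exists>h. h \<in> hom C Z L \<and> (\<forall>j \<in> Ob ?J. \<forall>w \<in> wob ?W j. c j w \<cdot> h = (\<lambda>j w. if j = 0 then x else if w = 0 then f \<cdot> x else g \<cdot> x) j w)"
      using lim that(1) unfolding is_weighted_limit_def by blast
    then show ?thesis by (auto simp: par_cat_def par_weight_def)
  qed
  moreover have "h \<sqsubseteq> k" if h: "Z \<in> Ob C" "h \<in> hom C Z L" "k \<in> hom C Z L"
    "c 0 0 \<cdot> h \<sqsubseteq> c 0 0 \<cdot> k" for Z h k
  proof -
    \<comment> \<open>The order clause of the limit inspects all three legs; for the two at object 1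
      the inequality follows by monotonicity from the leg at 0.\<close>
    have "(f' \<cdot> c 0 0) \<cdot> h \<sqsubseteq> (f' \<cdot> c 0 0) \<cdot> k" if "f' \<in> hom C X Y" for f'
    proof -
      have "f' \<cdot> (c 0 0 \<cdot> h) \<sqsubseteq> f' \<cdot> (c 0 0 \<cdot> k)"
        using cmp_mono_right[OF cmp_hom[OF h(2) c(2)] cmp_hom[OF h(3) c(2)] that h(4)] .
      then show ?thesis using cmp_assoc[OF h(2) c(2) that] cmp_assoc[OF h(3) c(2) that] by simp
    qed
    then show ?thesis
      using lim h f c(3,4) unfolding is_weighted_limit_def by (simp add: par_cat_def par_weight_def)
  qed
  ultimately have "is_inserter C f g (c 0 0)"
    using c f unfolding is_inserter_def ff_def
    by (simp add: hom_src[OF c(2)] hom_tgt[OF c(2)] hom_Arr[OF c(2)] hom_src[OF f(1)])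
  then show ?thesis by blast
qed

section \<open>Orthogonality of so- and ff-morphisms\<close>

lemma ffD: "\<lbrakk>ff C m; m \<in> hom C X Y; f \<in> hom C Z X; g \<in> hom C Z X; m \<cdot> f \<sqsubseteq> m \<cdot> g\<rbrakk> \<Longrightarrow> f \<sqsubseteq> g"
  using hom_Ob unfolding ff_def by (metis hom_src)

lemma ff_mono: "\<lbrakk>ff C m; m \<in> hom C X Y; f \<in> hom C Z X; g \<in> hom C Z X; m \<cdot> f = m \<cdot> g\<rbrakk> \<Longrightarrow> f = g"
  using leq_antisym[of f Z X g] ffD[of m X Y f Z g] ffD[of m X Y g Z f] leq_refl[OF cmp_hom, of f Z X m Y] by simp

lemma ffI:
  assumes "m \<in> hom C X Y"
    and "\<And>Z f g. \<lbrakk>f \<in> hom C Z X; g \<in> hom C Z X; m \<cdot> f \<sqsubseteq> m \<cdot> g\<rbrakk> \<Longrightarrow> f \<sqsubseteq> g"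
  shows "ff C m"
  using assms hom_src[OF assms(1)] hom_Arr[OF assms(1)] by (auto simp: ff_def)

lemma ff_cmp:
  assumes "ff C m" "ff C n" "m \<in> hom C X Y" "n \<in> hom C Y Z"
  shows "ff C (n \<cdot> m)"
proof (rule ffI[OF cmp_hom[OF assms(3,4)]])
  fix A f g assume fg: "f \<in> hom C A X" "g \<in> hom C A X" "(n \<cdot> m) \<cdot> f \<sqsubseteq> (n \<cdot> m) \<cdot> g"
  then have "n \<cdot> (m \<cdot> f) \<sqsubseteq> n \<cdot> (m \<cdot> g)"
    using cmp_assoc[OF fg(1) assms(3,4)] cmp_assoc[OF fg(2) assms(3,4)] by simp
  then show "f \<sqsubseteq> g"
    using ffD[OF assms(1,3) fg(1,2)] ffD[OF assms(2,4)] cmp_hom[OF fg(1) assms(3)] cmp_hom[OF fg(2) assms(3)]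
    by blast
qed

lemma ff_ident: "X \<in> Ob C \<Longrightarrow> ff C (ident C X)"
  by (rule ffI[OF ident_hom]) (simp_all add: ident_left)

text \<open>The order part of the definition of \<^const>\<open>so\<close> is automatic, \<open>m\<close> being an
  \<open>ff\<close>-morphism, so being an \<open>so\<close>-morphism amounts to a fill-in property.\<close>

lemma so_iff:
  assumes e: "e \<in> hom C A B"
  shows "so C e \<longleftrightarrow> (\<forall>X Y m f g. ff C m \<and> m \<in> hom C X Y \<and> f \<in> hom C A X \<and> g \<in> hom C B Y \<and>
    m \<cdot> f = g \<cdot> e \<longrightarrow> (\<exists>h \<in> hom C B X. h \<cdot> e = f \<and> m \<cdot> h = g))" (is "_ \<longleftrightarrow> ?r")
proof
  assume so: "so C e"
  show ?r
  proof (intro allI impI, elim conjE)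
    fix X Y m f g assume m: "ff C m" "m \<in> hom C X Y" and fg: "f \<in> hom C A X" "g \<in> hom C B Y" "m \<cdot> f = g \<cdot> e"
    have "bij_betw (\<lambda>h. (h \<cdot> e, m \<cdot> h)) (hom C B (src C m))
        {(f, g). f \<in> hom C A (src C m) \<and> g \<in> hom C B (tgt C m) \<and> m \<cdot> f = g \<cdot> e}"
      using so m(1) unfolding so_def hom_src[OF e] hom_tgt[OF e] by blast
    then have "(f, g) \<in> (\<lambda>h. (h \<cdot> e, m \<cdot> h)) ` hom C B X"
      using fg by (simp add: bij_betw_def hom_src[OF m(2)] hom_tgt[OF m(2)])
    then show "\<exists>h \<in> hom C B X. h \<cdot> e = f \<and> m \<cdot> h = g" by auto
  qed
next
  assume r: ?r
  have "bij_betw (\<lambda>h. (h \<cdot> e, m \<cdot> h)) (hom C B (src C m))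
        {(f, g). f \<in> hom C A (src C m) \<and> g \<in> hom C B (tgt C m) \<and> m \<cdot> f = g \<cdot> e}" if "ff C m" for m
  proof -
    have m: "m \<in> hom C (src C m) (tgt C m)" using that by (simp add: ff_def homI)
    have "h = k" if "h \<in> hom C B (src C m)" "k \<in> hom C B (src C m)" "m \<cdot> h = m \<cdot> k" for h k
      using ff_mono[OF \<open>ff C m\<close> m] that by blast
    then have "inj_on (\<lambda>h. (h \<cdot> e, m \<cdot> h)) (hom C B (src C m))" by (auto intro: inj_onI)
    moreover have "(h \<cdot> e, m \<cdot> h) \<in> {(f, g). f \<in> hom C A (src C m) \<and> g \<in> hom C B (tgt C m) \<and> m \<cdot> f = g \<cdot> e}"
      if "h \<in> hom C B (src C m)" for h
      using that cmp_hom[OF e that] cmp_hom[OF that m] cmp_assoc[OF e that m] by simp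
    moreover have "(f, g) \<in> (\<lambda>h. (h \<cdot> e, m \<cdot> h)) ` hom C B (src C m)"
      if "f \<in> hom C A (src C m)" "g \<in> hom C B (tgt C m)" "m \<cdot> f = g \<cdot> e" for f g
      using r \<open>ff C m\<close> m that by (metis (no_types, lifting) image_eqI)
    ultimately show ?thesis unfolding bij_betw_def by blast
  qed
  moreover have "h \<sqsubseteq> k" if "ff C m" "h \<in> hom C B (src C m)" "k \<in> hom C B (src C m)" "m \<cdot> h \<sqsubseteq> m \<cdot> k" for m h k
    using that hom_Ob(2)[OF e] by (auto simp: ff_def)
  ultimately show "so C e" unfolding so_def
    by (simp add: hom_src[OF e] hom_tgt[OF e] hom_Arr[OF e])
qed

lemma so_fill:
  assumes "so C e" "e \<in> hom C A B" "ff C m" "m \<in> hom C X Y" "f \<in> hom C A X" "g \<in> hom C B Y" "m \<cdot> f = g \<cdot> e"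
  obtains h where "h \<in> hom C B X" "h \<cdot> e = f" "m \<cdot> h = g"
proof -
  have "\<exists>h \<in> hom C B X. h \<cdot> e = f \<and> m \<cdot> h = g"
    using assms(1,3-) unfolding so_iff[OF assms(2)] by blast
  then show ?thesis using that by blast
qed

lemma so_ident: "X \<in> Ob C \<Longrightarrow> so C (ident C X)"
  using so_iff[OF ident_hom] ident_right by (metis cmp_hom)

lemma so_cmp:
  assumes "so C e" "so C d" and e: "e \<in> hom C A B" and d: "d \<in> hom C B D"
  shows "so C (d \<cdot> e)"
  unfolding so_iff[OF cmp_hom[OF e d]]
proof (intro allI impI, elim conjE)
  fix X Y m f g assume m: "ff C m" "m \<in> hom C X Y" and fg: "f \<in> hom C A X" "g \<in> hom C D Y" "m \<cdot> f = g \<cdot> (d \<cdot> e)"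
  have gd: "g \<cdot> d \<in> hom C B Y" "m \<cdot> f = (g \<cdot> d) \<cdot> e" using cmp_hom d fg cmp_assoc[OF e d fg(2)] by auto
  obtain h where h: "h \<in> hom C B X" "h \<cdot> e = f" "m \<cdot> h = g \<cdot> d"
    using so_fill[OF assms(1) e m fg(1) gd] .
  obtain k where k: "k \<in> hom C D X" "k \<cdot> d = h" "m \<cdot> k = g"
    using so_fill[OF assms(2) d m h(1) fg(2) h(3)] .
  then show "\<exists>k \<in> hom C D X. k \<cdot> (d \<cdot> e) = f \<and> m \<cdot> k = g"
    using h cmp_assoc[OF e d k(1)] by (intro bexI[of _ k]) simp_all
qed

lemma so_iso:
  assumes i: "i \<in> hom C A B" "j \<in> hom C B A" "i \<cdot> j = ident C B" "j \<cdot> i = ident C A"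
  shows "so C i"
  unfolding so_iff[OF i(1)]
proof (intro allI impI, elim conjE)
  fix X Y m f g assume m: "ff C m" "m \<in> hom C X Y" and fg: "f \<in> hom C A X" "g \<in> hom C B Y" "m \<cdot> f = g \<cdot> i"
  have "f \<cdot> j \<in> hom C B X" using cmp_hom fg i by blast
  moreover have "(f \<cdot> j) \<cdot> i = f" using cmp_assoc[OF i(1,2) fg(1)] i ident_right[OF fg(1)] by simp
  moreover have "m \<cdot> (f \<cdot> j) = g"
    using cmp_assoc[OF i(2) fg(1) m(2)] cmp_assoc[OF i(2,1) fg(2)] fg i ident_right[OF fg(2)] by simp
  ultimately show "\<exists>h \<in> hom C B X. h \<cdot> i = f \<and> m \<cdot> h = g" by blast
qed

end

section \<open>Pullbacks, commas, covers and images in a regular category\<close>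

locale regular_poset_category = regular_category C for C :: "('o, 'a) pos_cat" (structure)
begin

lemmas has_terminal = terminal_exists[OF finite_limits]
  and has_product = product_exists[OF finite_limits]
  and has_inserter = inserter_exists[OF finite_limits]

lemma has_ineq_limit:
  assumes "finite K" "\<And>k. k \<in> K \<Longrightarrow> E k \<in> Ob C" "finite Q" "wf_ineqs C K E Q"
  obtains L c where "is_ineq_limit C K E Q L c"
  using pos_functor.ineq_limits_preserved[OF id_functor _ _ _ assms] has_terminal has_product has_inserter
  by simp blast

lemma has_pullback:
  assumes f: "f \<in> hom C X Z" and g: "g \<in> hom C Y Z"
  obtains P p q where "is_pullback C f g p q" "p \<in> hom C P X" "q \<in> hom C P Y"
proof -
  let ?E = "\<lambda>b. if b then Y else X"
  \<comment> \<open>The equation defining a pullback is split into two opposite inequalities;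
    \<open>False\<close> is the index of \<open>X\<close> and \<open>True\<close> that of
    \<open>Y\<close>.\<close>
  let ?Q = "{(False, f, True, g), (True, g, False, f)}"
  obtain L c where lim: "is_ineq_limit C UNIV ?E ?Q L c"
  proof (rule has_ineq_limit[of UNIV ?E ?Q])
    show "?E b \<in> Ob C" for b using hom_Ob(1)[OF f] hom_Ob(1)[OF g] by simp
    show "wf_ineqs C UNIV ?E ?Q" using f g by (auto simp: wf_ineqs_def)
  qed auto
  note L = is_ineq_limitD[OF lim]
  have c: "c False \<in> hom C L X" "c True \<in> hom C L Y" using L(3)[of False] L(3)[of True] by auto
  have "f \<cdot> c False \<in> hom C L Z" "g \<cdot> c True \<in> hom C L Z" using c f g cmp_hom by blast+
  then have eq: "f \<cdot> c False = g \<cdot> c True"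
    using L(2) leq_antisym unfolding is_cone_def by auto
  have ord: "h \<sqsubseteq> k" if "A \<in> Ob C" "h \<in> hom C A L" "k \<in> hom C A L"
    "c False \<cdot> h \<sqsubseteq> c False \<cdot> k" "c True \<cdot> h \<sqsubseteq> c True \<cdot> k" for A h k
    by (rule L(5)[OF that(1-3)]) (metis (full_types) that(4,5))
  have uni: "\<exists>h \<in> hom C A L. c False \<cdot> h = u \<and> c True \<cdot> h = v"
    if A: "A \<in> Ob C" "u \<in> hom C A X" "v \<in> hom C A Y" "f \<cdot> u = g \<cdot> v" for A u v
  proof -
    have "g \<cdot> v \<sqsubseteq> g \<cdot> v" using A g cmp_hom leq_refl by blast
    then have "is_cone C UNIV ?E ?Q A (\<lambda>b. if b then v else u)"
      using A by (simp add: is_cone_def)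
    then obtain h where "h \<in> hom C A L" "\<forall>b\<in>UNIV. c b \<cdot> h = (if b then v else u)"
      using L(4)[OF A(1), of "\<lambda>b. if b then v else u"] by blast
    then show ?thesis by (metis UNIV_I)
  qed
  have "is_pullback C f g (c False) (c True)"
    unfolding is_pullback_def jointly_order_mono_def
    using eq ord uni
    by (simp add: hom_src[OF c(1)] hom_src[OF c(2)] hom_tgt[OF c(1)] hom_tgt[OF c(2)] hom_Arr[OF c(1)] hom_Arr[OF c(2)]
        hom_src[OF f] hom_src[OF g] hom_tgt[OF f] hom_tgt[OF g] hom_Arr[OF f] hom_Arr[OF g])
  then show ?thesis using that c by blast
qed

lemma has_comma:
  assumes f: "f \<in> hom C X Z" and g: "g \<in> hom C Y Z"
  obtains P p q where "is_comma C f g p q" "p \<in> hom C P X" "q \<in> hom C P Y"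
proof -
  let ?E = "\<lambda>b. if b then Y else X"
  let ?Q = "{(False, f, True, g)}"
  obtain L c where lim: "is_ineq_limit C UNIV ?E ?Q L c"
  proof (rule has_ineq_limit[of UNIV ?E ?Q])
    show "?E b \<in> Ob C" for b using hom_Ob(1)[OF f] hom_Ob(1)[OF g] by simp
    show "wf_ineqs C UNIV ?E ?Q" using f g by (auto simp: wf_ineqs_def)
  qed auto
  note L = is_ineq_limitD[OF lim]
  have c: "c False \<in> hom C L X" "c True \<in> hom C L Y" using L(3)[of False] L(3)[of True] by auto
  have le: "f \<cdot> c False \<sqsubseteq> g \<cdot> c True"
    using L(2) unfolding is_cone_def by auto
  have ord: "h \<sqsubseteq> k" if "A \<in> Ob C" "h \<in> hom C A L" "k \<in> hom C A L"
    "c False \<cdot> h \<sqsubseteq> c False \<cdot> k" "c True \<cdot> h \<sqsubseteq> c True \<cdot> k" for A h k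
    by (rule L(5)[OF that(1-3)]) (metis (full_types) that(4,5))
  have uni: "\<exists>h \<in> hom C A L. c False \<cdot> h = u \<and> c True \<cdot> h = v"
    if A: "A \<in> Ob C" "u \<in> hom C A X" "v \<in> hom C A Y" "f \<cdot> u \<sqsubseteq> g \<cdot> v" for A u v
  proof -
    have "is_cone C UNIV ?E ?Q A (\<lambda>b. if b then v else u)"
      using A by (simp add: is_cone_def)
    then obtain h where "h \<in> hom C A L" "\<forall>b\<in>UNIV. c b \<cdot> h = (if b then v else u)"
      using L(4)[OF A(1), of "\<lambda>b. if b then v else u"] by blast
    then show ?thesis by (metis UNIV_I)
  qed
  have "is_comma C f g (c False) (c True)"
    unfolding is_comma_def jointly_order_mono_def
    using le ord uni
    by (simp add: hom_src[OF c(1)] hom_src[OF c(2)] hom_tgt[OF c(1)] hom_tgt[OF c(2)] hom_Arr[OF c(1)] hom_Arr[OF c(2)]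
        hom_src[OF f] hom_src[OF g] hom_tgt[OF f] hom_tgt[OF g] hom_Arr[OF f] hom_Arr[OF g])
  then show ?thesis using that c by blast
qed

text \<open>The inserter of \<open>f\<close> and \<open>g\<close> is an \<open>ff\<close>-morphism
  through which \<open>e\<close> factors, so orthogonality gives it a section; the inequality, valid
  on the inserter, is restricted along the section to all of \<open>B\<close>.\<close>

lemma so_order_epi:
  assumes "so C e" "e \<in> hom C A B" "f \<in> hom C B X" "g \<in> hom C B X" "f \<cdot> e \<sqsubseteq> g \<cdot> e"
  shows "f \<sqsubseteq> g"
proof -
  obtain i where i: "is_inserter C f g i" using has_inserter assms(3,4) by blast
  let ?I = "src C i"
  have ih: "i \<in> hom C ?I B" "ff C i" "f \<cdot> i \<sqsubseteq> g \<cdot> i"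
    using is_inserterD[OF i assms(3)] i by (auto simp: is_inserter_def)
  obtain e' where e': "e' \<in> hom C A ?I" "i \<cdot> e' = e"
    using i assms(2,5) hom_Ob(1)[OF assms(2)] hom_src[OF assms(3)] unfolding is_inserter_def by blast
  have id: "ident C B \<in> hom C B B" "ident C B \<cdot> e = e"
    using ident_hom hom_Ob(2)[OF assms(2)] ident_left assms(2) by auto
  obtain d where d: "d \<in> hom C B ?I" "i \<cdot> d = ident C B"
    using so_fill[OF assms(1,2) ih(2,1) e'(1) id(1)] e'(2) id(2) by auto
  have "(f \<cdot> i) \<cdot> d \<sqsubseteq> (g \<cdot> i) \<cdot> d"
    using cmp_mono_left[OF d(1) cmp_hom[OF ih(1) assms(3)] cmp_hom[OF ih(1) assms(4)] ih(3)] .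
  then show ?thesis
    using cmp_assoc[OF d(1) ih(1) assms(3)] cmp_assoc[OF d(1) ih(1) assms(4)] d(2)
      ident_right[OF assms(3)] ident_right[OF assms(4)] by simp
qed

text \<open>Stability in the form that the calculus of elements needs: an element \<open>h\<close>
  of the codomain of a cover lifts through it after passing to another cover.\<close>

lemma so_pullback:
  assumes "so C e" "e \<in> hom C B A" "h \<in> hom C Z A"
  obtains W d h' where "so C d" "d \<in> hom C W Z" "h' \<in> hom C W B" "e \<cdot> h' = h \<cdot> d"
proof -
  obtain P p q where pb: "is_pullback C e h p q" "p \<in> hom C P B" "q \<in> hom C P Z"
    using has_pullback[OF assms(2,3)] by blast
  then have "e \<cdot> p = h \<cdot> q" by (simp add: is_pullback_def)
  then show ?thesis using that so_stable[OF pb(1) assms(1)] pb by blast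
qed

lemma image_factorization:
  assumes "f \<in> hom C X Y"
  obtains I e m where "so C e" "ff C m" "e \<in> hom C X I" "m \<in> hom C I Y" "m \<cdot> e = f"
proof -
  obtain e m where em: "so C e" "ff C m" "src C e = src C f" "tgt C e = src C m" "tgt C m = tgt C f" "m \<cdot> e = f"
    using factorization[OF hom_Arr[OF assms]] by blast
  then have "e \<in> hom C X (src C m)" "m \<in> hom C (src C m) Y"
    using assms by (simp_all add: hom_def so_def ff_def)
  then show ?thesis using that em by blast
qed

lemma pullbackD:
  assumes pb: "is_pullback C f g p q" and f: "f \<in> hom C X Z" and g: "g \<in> hom C Y Z"
  shows "p \<in> hom C (src C p) X" "q \<in> hom C (src C p) Y" "f \<cdot> p = g \<cdot> q"
    and "\<And>A u v. \<lbrakk>u \<in> hom C A X; v \<in> hom C A Y; f \<cdot> u = g \<cdot> v\<rbrakk> \<Longrightarrow>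
        \<exists>h \<in> hom C A (src C p). p \<cdot> h = u \<and> q \<cdot> h = v"
    and "\<And>A h k. \<lbrakk>h \<in> hom C A (src C p); k \<in> hom C A (src C p); p \<cdot> h \<sqsubseteq> p \<cdot> k; q \<cdot> h \<sqsubseteq> q \<cdot> k\<rbrakk> \<Longrightarrow> h \<sqsubseteq> k"
proof -
  show "p \<in> hom C (src C p) X" "q \<in> hom C (src C p) Y" "f \<cdot> p = g \<cdot> q"
    using pb f g unfolding is_pullback_def jointly_order_mono_def by (auto simp: hom_def)
  show "\<exists>h \<in> hom C A (src C p). p \<cdot> h = u \<and> q \<cdot> h = v"
    if "u \<in> hom C A X" "v \<in> hom C A Y" "f \<cdot> u = g \<cdot> v" for A u v
    using pb that hom_Ob(1)[OF that(1)] hom_src[OF f] hom_src[OF g] unfolding is_pullback_def by blast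
  show "h \<sqsubseteq> k" if "h \<in> hom C A (src C p)" "k \<in> hom C A (src C p)" "p \<cdot> h \<sqsubseteq> p \<cdot> k" "q \<cdot> h \<sqsubseteq> q \<cdot> k" for A h k
    using pb that hom_Ob(1)[OF that(1)] unfolding is_pullback_def jointly_order_mono_def by blast
qed

lemma ff_pullback:
  assumes "is_pullback C m g p q" "ff C m" and m: "m \<in> hom C X Z" and g: "g \<in> hom C Y Z"
  shows "ff C q"
proof -
  note P = pullbackD[OF assms(1) m g]
  show ?thesis
  proof (rule ffI[OF P(2)])
    fix A h k assume h: "h \<in> hom C A (src C p)" "k \<in> hom C A (src C p)" "q \<cdot> h \<sqsubseteq> q \<cdot> k"
    have "g \<cdot> (q \<cdot> h) \<sqsubseteq> g \<cdot> (q \<cdot> k)"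
      using cmp_mono_right[OF cmp_hom[OF h(1) P(2)] cmp_hom[OF h(2) P(2)] g h(3)] .
    then have "m \<cdot> (p \<cdot> h) \<sqsubseteq> m \<cdot> (p \<cdot> k)"
      using cmp_assoc[OF h(1) P(2) g] cmp_assoc[OF h(2) P(2) g] cmp_assoc[OF h(1) P(1) m]
        cmp_assoc[OF h(2) P(1) m] P(3) by metis
    then have "p \<cdot> h \<sqsubseteq> p \<cdot> k" using ffD[OF assms(2) m] cmp_hom[OF h(1) P(1)] cmp_hom[OF h(2) P(1)] by blast
    then show "h \<sqsubseteq> k" using P(5) h by blast
  qed
qed

section \<open>The chosen products and their pairings\<close>

lemma prj_product: "\<lbrakk>X \<in> Ob C; Y \<in> Ob C\<rbrakk> \<Longrightarrow> is_product C X Y (prj0 C X Y) (prj1 C X Y)"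
  using has_product[of X Y] unfolding prj0_def prj1_def prj_def
  by (metis (mono_tags, lifting) fst_conv snd_conv someI_ex)

lemma prj_hom:
  assumes "X \<in> Ob C" "Y \<in> Ob C"
  shows "prj0 C X Y \<in> hom C (prod_ob C X Y) X" "prj1 C X Y \<in> hom C (prod_ob C X Y) Y"
  using prj_product[OF assms] by (auto simp: is_product_def jointly_order_mono_def hom_def prod_ob_def)

lemma prod_ob_Ob: "\<lbrakk>X \<in> Ob C; Y \<in> Ob C\<rbrakk> \<Longrightarrow> prod_ob C X Y \<in> Ob C"
  using prj_hom hom_Ob by blast

lemma prod_leqI:
  assumes "X \<in> Ob C" "Y \<in> Ob C" "h \<in> hom C A (prod_ob C X Y)" "k \<in> hom C A (prod_ob C X Y)"
    "prj0 C X Y \<cdot> h \<sqsubseteq> prj0 C X Y \<cdot> k" "prj1 C X Y \<cdot> h \<sqsubseteq> prj1 C X Y \<cdot> k"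
  shows "h \<sqsubseteq> k"
  using prj_product[OF assms(1,2)] assms(3-) hom_Ob(1)[OF assms(3)]
  by (auto simp: is_product_def jointly_order_mono_def prod_ob_def)

lemma prod_eqI:
  assumes "X \<in> Ob C" "Y \<in> Ob C" "h \<in> hom C A (prod_ob C X Y)" "k \<in> hom C A (prod_ob C X Y)"
    "prj0 C X Y \<cdot> h = prj0 C X Y \<cdot> k" "prj1 C X Y \<cdot> h = prj1 C X Y \<cdot> k"
  shows "h = k"
proof -
  have "prj0 C X Y \<cdot> k \<in> hom C A X" "prj1 C X Y \<cdot> k \<in> hom C A Y" using prj_hom assms cmp_hom by blast+
  then have "h \<sqsubseteq> k" "k \<sqsubseteq> h" using prod_leqI assms leq_refl by metis+
  then show ?thesis using leq_antisym assms by blast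
qed

lemma pairing:
  assumes x: "x \<in> hom C A X" and y: "y \<in> hom C A Y"
  shows "pairing C X Y x y \<in> hom C A (prod_ob C X Y)"
    and "prj0 C X Y \<cdot> pairing C X Y x y = x" "prj1 C X Y \<cdot> pairing C X Y x y = y"
proof -
  have XY: "X \<in> Ob C" "Y \<in> Ob C" "A \<in> Ob C" using x y hom_Ob by blast+
  obtain h where h: "h \<in> hom C A (prod_ob C X Y)" "prj0 C X Y \<cdot> h = x" "prj1 C X Y \<cdot> h = y"
    using prj_product[OF XY(1,2)] x y XY unfolding is_product_def prod_ob_def by blast
  have "pairing C X Y x y = h" unfolding pairing_def hom_src[OF x]
    by (rule the_equality) (use h prod_eqI[OF XY(1,2)] in auto)
  then show "pairing C X Y x y \<in> hom C A (prod_ob C X Y)"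
    "prj0 C X Y \<cdot> pairing C X Y x y = x" "prj1 C X Y \<cdot> pairing C X Y x y = y" using h by auto
qed

lemma pairing_eta:
  assumes "X \<in> Ob C" "Y \<in> Ob C" "h \<in> hom C A (prod_ob C X Y)"
  shows "pairing C X Y (prj0 C X Y \<cdot> h) (prj1 C X Y \<cdot> h) = h"
  using pairing[OF cmp_hom[OF assms(3) prj_hom(1)[OF assms(1,2)]] cmp_hom[OF assms(3) prj_hom(2)[OF assms(1,2)]]]
    prod_eqI[OF assms(1,2)] assms(3) by blast

lemma pairing_cmp:
  assumes x: "x \<in> hom C A X" and y: "y \<in> hom C A Y" and h: "h \<in> hom C B A"
  shows "pairing C X Y x y \<cdot> h = pairing C X Y (x \<cdot> h) (y \<cdot> h)"
proof -
  have XY: "X \<in> Ob C" "Y \<in> Ob C" using x y hom_Ob by blast+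
  note p = pairing[OF x y] and ph = pairing[OF cmp_hom[OF h x] cmp_hom[OF h y]]
  show ?thesis
    by (rule prod_eqI[OF XY cmp_hom[OF h p(1)] ph(1)])
      (use cmp_assoc[OF h p(1) prj_hom(1)[OF XY]] cmp_assoc[OF h p(1) prj_hom(2)[OF XY]] p ph in auto)
qed

end

section \<open>Relations through generalized elements\<close>

context regular_poset_category
begin

text \<open>The Yoneda description of a subobject: \<open>m\<close> is determined up to isomorphism
  by the predicate telling which pairs of generalized elements factor through it.\<close>

definition represents :: "'a \<Rightarrow> 'o \<Rightarrow> 'o \<Rightarrow> ('a \<Rightarrow> 'a \<Rightarrow> bool) \<Rightarrow> bool" where
  "represents m X Y P \<longleftrightarrow> X \<in> Ob C \<and> Y \<in> Ob C \<and> ff C m \<and> m \<in> hom C (src C m) (prod_ob C X Y) \<and>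
    (\<forall>A x y. x \<in> hom C A X \<longrightarrow> y \<in> hom C A Y \<longrightarrow> (factors_through C (pairing C X Y x y) m \<longleftrightarrow> P x y))"

definition rel_of :: "'o \<Rightarrow> 'o \<Rightarrow> ('a \<Rightarrow> 'a \<Rightarrow> bool) \<Rightarrow> 'a set" where
  "rel_of X Y P = {m. represents m X Y P}"

text \<open>Typing is part of the predicate because \<open>pairing\<close> is a definite description
  and \<open>rel_mem\<close> says nothing meaningful about ill-typed arguments; equality of
  relations can then be tested by plain equivalence.\<close>

definition el :: "'o \<Rightarrow> 'o \<Rightarrow> 'o \<Rightarrow> 'a set \<Rightarrow> 'a \<Rightarrow> 'a \<Rightarrow> bool" where
  "el A X Y R x y \<longleftrightarrow> x \<in> hom C A X \<and> y \<in> hom C A Y \<and> R \<in> Rel C X Y \<and> rel_mem C X Y x y R"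

lemma factors_iff: "f \<in> hom C A B \<Longrightarrow> factors_through C f m \<longleftrightarrow> (\<exists>h \<in> hom C A (src C m). m \<cdot> h = f)"
  by (simp add: factors_through_def hom_def)

lemma factors_pairing_iff:
  assumes "x \<in> hom C A X" "y \<in> hom C A Y"
  shows "factors_through C (pairing C X Y x y) m \<longleftrightarrow> (\<exists>h \<in> hom C A (src C m). m \<cdot> h = pairing C X Y x y)"
  using factors_iff[OF pairing(1)[OF assms]] .

lemma factors_trans:
  assumes "f \<in> hom C A B" "m \<in> hom C (src C m) B" "n \<in> hom C (src C n) B"
    "factors_through C f m" "factors_through C m n"
  shows "factors_through C f n"
proof -
  obtain h where h: "h \<in> hom C A (src C m)" "m \<cdot> h = f"
    using assms(4) factors_iff[OF assms(1)] by blast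
  obtain k where k: "k \<in> hom C (src C m) (src C n)" "n \<cdot> k = m"
    using assms(5) by (auto simp: factors_through_def)
  have "k \<cdot> h \<in> hom C A (src C n)" "n \<cdot> (k \<cdot> h) = f"
    using cmp_hom[OF h(1) k(1)] cmp_assoc[OF h(1) k(1) assms(3)] h k by auto
  then show ?thesis using factors_iff[OF assms(1)] by blast
qed

lemma representsI:
  assumes "X \<in> Ob C" "Y \<in> Ob C" "ff C m" "m \<in> hom C M (prod_ob C X Y)"
    "\<And>A x y. \<lbrakk>x \<in> hom C A X; y \<in> hom C A Y\<rbrakk> \<Longrightarrow>
      (\<exists>h \<in> hom C A M. m \<cdot> h = pairing C X Y x y) \<longleftrightarrow> P x y"
  shows "represents m X Y P"
  using assms unfolding represents_def by (simp add: factors_pairing_iff hom_src[OF assms(4)])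

lemma representsD:
  assumes "represents m X Y P"
  shows "X \<in> Ob C" "Y \<in> Ob C" "ff C m" "m \<in> hom C (src C m) (prod_ob C X Y)"
    and "\<And>A x y. \<lbrakk>x \<in> hom C A X; y \<in> hom C A Y\<rbrakk> \<Longrightarrow>
      (\<exists>h \<in> hom C A (src C m). m \<cdot> h = pairing C X Y x y) \<longleftrightarrow> P x y"
  using assms unfolding represents_def by (auto simp: factors_pairing_iff)

lemma represents_generic:
  assumes "represents m X Y P"
  shows "P (prj0 C X Y \<cdot> m) (prj1 C X Y \<cdot> m)"
proof -
  note m = representsD[OF assms]
  note p = prj_hom[OF m(1,2)]
  have "m \<cdot> ident C (src C m) = pairing C X Y (prj0 C X Y \<cdot> m) (prj1 C X Y \<cdot> m)"
    using pairing_eta[OF m(1,2,4)] ident_right[OF m(4)] by simp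
  then show ?thesis
    using m(5)[OF cmp_hom[OF m(4) p(1)] cmp_hom[OF m(4) p(2)]] ident_hom[OF hom_Ob(1)[OF m(4)]] by blast
qed

text \<open>It suffices to test the implication at the generic pair, the two components of
  \<open>m\<close> itself, which satisfies \<open>P\<close> by
  \<open>represents_generic\<close>.\<close>

lemma represents_factors:
  assumes m: "represents m X Y P" and n: "represents n X Y Q"
    and "\<And>A x y. \<lbrakk>x \<in> hom C A X; y \<in> hom C A Y; P x y\<rbrakk> \<Longrightarrow> Q x y"
  shows "factors_through C m n"
proof -
  note M = representsD[OF m]
  note p = cmp_hom[OF M(4) prj_hom(1)[OF M(1,2)]] cmp_hom[OF M(4) prj_hom(2)[OF M(1,2)]]
  have "Q (prj0 C X Y \<cdot> m) (prj1 C X Y \<cdot> m)" using assms(3)[OF p] represents_generic[OF m] by blast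
  then show ?thesis
    using representsD(5)[OF n p] pairing_eta[OF M(1,2,4)] by (auto simp: factors_iff[OF M(4)])
qed

lemma represents_transfer:
  assumes m: "represents m X Y P" and n: "ff C n" "tgt C n = prod_ob C X Y"
    and "factors_through C m n" "factors_through C n m"
  shows "represents n X Y P"
proof -
  note M = representsD[OF m]
  have nh: "n \<in> hom C (src C n) (prod_ob C X Y)" using n by (auto simp: ff_def hom_def)
  have "factors_through C (pairing C X Y x y) n \<longleftrightarrow> P x y" if "x \<in> hom C A X" "y \<in> hom C A Y" for A x y
    using m[unfolded represents_def] factors_trans[OF pairing(1)[OF that]] M(4) nh assms(4,5) that by blast
  then show ?thesis using M(1,2) n nh unfolding represents_def by blast
qed

lemma rel_of_eq_class:
  assumes m: "represents m X Y P"
  shows "rel_of X Y P = {n. ff C n \<and> tgt C n = prod_ob C X Y \<and> factors_through C m n \<and> factors_through C n m}"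
proof (intro equalityI subsetI)
  fix n assume "n \<in> rel_of X Y P"
  then have n: "represents n X Y P" by (simp add: rel_of_def)
  then show "n \<in> {n. ff C n \<and> tgt C n = prod_ob C X Y \<and> factors_through C m n \<and> factors_through C n m}"
    using represents_factors[OF m n] represents_factors[OF n m] representsD(3,4)[OF n] by (simp add: hom_def)
qed (use represents_transfer[OF m] in \<open>auto simp: rel_of_def\<close>)

lemma rel_of_Rel: "represents m X Y P \<Longrightarrow> rel_of X Y P \<in> Rel C X Y"
  using rel_of_eq_class[of m X Y P] representsD(3,4)[of m X Y P]
  unfolding Rel_def subobjects_def by (auto simp: hom_def)

text \<open>The members of a class factor through each other, so factoring through one of them is
  the same as factoring through any other.\<close>

lemma Rel_representable:
  assumes XY: "X \<in> Ob C" "Y \<in> Ob C" and R: "R \<in> Rel C X Y"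
  shows "\<exists>m. represents m X Y (\<lambda>x y. rel_mem C X Y x y R)" "R = rel_of X Y (\<lambda>x y. rel_mem C X Y x y R)"
proof -
  obtain m where m: "ff C m" "tgt C m = prod_ob C X Y" and
    Rm: "R = {n. ff C n \<and> tgt C n = prod_ob C X Y \<and> factors_through C m n \<and> factors_through C n m}"
    using R unfolding Rel_def subobjects_def by blast
  have mh: "m \<in> hom C (src C m) (prod_ob C X Y)" using m by (auto simp: ff_def hom_def)
  have "factors_through C m m"
    using ident_right[OF mh] ident_hom[OF hom_Ob(1)[OF mh]] by (auto simp: factors_iff[OF mh])
  then have mR: "m \<in> R" using m Rm by blast
  have "factors_through C (pairing C X Y x y) m \<longleftrightarrow> rel_mem C X Y x y R"
    if "x \<in> hom C A X" "y \<in> hom C A Y" for A x y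
  proof
    assume "rel_mem C X Y x y R"
    then obtain r where "r \<in> R" "factors_through C (pairing C X Y x y) r" by (auto simp: rel_mem_def)
    moreover have "r \<in> hom C (src C r) (prod_ob C X Y)" using \<open>r \<in> R\<close> Rm by (auto simp: ff_def hom_def)
    ultimately show "factors_through C (pairing C X Y x y) m"
      using factors_trans[OF pairing(1)[OF that] _ mh] Rm by blast
  qed (use mR in \<open>auto simp: rel_mem_def\<close>)
  then have "represents m X Y (\<lambda>x y. rel_mem C X Y x y R)" using XY m mh by (simp add: represents_def)
  then show "\<exists>m. represents m X Y (\<lambda>x y. rel_mem C X Y x y R)" "R = rel_of X Y (\<lambda>x y. rel_mem C X Y x y R)"
    using rel_of_eq_class Rm by auto
qed

lemma elD:
  assumes "el A X Y R x y"
  shows "x \<in> hom C A X" "y \<in> hom C A Y" "R \<in> Rel C X Y" "X \<in> Ob C" "Y \<in> Ob C" "A \<in> Ob C"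
  using assms hom_Ob unfolding el_def by blast+

lemma el_rel_of:
  assumes m: "represents m X Y P"
  shows "el A X Y (rel_of X Y P) x y \<longleftrightarrow> x \<in> hom C A X \<and> y \<in> hom C A Y \<and> P x y"
proof -
  have "rel_mem C X Y x y (rel_of X Y P) \<longleftrightarrow> P x y" if "x \<in> hom C A X" "y \<in> hom C A Y"
    using m that unfolding rel_mem_def rel_of_def represents_def by blast
  then show ?thesis using rel_of_Rel[OF m] unfolding el_def by blast
qed

lemma Rel_member_represents:
  assumes "r \<in> R" "R \<in> Rel C X Y" "X \<in> Ob C" "Y \<in> Ob C"
  shows "represents r X Y (\<lambda>x y. rel_mem C X Y x y R)"
  using Rel_representable(2)[OF assms(3,4,2)] assms(1) unfolding rel_of_def by blast

lemma rel_le_iff: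
  assumes "X \<in> Ob C" "Y \<in> Ob C" "R \<in> Rel C X Y" "S \<in> Rel C X Y"
  shows "rel_le C R S \<longleftrightarrow> (\<forall>A x y. el A X Y R x y \<longrightarrow> el A X Y S x y)"
proof
  obtain r s where r: "represents r X Y (\<lambda>x y. rel_mem C X Y x y R)"
    and s: "represents s X Y (\<lambda>x y. rel_mem C X Y x y S)"
    using Rel_representable(1) assms by metis
  have rs: "r \<in> R" "s \<in> S"
    using r s Rel_representable(2)[OF assms(1,2,3)] Rel_representable(2)[OF assms(1,2,4)] by (auto simp: rel_of_def)
  assume "\<forall>A x y. el A X Y R x y \<longrightarrow> el A X Y S x y"
  then have "factors_through C r s"
    using assms by (intro represents_factors[OF r s]) (auto simp: el_def)
  then show "rel_le C R S" using rs by (auto simp: rel_le_def)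
next
  assume "rel_le C R S"
  then obtain r s where rs: "r \<in> R" "s \<in> S" "factors_through C r s" by (auto simp: rel_le_def)
  note r = Rel_member_represents[OF rs(1) assms(3,1,2)] and s = Rel_member_represents[OF rs(2) assms(4,1,2)]
  have "el A X Y S x y" if "el A X Y R x y" for A x y
  proof -
    have xy: "x \<in> hom C A X" "y \<in> hom C A Y" using that by (simp_all add: el_def)
    have "factors_through C (pairing C X Y x y) s"
      using that r rs(3) representsD(4)[OF r] representsD(4)[OF s] factors_trans[OF pairing(1)[OF xy]]
      unfolding represents_def el_def by blast
    then show ?thesis using s xy assms(4) unfolding represents_def el_def by blast
  qed
  then show "\<forall>A x y. el A X Y R x y \<longrightarrow> el A X Y S x y" by blast
qed

lemma rel_eqI:
  assumes XY: "X \<in> Ob C" "Y \<in> Ob C" "R \<in> Rel C X Y" "S \<in> Rel C X Y"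
    and "\<And>A x y. el A X Y R x y \<longleftrightarrow> el A X Y S x y"
  shows "R = S"
proof -
  have "represents m X Y (\<lambda>x y. rel_mem C X Y x y R) \<longleftrightarrow> represents m X Y (\<lambda>x y. rel_mem C X Y x y S)" for m
    using assms(3-) unfolding represents_def el_def by blast
  then have "rel_of X Y (\<lambda>x y. rel_mem C X Y x y R) = rel_of X Y (\<lambda>x y. rel_mem C X Y x y S)"
    unfolding rel_of_def by blast
  then show ?thesis using Rel_representable(2)[OF XY(1,2)] XY(3,4) by simp
qed

lemma el_restrict:
  assumes "el A X Y R x y" "h \<in> hom C B A"
  shows "el B X Y R (x \<cdot> h) (y \<cdot> h)"
proof -
  note D = elD[OF assms(1)]
  obtain m where m: "represents m X Y (\<lambda>x y. rel_mem C X Y x y R)" using Rel_representable(1) D by blast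
  note M = representsD[OF m]
  obtain k where k: "k \<in> hom C A (src C m)" "m \<cdot> k = pairing C X Y x y"
    using M(5)[OF D(1,2)] assms(1) by (auto simp: el_def)
  have "m \<cdot> (k \<cdot> h) = pairing C X Y (x \<cdot> h) (y \<cdot> h)"
    using cmp_assoc[OF assms(2) k(1) M(4)] k(2) pairing_cmp[OF D(1,2) assms(2)] by simp
  then show ?thesis
    using M(5)[OF cmp_hom[OF assms(2) D(1)] cmp_hom[OF assms(2) D(2)]] cmp_hom[OF assms(2)] k(1) D
    unfolding el_def by blast
qed

text \<open>A factorization of the restricted pair through a representing \<open>ff\<close>-morphism
  is a commutative square with \<open>e\<close> on one side and the \<open>ff\<close>-morphism on
  the other; its diagonal is the factorization of the pair itself.\<close>

lemma el_local:
  assumes so: "so C e" "e \<in> hom C B A" and xy: "x \<in> hom C A X" "y \<in> hom C A Y"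
    and el: "el B X Y R (x \<cdot> e) (y \<cdot> e)"
  shows "el A X Y R x y"
proof -
  note D = elD[OF el]
  obtain m where m: "represents m X Y (\<lambda>x y. rel_mem C X Y x y R)" using Rel_representable(1) D by blast
  note M = representsD[OF m]
  obtain k where k: "k \<in> hom C B (src C m)" "m \<cdot> k = pairing C X Y x y \<cdot> e"
    using M(5)[OF D(1,2)] el pairing_cmp[OF xy so(2)] by (auto simp: el_def)
  obtain h where "h \<in> hom C A (src C m)" "m \<cdot> h = pairing C X Y x y"
    using so_fill[OF so M(3,4) k(1) pairing(1)[OF xy] k(2)] .
  then show ?thesis using M(5)[OF xy] xy D unfolding el_def by blast
qed

text \<open>This is the semantics of the existential quantifier hidden in an image: the composite is
  the \<open>ff\<close>-part of an arrow out of the pullback, and an element of the image comes from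
  the pullback only on a cover.\<close>

lemma comp_represents:
  assumes rs: "r \<in> R" "s \<in> S" and RS: "R \<in> Rel C X Y" "S \<in> Rel C Y Z"
    and XYZ: "X \<in> Ob C" "Y \<in> Ob C" "Z \<in> Ob C"
    and pb: "is_pullback C (prj1 C X Y \<cdot> r) (prj0 C Y Z \<cdot> s) t\<^sub>0 t\<^sub>1"
    and e: "so C e" "src C e = src C t\<^sub>0" "tgt C e = src C m"
    and m: "ff C m" "tgt C m = prod_ob C X Z"
    and me: "m \<cdot> e = pairing C X Z ((prj0 C X Y \<cdot> r) \<cdot> t\<^sub>0) ((prj1 C Y Z \<cdot> s) \<cdot> t\<^sub>1)"
  shows "represents m X Z (\<lambda>x z. \<exists>B e y. so C e \<and> e \<in> hom C B (src C x) \<and>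
      el B X Y R (x \<cdot> e) y \<and> el B Y Z S y (z \<cdot> e))"
proof -
  note r = representsD[OF Rel_member_represents[OF rs(1) RS(1) XYZ(1,2)]]
    and s = representsD[OF Rel_member_represents[OF rs(2) RS(2) XYZ(2,3)]]
  note p = prj_hom[OF XYZ(1,2)] and q = prj_hom[OF XYZ(2,3)]
  note r0 = cmp_hom[OF r(4) p(1)] and r1 = cmp_hom[OF r(4) p(2)]
    and s0 = cmp_hom[OF s(4) q(1)] and s1 = cmp_hom[OF s(4) q(2)]
  note T = pullbackD[OF pb r1 s0]
  have mh: "m \<in> hom C (src C m) (prod_ob C X Z)" and eh: "e \<in> hom C (src C t\<^sub>0) (src C m)"
    using m e by (auto simp: ff_def so_def hom_def)
  note a = cmp_hom[OF T(1) r0] and c = cmp_hom[OF T(2) s1]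
  have fact_r: "(prj0 C X Y \<cdot> r) \<cdot> k = x \<and> (prj1 C X Y \<cdot> r) \<cdot> k = y"
    if "k \<in> hom C B (src C r)" "r \<cdot> k = pairing C X Y x y" "x \<in> hom C B X" "y \<in> hom C B Y" for B k x y
    using cmp_assoc[OF that(1) r(4) p(1)] cmp_assoc[OF that(1) r(4) p(2)] that pairing(2,3)[OF that(3,4)] by simp
  have fact_s: "(prj0 C Y Z \<cdot> s) \<cdot> k = x \<and> (prj1 C Y Z \<cdot> s) \<cdot> k = y"
    if "k \<in> hom C B (src C s)" "s \<cdot> k = pairing C Y Z x y" "x \<in> hom C B Y" "y \<in> hom C B Z" for B k x y
    using cmp_assoc[OF that(1) s(4) q(1)] cmp_assoc[OF that(1) s(4) q(2)] that pairing(2,3)[OF that(3,4)] by simp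
  show ?thesis
  proof (rule representsI[OF XYZ(1,3) m(1) mh], rule iffI, goal_cases)
    case (1 A x z)
    then obtain h where h: "h \<in> hom C A (src C m)" "m \<cdot> h = pairing C X Z x z" by blast
    \<comment> \<open>Pulling the \<open>so\<close>-part \<open>e\<close> back along
      \<open>h\<close> provides the cover \<open>d\<close> and a lift \<open>h'\<close> into the
      pullback, from which the intermediate element is read off.\<close>
    obtain B d h' where d: "so C d" "d \<in> hom C B A" "h' \<in> hom C B (src C t\<^sub>0)" "e \<cdot> h' = h \<cdot> d"
      using so_pullback[OF e(1) eh h(1)] .
    note k = cmp_hom[OF d(3) T(1)] and l = cmp_hom[OF d(3) T(2)]
    have "pairing C X Z (x \<cdot> d) (z \<cdot> d) = m \<cdot> (h \<cdot> d)"
      using pairing_cmp[OF 1(1,2) d(2)] h cmp_assoc[OF d(2) h(1) mh] by simp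
    also have "\<dots> = (m \<cdot> e) \<cdot> h'" using cmp_assoc[OF d(3) eh mh] d(4) by simp
    also have "\<dots> = pairing C X Z (((prj0 C X Y \<cdot> r) \<cdot> t\<^sub>0) \<cdot> h') (((prj1 C Y Z \<cdot> s) \<cdot> t\<^sub>1) \<cdot> h')"
      unfolding me using pairing_cmp[OF a c d(3)] .
    finally have eq: "pairing C X Z (x \<cdot> d) (z \<cdot> d) = \<dots>" .
    note xd = cmp_hom[OF d(2) 1(1)] and zd = cmp_hom[OF d(2) 1(2)]
    have xz: "x \<cdot> d = (prj0 C X Y \<cdot> r) \<cdot> (t\<^sub>0 \<cdot> h')" "z \<cdot> d = (prj1 C Y Z \<cdot> s) \<cdot> (t\<^sub>1 \<cdot> h')"
      using eq pairing(2,3)[OF xd zd] pairing(2,3)[OF cmp_hom[OF d(3) a] cmp_hom[OF d(3) c]]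
        cmp_assoc[OF d(3) T(1) r0] cmp_assoc[OF d(3) T(2) s1] by simp_all
    let ?y = "(prj1 C X Y \<cdot> r) \<cdot> (t\<^sub>0 \<cdot> h')"
    have y: "?y \<in> hom C B Y" using cmp_hom[OF k r1] .
    have y': "?y = (prj0 C Y Z \<cdot> s) \<cdot> (t\<^sub>1 \<cdot> h')"
      using cmp_assoc[OF d(3) T(1) r1] cmp_assoc[OF d(3) T(2) s0] T(3) by simp
    have "r \<cdot> (t\<^sub>0 \<cdot> h') = pairing C X Y (x \<cdot> d) ?y"
      unfolding xz using cmp_assoc[OF k r(4) p(1)] cmp_assoc[OF k r(4) p(2)]
        pairing_eta[OF XYZ(1,2) cmp_hom[OF k r(4)]] by simp
    then have "el B X Y R (x \<cdot> d) ?y" using r(5)[OF xd y] k xd y RS unfolding el_def by blast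
    moreover have "s \<cdot> (t\<^sub>1 \<cdot> h') = pairing C Y Z ?y (z \<cdot> d)"
      unfolding xz y' using cmp_assoc[OF l s(4) q(1)] cmp_assoc[OF l s(4) q(2)]
        pairing_eta[OF XYZ(2,3) cmp_hom[OF l s(4)]] by simp
    then have "el B Y Z S ?y (z \<cdot> d)" using s(5)[OF y zd] l zd y RS unfolding el_def by blast
    ultimately show ?case using d(1,2) hom_src[OF 1(1)] by auto
  next
    case (2 A x z)
    then obtain B d y where d: "so C d" "d \<in> hom C B A" "el B X Y R (x \<cdot> d) y" "el B Y Z S y (z \<cdot> d)"
      using hom_src[OF 2(1)] by auto
    note Rd = elD[OF d(3)] and Sd = elD[OF d(4)]
    obtain k where k: "k \<in> hom C B (src C r)" "r \<cdot> k = pairing C X Y (x \<cdot> d) y"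
      using r(5)[OF Rd(1,2)] d(3) by (auto simp: el_def)
    obtain l where l: "l \<in> hom C B (src C s)" "s \<cdot> l = pairing C Y Z y (z \<cdot> d)"
      using s(5)[OF Sd(1,2)] d(4) by (auto simp: el_def)
    note kk = fact_r[OF k Rd(1,2)] and ll = fact_s[OF l Sd(1,2)]
    \<comment> \<open>The middle components of \<open>k\<close> and \<open>l\<close> are both
      \<open>y\<close>, so the two glue to an element of the pullback.\<close>
    obtain w where w: "w \<in> hom C B (src C t\<^sub>0)" "t\<^sub>0 \<cdot> w = k" "t\<^sub>1 \<cdot> w = l"
      using T(4)[OF k(1) l(1)] kk ll by auto
    have "m \<cdot> (e \<cdot> w) = pairing C X Z (((prj0 C X Y \<cdot> r) \<cdot> t\<^sub>0) \<cdot> w) (((prj1 C Y Z \<cdot> s) \<cdot> t\<^sub>1) \<cdot> w)"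
      using cmp_assoc[OF w(1) eh mh] me pairing_cmp[OF a c w(1)] by simp
    also have "\<dots> = pairing C X Z (x \<cdot> d) (z \<cdot> d)"
      using cmp_assoc[OF w(1) T(1) r0] cmp_assoc[OF w(1) T(2) s1] w kk ll by simp
    also have "\<dots> = pairing C X Z x z \<cdot> d" using pairing_cmp[OF 2(1,2) d(2)] by simp
    \<comment> \<open>The factorization through \<open>m\<close> has so far been found on the cover
      only; filling in \<open>d\<close> against \<open>m\<close> brings it down to
      \<open>A\<close>.\<close>
    finally obtain h where "h \<in> hom C A (src C m)" "m \<cdot> h = pairing C X Z x z"
      using so_fill[OF d(1,2) m(1) mh cmp_hom[OF w(1) eh] pairing(1)[OF 2(1,2)]] by blast
    then show ?case by blast
  qed
qed

text \<open>Since \<open>rel_comp\<close> collects representatives instead of choosing one, the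
  equality of sets also needs that each representative of the predicate arises as an
  \<open>ff\<close>-part.\<close>

lemma rel_comp_eq:
  assumes RS: "R \<in> Rel C X Y" "S \<in> Rel C Y Z" and XYZ: "X \<in> Ob C" "Y \<in> Ob C" "Z \<in> Ob C"
  defines "P \<equiv> (\<lambda>x z. \<exists>B e y. so C e \<and> e \<in> hom C B (src C x) \<and>
      el B X Y R (x \<cdot> e) y \<and> el B Y Z S y (z \<cdot> e))"
  shows "\<exists>m. represents m X Z P" "rel_comp C X Y Z S R = rel_of X Z P"
proof -
  obtain r s where rs: "r \<in> R" "s \<in> S"
    using Rel_representable[OF XYZ(1,2) RS(1)] Rel_representable[OF XYZ(2,3) RS(2)] unfolding rel_of_def by blast
  note r = representsD(4)[OF Rel_member_represents[OF rs(1) RS(1) XYZ(1,2)]]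
    and s = representsD(4)[OF Rel_member_represents[OF rs(2) RS(2) XYZ(2,3)]]
  note p = prj_hom[OF XYZ(1,2)] and q = prj_hom[OF XYZ(2,3)]
  note r0 = cmp_hom[OF r p(1)] and r1 = cmp_hom[OF r p(2)]
    and s0 = cmp_hom[OF s q(1)] and s1 = cmp_hom[OF s q(2)]
  obtain T t0 t1 where pb: "is_pullback C (prj1 C X Y \<cdot> r) (prj0 C Y Z \<cdot> s) t0 t1"
    and t: "t0 \<in> hom C T (src C r)" "t1 \<in> hom C T (src C s)"
    using has_pullback[OF r1 s0] .
  let ?f = "pairing C X Z ((prj0 C X Y \<cdot> r) \<cdot> t0) ((prj1 C Y Z \<cdot> s) \<cdot> t1)"
  have f: "?f \<in> hom C T (prod_ob C X Z)" using pairing(1)[OF cmp_hom[OF t(1) r0] cmp_hom[OF t(2) s1]] .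
  obtain I e m where em: "so C e" "ff C m" "e \<in> hom C T I" "m \<in> hom C I (prod_ob C X Z)" "m \<cdot> e = ?f"
    using image_factorization[OF f] .
  have h: "src C e = src C t0" "tgt C e = src C m" "tgt C m = prod_ob C X Z"
    using em(3,4) t by (auto simp: hom_def)
  have m: "represents m X Z P" unfolding P_def
    using comp_represents[OF rs RS XYZ pb em(1) h(1,2) em(2) h(3) em(5)] .
  then show "\<exists>m. represents m X Z P" ..
  show "rel_comp C X Y Z S R = rel_of X Z P"
  proof (intro equalityI subsetI)
    fix n assume "n \<in> rel_comp C X Y Z S R"
    then show "n \<in> rel_of X Z P"
      unfolding rel_comp_def rel_of_def P_def using comp_represents[OF _ _ RS XYZ] by blast
  next
    fix n assume "n \<in> rel_of X Z P"
    then have n: "represents n X Z P" by (simp add: rel_of_def)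
    note N = representsD[OF n] and M = representsD[OF m]
    obtain i where i: "i \<in> hom C (src C m) (src C n)" "n \<cdot> i = m"
      using represents_factors[OF m n] by (auto simp: factors_through_def)
    obtain j where j: "j \<in> hom C (src C n) (src C m)" "m \<cdot> j = n"
      using represents_factors[OF n m] by (auto simp: factors_through_def)
    \<comment> \<open>Two representatives factor through each other by inverse isomorphisms
      \<open>i\<close> and \<open>j\<close>, so composing \<open>e\<close> with \<open>i\<close>
      yields an \<open>so\<close>-part for \<open>n\<close>.\<close>
    have "n \<cdot> (i \<cdot> j) = n \<cdot> ident C (src C n)" "m \<cdot> (j \<cdot> i) = m \<cdot> ident C (src C m)"
      using cmp_assoc[OF j(1) i(1) N(4)] cmp_assoc[OF i(1) j(1) M(4)] i j ident_right[OF N(4)] ident_right[OF M(4)]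
      by simp_all
    then have "i \<cdot> j = ident C (src C n)" "j \<cdot> i = ident C (src C m)"
      using ff_mono[OF N(3,4) cmp_hom[OF j(1) i(1)] ident_hom[OF hom_Ob(1)[OF N(4)]]]
        ff_mono[OF M(3,4) cmp_hom[OF i(1) j(1)] ident_hom[OF hom_Ob(1)[OF M(4)]]] by blast+
    then have "so C i" using so_iso i j by blast
    moreover have e: "e \<in> hom C T (src C m)" using em(3,4) by (simp add: hom_def)
    ultimately have "so C (i \<cdot> e)" using so_cmp[OF em(1) _ e i(1)] by blast
    moreover have "i \<cdot> e \<in> hom C T (src C n)" "n \<cdot> (i \<cdot> e) = ?f"
      using cmp_hom[OF e i(1)] cmp_assoc[OF e i(1) N(4)] i em by auto
    ultimately have "so C (i \<cdot> e) \<and> src C (i \<cdot> e) = src C t0 \<and> tgt C (i \<cdot> e) = src C n \<and> n \<cdot> (i \<cdot> e) = ?f"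
      using t(1) by (simp add: hom_def)
    then show "n \<in> rel_comp C X Y Z S R"
      unfolding rel_comp_def using N(3) hom_tgt[OF N(4)] rs pb by blast
  qed
qed

lemma rel_comp_Rel:
  "\<lbrakk>R \<in> Rel C X Y; S \<in> Rel C Y Z; X \<in> Ob C; Y \<in> Ob C; Z \<in> Ob C\<rbrakk> \<Longrightarrow> rel_comp C X Y Z S R \<in> Rel C X Z"
  using rel_comp_eq(1)[of R X Y S Z] rel_of_Rel by (auto simp: rel_comp_eq(2)[of R X Y S Z])

lemma el_compE:
  assumes "el A X Z (rel_comp C X Y Z S R) x z" "R \<in> Rel C X Y" "S \<in> Rel C Y Z" "Y \<in> Ob C"
  obtains B e y where "so C e" "e \<in> hom C B A" "el B X Y R (x \<cdot> e) y" "el B Y Z S y (z \<cdot> e)"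
proof -
  note D = elD[OF assms(1)]
  obtain m where m: "represents m X Z (\<lambda>x z. \<exists>B e y. so C e \<and> e \<in> hom C B (src C x) \<and>
      el B X Y R (x \<cdot> e) y \<and> el B Y Z S y (z \<cdot> e))"
    using rel_comp_eq(1)[OF assms(2,3) D(4) assms(4) D(5)] by blast
  show ?thesis
    using assms(1) that
    unfolding rel_comp_eq(2)[OF assms(2,3) D(4) assms(4) D(5)] el_rel_of[OF m] hom_src[OF D(1)] by blast
qed

lemma el_compI_local:
  assumes "so C e" "e \<in> hom C B A" "el B X Y R (x \<cdot> e) y" "el B Y Z S y (z \<cdot> e)" "x \<in> hom C A X" "z \<in> hom C A Z"
  shows "el A X Z (rel_comp C X Y Z S R) x z"
proof -
  note D = elD[OF assms(3)] and E = elD[OF assms(4)]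
  obtain m where m: "represents m X Z (\<lambda>x z. \<exists>B e y. so C e \<and> e \<in> hom C B (src C x) \<and>
      el B X Y R (x \<cdot> e) y \<and> el B Y Z S y (z \<cdot> e))"
    using rel_comp_eq(1)[OF D(3) E(3) D(4,5) E(5)] by blast
  show ?thesis
    unfolding rel_comp_eq(2)[OF D(3) E(3) D(4,5) E(5)] el_rel_of[OF m] hom_src[OF assms(5)]
    using assms by blast
qed

lemma el_compI:
  assumes "el A X Y R x y" "el A Y Z S y z"
  shows "el A X Z (rel_comp C X Y Z S R) x z"
proof -
  note D = elD[OF assms(1)] and E = elD[OF assms(2)]
  show ?thesis
    by (rule el_compI_local[OF so_ident[OF D(6)] ident_hom[OF D(6)]])
      (use assms D E ident_right in auto)
qed

text \<open>The universal property of a comma object is the representing property of the inequality.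
  Conversely the components of any representing \<open>ff\<close>-morphism form a comma, so
  \<open>comma_rel\<close> is the whole class.\<close>

lemma comma_rel_eq:
  assumes f: "f \<in> hom C X Z" and g: "g \<in> hom C Y Z"
  shows "\<exists>m. represents m X Y (\<lambda>x y. f \<cdot> x \<sqsubseteq> g \<cdot> y)" "comma_rel C f g = rel_of X Y (\<lambda>x y. f \<cdot> x \<sqsubseteq> g \<cdot> y)"
proof -
  have XY: "X \<in> Ob C" "Y \<in> Ob C" using f g hom_Ob by blast+
  have rep: "represents (pairing C X Y c d) X Y (\<lambda>x y. f \<cdot> x \<sqsubseteq> g \<cdot> y)" if cd: "is_comma C f g c d" for c d
  proof -
    have c: "c \<in> hom C (src C c) X" "d \<in> hom C (src C c) Y"
      using cd f g by (auto simp: is_comma_def jointly_order_mono_def hom_def)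
    note p = pairing[OF c]
    have comps: "prj0 C X Y \<cdot> (pairing C X Y c d \<cdot> h) = c \<cdot> h" "prj1 C X Y \<cdot> (pairing C X Y c d \<cdot> h) = d \<cdot> h"
      if "h \<in> hom C A (src C c)" for A h
      using cmp_assoc[OF that p(1) prj_hom(1)[OF XY]] cmp_assoc[OF that p(1) prj_hom(2)[OF XY]] p by auto
    have "ff C (pairing C X Y c d)"
    proof (rule ffI[OF p(1)])
      fix A h k assume h: "h \<in> hom C A (src C c)" "k \<in> hom C A (src C c)"
        "pairing C X Y c d \<cdot> h \<sqsubseteq> pairing C X Y c d \<cdot> k"
      have "c \<cdot> h \<sqsubseteq> c \<cdot> k" "d \<cdot> h \<sqsubseteq> d \<cdot> k"
        using cmp_mono_right[OF cmp_hom[OF h(1) p(1)] cmp_hom[OF h(2) p(1)] prj_hom(1)[OF XY] h(3)]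
          cmp_mono_right[OF cmp_hom[OF h(1) p(1)] cmp_hom[OF h(2) p(1)] prj_hom(2)[OF XY] h(3)]
          comps[OF h(1)] comps[OF h(2)] by simp_all
      then show "h \<sqsubseteq> k" using cd h hom_Ob(1)[OF h(1)]
        unfolding is_comma_def jointly_order_mono_def by blast
    qed
    then show ?thesis
    proof (rule representsI[OF XY _ p(1)], intro iffI, goal_cases)
      case (1 A x y)
      then obtain h where h: "h \<in> hom C A (src C c)" "pairing C X Y c d \<cdot> h = pairing C X Y x y" by blast
      then have xy: "c \<cdot> h = x" "d \<cdot> h = y" using comps[OF h(1)] pairing[OF 1(1,2)] by simp_all
      have "f \<cdot> c \<sqsubseteq> g \<cdot> d" using cd by (simp add: is_comma_def)
      then have "(f \<cdot> c) \<cdot> h \<sqsubseteq> (g \<cdot> d) \<cdot> h"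
        using cmp_mono_left[OF h(1) cmp_hom[OF c(1) f] cmp_hom[OF c(2) g]] by blast
      then show ?case using cmp_assoc[OF h(1) c(1) f] cmp_assoc[OF h(1) c(2) g] xy by simp
    next
      case (2 A x y)
      then obtain h where h: "h \<in> hom C A (src C c)" "c \<cdot> h = x" "d \<cdot> h = y"
        using cd hom_Ob(1)[OF 2(1)] unfolding is_comma_def hom_src[OF f] hom_src[OF g] by blast
      then show ?case using pairing_cmp[OF c h(1)] by auto
    qed
  qed
  obtain T c d where cd: "is_comma C f g c d" using has_comma[OF f g] by blast
  then show "\<exists>m. represents m X Y (\<lambda>x y. f \<cdot> x \<sqsubseteq> g \<cdot> y)" using rep by blast
  show "comma_rel C f g = rel_of X Y (\<lambda>x y. f \<cdot> x \<sqsubseteq> g \<cdot> y)"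
  proof (intro equalityI subsetI)
    fix m assume "m \<in> comma_rel C f g"
    then show "m \<in> rel_of X Y (\<lambda>x y. f \<cdot> x \<sqsubseteq> g \<cdot> y)"
      using rep unfolding comma_rel_def rel_of_def hom_src[OF f] hom_src[OF g] by blast
  next
    fix m assume "m \<in> rel_of X Y (\<lambda>x y. f \<cdot> x \<sqsubseteq> g \<cdot> y)"
    then have m: "represents m X Y (\<lambda>x y. f \<cdot> x \<sqsubseteq> g \<cdot> y)" by (simp add: rel_of_def)
    note M = representsD[OF m]
    let ?c = "prj0 C X Y \<cdot> m" and ?d = "prj1 C X Y \<cdot> m"
    have c: "?c \<in> hom C (src C m) X" "?d \<in> hom C (src C m) Y"
      using cmp_hom[OF M(4) prj_hom(1)[OF XY]] cmp_hom[OF M(4) prj_hom(2)[OF XY]] .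
    have eta: "pairing C X Y ?c ?d = m" using pairing_eta[OF XY M(4)] .
    have ord: "h \<sqsubseteq> k" if h: "h \<in> hom C A (src C m)" "k \<in> hom C A (src C m)" "?c \<cdot> h \<sqsubseteq> ?c \<cdot> k" "?d \<cdot> h \<sqsubseteq> ?d \<cdot> k" for A h k
    proof -
      have "m \<cdot> h \<sqsubseteq> m \<cdot> k"
        by (rule prod_leqI[OF XY cmp_hom[OF h(1) M(4)] cmp_hom[OF h(2) M(4)]])
          (use h(3,4) cmp_assoc[OF h(1) M(4) prj_hom(1)[OF XY]] cmp_assoc[OF h(2) M(4) prj_hom(1)[OF XY]]
            cmp_assoc[OF h(1) M(4) prj_hom(2)[OF XY]] cmp_assoc[OF h(2) M(4) prj_hom(2)[OF XY]] in simp_all)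
      then show ?thesis using ffD[OF M(3,4)] h by blast
    qed
    have uni: "\<exists>h \<in> hom C A (src C m). ?c \<cdot> h = x \<and> ?d \<cdot> h = y"
      if xy: "x \<in> hom C A X" "y \<in> hom C A Y" "f \<cdot> x \<sqsubseteq> g \<cdot> y" for A x y
    proof -
      obtain h where h: "h \<in> hom C A (src C m)" "m \<cdot> h = pairing C X Y x y" using M(5)[OF xy(1,2)] xy by blast
      then show ?thesis
        using cmp_assoc[OF h(1) M(4) prj_hom(1)[OF XY]] cmp_assoc[OF h(1) M(4) prj_hom(2)[OF XY]]
          pairing[OF xy(1,2)] by auto
    qed
    have "is_comma C f g ?c ?d"
      unfolding is_comma_def jointly_order_mono_def
      using ord uni represents_generic[OF m]
      by (simp add: hom_src[OF f] hom_src[OF g] hom_tgt[OF f] hom_tgt[OF g] hom_Arr[OF f] hom_Arr[OF g]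
          hom_src[OF c(1)] hom_src[OF c(2)] hom_tgt[OF c(1)] hom_tgt[OF c(2)] hom_Arr[OF c(1)] hom_Arr[OF c(2)])
    then show "m \<in> comma_rel C f g"
      using eta unfolding comma_rel_def hom_src[OF f] hom_src[OF g] by (metis (mono_tags, lifting) mem_Collect_eq)
  qed
qed

lemma id_rel_Rel: "X \<in> Ob C \<Longrightarrow> id_rel C X \<in> Rel C X X"
  using comma_rel_eq[OF ident_hom ident_hom, of X] rel_of_Rel unfolding id_rel_def by metis

lemma el_id_rel: "X \<in> Ob C \<Longrightarrow> el A X X (id_rel C X) x y \<longleftrightarrow> x \<in> hom C A X \<and> y \<in> hom C A X \<and> x \<sqsubseteq> y"
  using comma_rel_eq[OF ident_hom ident_hom, of X] el_rel_of[of _ X X "\<lambda>x y. ident C X \<cdot> x \<sqsubseteq> ident C X \<cdot> y"]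
    ident_left unfolding id_rel_def by auto

lemma lower_star_Rel: "f \<in> hom C X Y \<Longrightarrow> lower_star C f \<in> Rel C X Y"
  using comma_rel_eq[OF _ ident_hom, of f X Y] hom_Ob(2) rel_of_Rel unfolding lower_star_def
  by (metis hom_tgt)

lemma el_lower_star:
  assumes f: "f \<in> hom C X Y"
  shows "el A X Y (lower_star C f) x y \<longleftrightarrow> x \<in> hom C A X \<and> y \<in> hom C A Y \<and> f \<cdot> x \<sqsubseteq> y"
proof -
  note c = comma_rel_eq[OF f ident_hom[OF hom_Ob(2)[OF f]]]
  show ?thesis
    using el_rel_of ident_left c(1) unfolding lower_star_def hom_tgt[OF f] c(2) by fastforce
qed

section \<open>Predicates that define relations, and their closure properties\<close>

definition representable :: "'o \<Rightarrow> 'o \<Rightarrow> ('a \<Rightarrow> 'a \<Rightarrow> bool) \<Rightarrow> bool" where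
  "representable X Y P \<longleftrightarrow> (\<exists>m. represents m X Y P)"

lemma rel_of_representable:
  assumes "representable X Y P"
  shows "rel_of X Y P \<in> Rel C X Y"
    "el A X Y (rel_of X Y P) x y \<longleftrightarrow> x \<in> hom C A X \<and> y \<in> hom C A Y \<and> P x y"
  using assms rel_of_Rel el_rel_of unfolding representable_def by blast+

text \<open>Inverse image of a subobject along an arbitrary arrow into the product. Substitution,
  conjunction and restriction to the diagonal are the cases of a product of two arrows, of another
  subobject and of the diagonal arrow.\<close>

lemma representable_pullback:
  assumes "represents m X Y P" "f \<in> hom C Z (prod_ob C X Y)"
  obtains I i where "ff C i" "i \<in> hom C I Z"
    "\<And>A z. z \<in> hom C A Z \<Longrightarrow>
      (\<exists>h \<in> hom C A I. i \<cdot> h = z) \<longleftrightarrow> P (prj0 C X Y \<cdot> (f \<cdot> z)) (prj1 C X Y \<cdot> (f \<cdot> z))"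
proof -
  note M = representsD[OF assms(1)]
  obtain I p i where pb: "is_pullback C m f p i" "p \<in> hom C I (src C m)" "i \<in> hom C I Z"
    using has_pullback[OF M(4) assms(2)] .
  note T = pullbackD[OF pb(1) M(4) assms(2)]
  have src: "src C p = I" using pb(2) by (simp add: hom_def)
  have "(\<exists>h \<in> hom C A I. i \<cdot> h = z) \<longleftrightarrow> P (prj0 C X Y \<cdot> (f \<cdot> z)) (prj1 C X Y \<cdot> (f \<cdot> z))"
    if z: "z \<in> hom C A Z" for A z
  proof -
    have fz: "f \<cdot> z \<in> hom C A (prod_ob C X Y)" using cmp_hom[OF z assms(2)] .
    have "(\<exists>h \<in> hom C A I. i \<cdot> h = z) \<longleftrightarrow> (\<exists>k \<in> hom C A (src C m). m \<cdot> k = f \<cdot> z)"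
    proof
      assume "\<exists>h \<in> hom C A I. i \<cdot> h = z"
      then obtain h where h: "h \<in> hom C A I" "i \<cdot> h = z" by blast
      then have "m \<cdot> (p \<cdot> h) = f \<cdot> z"
        using cmp_assoc[OF h(1) pb(2) M(4)] cmp_assoc[OF h(1) pb(3) assms(2)] T(3) by simp
      then show "\<exists>k \<in> hom C A (src C m). m \<cdot> k = f \<cdot> z" using cmp_hom[OF h(1) pb(2)] by blast
    next
      assume "\<exists>k \<in> hom C A (src C m). m \<cdot> k = f \<cdot> z"
      then show "\<exists>h \<in> hom C A I. i \<cdot> h = z" using T(4)[OF _ z] unfolding src by blast
    qed
    also have "\<dots> \<longleftrightarrow> P (prj0 C X Y \<cdot> (f \<cdot> z)) (prj1 C X Y \<cdot> (f \<cdot> z))"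
      using M(5)[OF cmp_hom[OF fz prj_hom(1)[OF M(1,2)]] cmp_hom[OF fz prj_hom(2)[OF M(1,2)]]]
        pairing_eta[OF M(1,2) fz] by simp
    finally show ?thesis .
  qed
  then show ?thesis using that[OF ff_pullback[OF pb(1) M(3,4) assms(2)] pb(3)] by blast
qed

lemma representable_mem:
  "\<lbrakk>R \<in> Rel C X Y; X \<in> Ob C; Y \<in> Ob C\<rbrakk> \<Longrightarrow> representable X Y (\<lambda>x y. rel_mem C X Y x y R)"
  using Rel_representable(1) unfolding representable_def by blast

lemma representable_cong:
  assumes "representable X Y P" "\<And>A x y. \<lbrakk>x \<in> hom C A X; y \<in> hom C A Y\<rbrakk> \<Longrightarrow> P x y \<longleftrightarrow> Q x y"
  shows "representable X Y Q"
  using assms unfolding representable_def represents_def by blast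

lemma representable_subst:
  assumes P: "representable X Y P" and f: "f \<in> hom C X' X" and g: "g \<in> hom C Y' Y"
  shows "representable X' Y' (\<lambda>x y. P (f \<cdot> x) (g \<cdot> y))"
proof -
  obtain m where m: "represents m X Y P" using P by (auto simp: representable_def)
  have XY: "X' \<in> Ob C" "Y' \<in> Ob C" using f g hom_Ob by blast+
  note p = prj_hom[OF XY]
  let ?a = "f \<cdot> prj0 C X' Y'" and ?b = "g \<cdot> prj1 C X' Y'"
  note a = cmp_hom[OF p(1) f] and b = cmp_hom[OF p(2) g]
  let ?f = "pairing C X Y ?a ?b"
  obtain I i where i: "ff C i" "i \<in> hom C I (prod_ob C X' Y')"
    "\<And>A z. z \<in> hom C A (prod_ob C X' Y') \<Longrightarrow>
      (\<exists>h \<in> hom C A I. i \<cdot> h = z) \<longleftrightarrow> P (prj0 C X Y \<cdot> (?f \<cdot> z)) (prj1 C X Y \<cdot> (?f \<cdot> z))"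
    by (rule representable_pullback[OF m pairing(1)[OF a b]]) (rule that)
  have "represents i X' Y' (\<lambda>x y. P (f \<cdot> x) (g \<cdot> y))"
  proof (rule representsI[OF XY i(1,2)])
    fix A x y assume xy: "x \<in> hom C A X'" "y \<in> hom C A Y'"
    note z = pairing[OF xy]
    have "prj0 C X Y \<cdot> (?f \<cdot> pairing C X' Y' x y) = f \<cdot> x" "prj1 C X Y \<cdot> (?f \<cdot> pairing C X' Y' x y) = g \<cdot> y"
      using pairing_cmp[OF a b z(1)] pairing[OF cmp_hom[OF z(1) a] cmp_hom[OF z(1) b]]
        cmp_assoc[OF z(1) p(1) f] cmp_assoc[OF z(1) p(2) g] z by simp_all
    then show "(\<exists>h \<in> hom C A I. i \<cdot> h = pairing C X' Y' x y) \<longleftrightarrow> P (f \<cdot> x) (g \<cdot> y)"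
      using i(3)[OF z(1)] by simp
  qed
  then show ?thesis by (auto simp: representable_def)
qed

lemma representable_conj:
  assumes "representable X Y P" "representable X Y Q"
  shows "representable X Y (\<lambda>x y. P x y \<and> Q x y)"
proof -
  obtain m n where m: "represents m X Y P" and n: "represents n X Y Q"
    using assms by (auto simp: representable_def)
  note M = representsD[OF m] and N = representsD[OF n]
  obtain I i where i: "ff C i" "i \<in> hom C I (src C m)"
    "\<And>A z. z \<in> hom C A (src C m) \<Longrightarrow>
      (\<exists>h \<in> hom C A I. i \<cdot> h = z) \<longleftrightarrow> Q (prj0 C X Y \<cdot> (m \<cdot> z)) (prj1 C X Y \<cdot> (m \<cdot> z))"
    by (rule representable_pullback[OF n M(4)]) (rule that)
  have "represents (m \<cdot> i) X Y (\<lambda>x y. P x y \<and> Q x y)"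
  proof (rule representsI[OF M(1,2) ff_cmp[OF i(1) M(3) i(2) M(4)] cmp_hom[OF i(2) M(4)]], intro iffI, goal_cases)
    case (1 A x y)
    then obtain h where h: "h \<in> hom C A I" "(m \<cdot> i) \<cdot> h = pairing C X Y x y" by blast
    note k = cmp_hom[OF h(1) i(2)]
    have "m \<cdot> (i \<cdot> h) = pairing C X Y x y" using cmp_assoc[OF h(1) i(2) M(4)] h by simp
    then show ?case using M(5)[OF 1(1,2)] i(3)[OF k] k pairing[OF 1(1,2)] h by auto
  next
    case (2 A x y)
    then obtain k where k: "k \<in> hom C A (src C m)" "m \<cdot> k = pairing C X Y x y" using M(5)[OF 2(1,2)] by blast
    then obtain h where h: "h \<in> hom C A I" "i \<cdot> h = k" using i(3)[OF k(1)] pairing[OF 2(1,2)] 2(3) by auto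
    then show ?case using cmp_assoc[OF h(1) i(2) M(4)] k by auto
  qed
  then show ?thesis by (auto simp: representable_def)
qed

lemma representable_True:
  assumes XY: "X \<in> Ob C" "Y \<in> Ob C"
  shows "representable X Y (\<lambda>_ _. True)"
proof -
  note O = prod_ob_Ob[OF XY]
  have "represents (ident C (prod_ob C X Y)) X Y (\<lambda>_ _. True)"
    by (rule representsI[OF XY ff_ident[OF O] ident_hom[OF O]]) (use pairing(1) ident_left in blast)
  then show ?thesis by (auto simp: representable_def)
qed

lemma representable_diagonal:
  assumes "R \<in> Rel C X X" "X \<in> Ob C"
  obtains I i where "ff C i" "i \<in> hom C I X"
    "\<And>A x. x \<in> hom C A X \<Longrightarrow> (\<exists>h \<in> hom C A I. i \<cdot> h = x) \<longleftrightarrow> el A X X R x x"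
proof -
  obtain m where m: "represents m X X (\<lambda>x y. rel_mem C X X x y R)" using Rel_representable(1) assms by blast
  note id = ident_hom[OF assms(2)]
  let ?d = "pairing C X X (ident C X) (ident C X)"
  obtain I i where i: "ff C i" "i \<in> hom C I X"
    "\<And>A z. z \<in> hom C A X \<Longrightarrow> (\<exists>h \<in> hom C A I. i \<cdot> h = z) \<longleftrightarrow>
      rel_mem C X X (prj0 C X X \<cdot> (?d \<cdot> z)) (prj1 C X X \<cdot> (?d \<cdot> z)) R"
    by (rule representable_pullback[OF m pairing(1)[OF id id]]) (rule that)
  have "(\<exists>h \<in> hom C A I. i \<cdot> h = x) \<longleftrightarrow> el A X X R x x" if x: "x \<in> hom C A X" for A x
    using i(3)[OF x] pairing_cmp[OF id id x] ident_left[OF x] pairing[OF x x] x assms(1) by (simp add: el_def)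
  then show ?thesis using that i(1,2) by blast
qed

end

section \<open>The internal calculus of the exact completion\<close>

context regular_poset_category
begin

abbreviation Qw_C ("\<Q>") where "\<Q> \<equiv> Qw C"
abbreviation ex_reg_C ("\<X>") where "\<X> \<equiv> ex_reg C"
abbreviation Qw_cmp (infixl "\<odot>" 70) where "g \<odot> f \<equiv> g \<cdot>\<^bsub>\<Q>\<^esub> f"

text \<open>Transitivity of the composite reduces to transitivity of elements at one stage because
  the conclusion is local: an intermediate element on a cover is enough.\<close>

lemma congruence_iff:
  assumes X: "X \<in> Ob C"
  shows "congruence C X E \<longleftrightarrow> E \<in> Rel C X X \<and>
    (\<forall>A x y. x \<in> hom C A X \<longrightarrow> y \<in> hom C A X \<longrightarrow> x \<sqsubseteq> y \<longrightarrow> el A X X E x y) \<and>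
    (\<forall>A x y z. el A X X E x y \<longrightarrow> el A X X E y z \<longrightarrow> el A X X E x z)" (is "?l \<longleftrightarrow> ?r")
proof
  assume l: ?l
  then have E: "E \<in> Rel C X X" by (simp add: congruence_def)
  have "el A X X E x y" if "x \<in> hom C A X" "y \<in> hom C A X" "x \<sqsubseteq> y" for A x y
    using l that rel_le_iff[OF X X id_rel_Rel[OF X] E] el_id_rel[OF X] by (auto simp: congruence_def)
  moreover have "el A X X E x z" if "el A X X E x y" "el A X X E y z" for A x y z
    using l el_compI[OF that] rel_le_iff[OF X X rel_comp_Rel[OF E E X X X] E] by (auto simp: congruence_def)
  ultimately show ?r using E by blast
next
  assume r: ?r
  then have E: "E \<in> Rel C X X" by blast
  have "rel_mem C X X x' y' E" if "x \<in> hom C A X" "x' \<in> hom C A X" "y \<in> hom C A X" "y' \<in> hom C A X"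
    "x' \<sqsubseteq> x" "rel_mem C X X x y E" "y \<sqsubseteq> y'" for A x x' y y'
  proof -
    \<comment> \<open>Weakening is transitivity along a chain of three steps whose outer two come
      from the order.\<close>
    have "el A X X E x' x" "el A X X E x y" "el A X X E y y'" using r that by (auto simp: el_def)
    then have "el A X X E x' y'" using r by blast
    then show ?thesis by (simp add: el_def)
  qed
  then have "weakening_closed C X X E" unfolding weakening_closed_def by blast
  moreover have "rel_le C (id_rel C X) E"
    using r el_id_rel[OF X] unfolding rel_le_iff[OF X X id_rel_Rel[OF X] E] by blast
  moreover have "el A X X E x z" if xz: "el A X X (rel_comp C X X X E E) x z" for A x z
  proof -
    obtain B e y where e: "so C e" "e \<in> hom C B A" "el B X X E (x \<cdot> e) y" "el B X X E y (z \<cdot> e)"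
      using el_compE[OF xz E E X] .
    then have "el B X X E (x \<cdot> e) (z \<cdot> e)" using r by blast
    then show ?thesis using el_local[OF e(1,2)] elD[OF xz] by blast
  qed
  then have "rel_le C (rel_comp C X X X E E) E"
    unfolding rel_le_iff[OF X X rel_comp_Rel[OF E E X X X] E] by blast
  ultimately show ?l using E by (simp add: congruence_def)
qed

text \<open>For an arrow \<open>f : X \<rightarrow> Y\<close> of \<open>Q\<^sub>w(C)\<close>, \<open>holds A f x y\<close> says \<open>(x, y) \<in>\<^sub>A f\<close>; \<open>le A X\<close> is
  membership in the congruence of \<open>X\<close>.\<close>

definition holds :: "'o \<Rightarrow> ('o, 'a) cong_arr \<Rightarrow> 'a \<Rightarrow> 'a \<Rightarrow> bool" where
  "holds A f x y \<longleftrightarrow> el A (fst (fst f)) (fst (fst (snd f))) (snd (snd f)) x y"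

definition le :: "'o \<Rightarrow> ('o, 'a) cong \<Rightarrow> 'a \<Rightarrow> 'a \<Rightarrow> bool" where
  "le A X x y \<longleftrightarrow> el A (fst X) (fst X) (snd X) x y"

lemma Qw_simps:
  "X \<in> Ob \<Q> \<longleftrightarrow> fst X \<in> Ob C \<and> congruence C (fst X) (snd X)"
  "src \<Q> f = fst f" "tgt \<Q> f = fst (snd f)" "ident \<Q> X = (X, X, snd X)"
  "g \<odot> f = (fst f, fst (snd g),
     rel_comp C (fst (fst f)) (fst (fst g)) (fst (fst (snd g))) (snd (snd g)) (snd (snd f)))"
  "f \<sqsubseteq>\<^bsub>\<Q>\<^esub> g \<longleftrightarrow> rel_le C (snd (snd f)) (snd (snd g))"
  by (simp_all add: Qw_def split_beta)

lemma ex_reg_simps: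
  "Ob \<X> = Ob \<Q>" "src \<X> = src \<Q>" "tgt \<X> = tgt \<Q>" "ident \<X> = ident \<Q>" "cmp \<X> = cmp \<Q>"
  "f \<sqsubseteq>\<^bsub>\<X>\<^esub> g \<longleftrightarrow> g \<sqsubseteq>\<^bsub>\<Q>\<^esub> f"
  by (simp_all add: ex_reg_def Qw_def)

lemma hom_ex_reg: "hom \<X> X Y = {f \<in> hom \<Q> X Y. has_right_adjoint \<Q> f}"
  by (auto simp: hom_def ex_reg_def Qw_def)

lemma le_typed:
  assumes "le A X x y"
  shows "x \<in> hom C A (fst X)" "y \<in> hom C A (fst X)"
  using assms by (auto simp: le_def el_def)

lemma Ob_Qw:
  assumes "X \<in> Ob \<Q>"
  shows "fst X \<in> Ob C" "snd X \<in> Rel C (fst X) (fst X)"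
    and leq_le: "\<lbrakk>x \<in> hom C A (fst X); y \<in> hom C A (fst X); x \<sqsubseteq> y\<rbrakk> \<Longrightarrow> le A X x y"
    and le_refl: "x \<in> hom C A (fst X) \<Longrightarrow> le A X x x"
    and le_trans: "\<lbrakk>le A X x y; le A X y z\<rbrakk> \<Longrightarrow> le A X x z"
proof -
  show 1: "fst X \<in> Ob C" using assms by (simp add: Qw_simps)
  have c: "congruence C (fst X) (snd X)" using assms by (simp add: Qw_simps)
  show "snd X \<in> Rel C (fst X) (fst X)" using c congruence_iff[OF 1] by blast
  show 2: "\<lbrakk>x \<in> hom C A (fst X); y \<in> hom C A (fst X); x \<sqsubseteq> y\<rbrakk> \<Longrightarrow> le A X x y" for x y
    using c congruence_iff[OF 1] unfolding le_def by blast
  show "x \<in> hom C A (fst X) \<Longrightarrow> le A X x x" using 2 leq_refl by blast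
  show "\<lbrakk>le A X x y; le A X y z\<rbrakk> \<Longrightarrow> le A X x z"
    using c congruence_iff[OF 1] unfolding le_def by blast
qed

lemma Ob_QwI:
  assumes "fst X \<in> Ob C" "snd X \<in> Rel C (fst X) (fst X)"
    "\<And>A x y. \<lbrakk>x \<in> hom C A (fst X); y \<in> hom C A (fst X); x \<sqsubseteq> y\<rbrakk> \<Longrightarrow> le A X x y"
    "\<And>A x y z. \<lbrakk>le A X x y; le A X y z\<rbrakk> \<Longrightarrow> le A X x z"
  shows "X \<in> Ob \<Q>"
  using assms congruence_iff[OF assms(1)] unfolding Qw_simps le_def by blast

lemma le_restrict: "\<lbrakk>le A X x y; h \<in> hom C B A\<rbrakk> \<Longrightarrow> le B X (x \<cdot> h) (y \<cdot> h)"
  unfolding le_def by (rule el_restrict)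

lemma le_local:
  "\<lbrakk>so C e; e \<in> hom C B A; x \<in> hom C A (fst X); y \<in> hom C A (fst X); le B X (x \<cdot> e) (y \<cdot> e)\<rbrakk> \<Longrightarrow> le A X x y"
  unfolding le_def by (rule el_local)

text \<open>Of the equation between the relation and its composite with both congruences, one
  inclusion says that the relation absorbs the congruences on either side, and the other is supplied
  by reflexivity.\<close>

lemma hom_Qw_iff:
  "f \<in> hom \<Q> X Y \<longleftrightarrow> X \<in> Ob \<Q> \<and> Y \<in> Ob \<Q> \<and> fst f = X \<and> fst (snd f) = Y \<and>
    snd (snd f) \<in> Rel C (fst X) (fst Y) \<and>
    (\<forall>A x' x y. le A X x' x \<longrightarrow> holds A f x y \<longrightarrow> holds A f x' y) \<and>
    (\<forall>A x y y'. holds A f x y \<longrightarrow> le A Y y y' \<longrightarrow> holds A f x y')" (is "?l \<longleftrightarrow> ?r")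
proof -
  let ?R = "snd (snd f)" and ?X = "fst X" and ?Y = "fst Y"
  have "f \<in> hom \<Q> X Y \<longleftrightarrow> X \<in> Ob \<Q> \<and> Y \<in> Ob \<Q> \<and> fst f = X \<and> fst (snd f) = Y \<and>
      ?R \<in> Rel C ?X ?Y \<and> rel_comp C ?X ?Y ?Y (snd Y) (rel_comp C ?X ?X ?Y ?R (snd X)) = ?R"
    (is "?a \<longleftrightarrow> ?b")
  proof -
    have "f \<in> Arr \<Q> \<longleftrightarrow> fst f \<in> Ob \<Q> \<and> fst (snd f) \<in> Ob \<Q> \<and> ?R \<in> Rel C (fst (fst f)) (fst (fst (snd f))) \<and>
      rel_comp C (fst (fst f)) (fst (fst (snd f))) (fst (fst (snd f))) (snd (fst (snd f)))
        (rel_comp C (fst (fst f)) (fst (fst f)) (fst (fst (snd f))) ?R (snd (fst f))) = ?R"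
      unfolding Qw_simps by (simp add: Qw_def split_beta)
    then show "?a \<longleftrightarrow> ?b" unfolding hom_def mem_Collect_eq Qw_simps(2,3) by metis
  qed
  also have "\<dots> \<longleftrightarrow> ?r"
  proof (intro conj_cong refl)
    assume X: "X \<in> Ob \<Q>" and Y: "Y \<in> Ob \<Q>" and f: "fst f = X" "fst (snd f) = Y" and R: "?R \<in> Rel C ?X ?Y"
    note OX = Ob_Qw[OF X] and OY = Ob_Qw[OF Y]
    note RE = rel_comp_Rel[OF OX(2) R OX(1) OX(1) OY(1)]
    note FRE = rel_comp_Rel[OF RE OY(2) OX(1) OY(1) OY(1)]
    have h: "holds A f x y \<longleftrightarrow> el A ?X ?Y ?R x y" for A x y by (simp add: holds_def f)
    show "rel_comp C ?X ?Y ?Y (snd Y) (rel_comp C ?X ?X ?Y ?R (snd X)) = ?R \<longleftrightarrow>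
      (\<forall>A x' x y. le A X x' x \<longrightarrow> holds A f x y \<longrightarrow> holds A f x' y) \<and>
      (\<forall>A x y y'. holds A f x y \<longrightarrow> le A Y y y' \<longrightarrow> holds A f x y')" (is "?e \<longleftrightarrow> ?c1 \<and> ?c2")
    proof
      assume eq: ?e
      \<comment> \<open>Absorption on both sides at once; a reflexive pair at either end separates
        the two one-sided laws.\<close>
      have tri: "holds A f x' y'" if "le A X x' x" "holds A f x y" "le A Y y y'" for A x' x y y'
        using el_compI[OF el_compI[OF that(1)[unfolded le_def] that(2)[unfolded h]] that(3)[unfolded le_def]]
        unfolding h eq .
      have "holds A f x' y" if "le A X x' x" "holds A f x y" for A x' x y
        using tri[OF that OY(4)] elD(2) that(2)[unfolded h] by blast
      moreover have "holds A f x y'" if "holds A f x y" "le A Y y y'" for A x y y'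
        using tri[OF OX(4) that] elD(1) that(1)[unfolded h] by blast
      ultimately show "?c1 \<and> ?c2" by blast
    next
      assume c: "?c1 \<and> ?c2"
      show ?e
      proof (rule rel_eqI[OF OX(1) OY(1) FRE R], rule iffI)
        fix A x z assume xz: "el A ?X ?Y (rel_comp C ?X ?Y ?Y (snd Y) (rel_comp C ?X ?X ?Y ?R (snd X))) x z"
        obtain B e y where e: "so C e" "e \<in> hom C B A" and
          xy: "el B ?X ?Y (rel_comp C ?X ?X ?Y ?R (snd X)) (x \<cdot> e) y" and yz: "el B ?Y ?Y (snd Y) y (z \<cdot> e)"
          using el_compE[OF xz RE OY(2,1)] .
        obtain D d w where d: "so C d" "d \<in> hom C D B" and
          xw: "el D ?X ?X (snd X) ((x \<cdot> e) \<cdot> d) w" and wy: "el D ?X ?Y ?R w (y \<cdot> d)"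
          using el_compE[OF xy OX(2) R OX(1)] .
        have "el D ?X ?Y ?R ((x \<cdot> e) \<cdot> d) ((z \<cdot> e) \<cdot> d)"
          using c xw wy el_restrict[OF yz d(2)] unfolding h le_def by blast
        then show "el A ?X ?Y ?R x z"
          using el_local[OF d] el_local[OF e] elD[OF xz] elD[OF xy] elD[OF yz] by blast
      next
        fix A x z assume xz: "el A ?X ?Y ?R x z"
        then show "el A ?X ?Y (rel_comp C ?X ?Y ?Y (snd Y) (rel_comp C ?X ?X ?Y ?R (snd X))) x z"
          using el_compI[OF el_compI[OF OX(4)[OF elD(1)[OF xz], unfolded le_def] xz]
              OY(4)[OF elD(2)[OF xz], unfolded le_def]] by blast
      qed
    qed
  qed
  finally show ?thesis .
qed

lemma Qw_hom:
  assumes "f \<in> hom \<Q> X Y"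
  shows "X \<in> Ob \<Q>" "Y \<in> Ob \<Q>" "fst f = X" "fst (snd f) = Y" "snd (snd f) \<in> Rel C (fst X) (fst Y)"
    and holds_left: "\<And>A x' x y. \<lbrakk>le A X x' x; holds A f x y\<rbrakk> \<Longrightarrow> holds A f x' y"
    and holds_right: "\<And>A x y y'. \<lbrakk>holds A f x y; le A Y y y'\<rbrakk> \<Longrightarrow> holds A f x y'"
    and holds_typed1: "\<And>A x y. holds A f x y \<Longrightarrow> x \<in> hom C A (fst X)"
    and holds_typed2: "\<And>A x y. holds A f x y \<Longrightarrow> y \<in> hom C A (fst Y)"
proof -
  show 1: "X \<in> Ob \<Q>" "Y \<in> Ob \<Q>" "fst f = X" "fst (snd f) = Y" "snd (snd f) \<in> Rel C (fst X) (fst Y)"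
    "\<And>A x' x y. \<lbrakk>le A X x' x; holds A f x y\<rbrakk> \<Longrightarrow> holds A f x' y"
    "\<And>A x y y'. \<lbrakk>holds A f x y; le A Y y y'\<rbrakk> \<Longrightarrow> holds A f x y'"
    using assms unfolding hom_Qw_iff by blast+
  show "holds A f x y \<Longrightarrow> x \<in> hom C A (fst X)" "holds A f x y \<Longrightarrow> y \<in> hom C A (fst Y)" for A x y
    unfolding holds_def el_def 1(3,4) by blast+
qed

lemma holds_restrict: "\<lbrakk>holds A f x y; h \<in> hom C B A\<rbrakk> \<Longrightarrow> holds B f (x \<cdot> h) (y \<cdot> h)"
  unfolding holds_def by (rule el_restrict)

lemma holds_local:
  assumes "f \<in> hom \<Q> X Y" "so C e" "e \<in> hom C B A" "x \<in> hom C A (fst X)" "y \<in> hom C A (fst Y)"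
    "holds B f (x \<cdot> e) (y \<cdot> e)"
  shows "holds A f x y"
  using assms Qw_hom(3,4)[OF assms(1)] el_local[OF assms(2,3)] unfolding holds_def by simp

lemma holds_ident: "holds A (ident \<Q> X) x y \<longleftrightarrow> le A X x y"
  by (simp add: holds_def le_def Qw_simps)

lemma holds_compI:
  assumes "f \<in> hom \<Q> X Y" "g \<in> hom \<Q> Y Z" "holds A f x y" "holds A g y z"
  shows "holds A (g \<odot> f) x z"
  using assms(3,4) Qw_hom(3,4)[OF assms(1)] Qw_hom(3,4)[OF assms(2)] el_compI
  unfolding holds_def by (simp add: Qw_simps)

lemma holds_compE:
  assumes "f \<in> hom \<Q> X Y" "g \<in> hom \<Q> Y Z" "holds A (g \<odot> f) x z"
  obtains B e y where "so C e" "e \<in> hom C B A" "holds B f (x \<cdot> e) y" "holds B g y (z \<cdot> e)"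
    "x \<in> hom C A (fst X)" "z \<in> hom C A (fst Z)"
proof -
  note F = Qw_hom[OF assms(1)] and G = Qw_hom[OF assms(2)]
  have el: "el A (fst X) (fst Z) (rel_comp C (fst X) (fst Y) (fst Z) (snd (snd g)) (snd (snd f))) x z"
    using assms(3) F(3,4) G(3,4) by (simp add: holds_def Qw_simps)
  show ?thesis
    by (rule el_compE[OF el F(5) G(5) Ob_Qw(1)[OF F(2)]])
      (rule that; use F(3,4) G(3,4) elD[OF el] in \<open>simp add: holds_def\<close>)
qed

lemma holds_eqI:
  assumes "f \<in> hom \<Q> X Y" "g \<in> hom \<Q> X Y" "\<And>A x y. holds A f x y \<longleftrightarrow> holds A g x y"
  shows "f = g"
proof -
  note F = Qw_hom[OF assms(1)] and G = Qw_hom[OF assms(2)]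
  have "snd (snd f) = snd (snd g)"
    using rel_eqI[OF Ob_Qw(1)[OF F(1)] Ob_Qw(1)[OF F(2)] F(5) G(5)] assms(3) F(3,4) G(3,4)
    unfolding holds_def by simp
  then show ?thesis using F(3,4) G(3,4) by (simp add: prod_eq_iff)
qed

lemma leq_Qw_iff:
  assumes "f \<in> hom \<Q> X Y" "g \<in> hom \<Q> X Y"
  shows "f \<sqsubseteq>\<^bsub>\<Q>\<^esub> g \<longleftrightarrow> (\<forall>A x y. holds A f x y \<longrightarrow> holds A g x y)"
proof -
  note F = Qw_hom[OF assms(1)] and G = Qw_hom[OF assms(2)]
  show ?thesis
    using rel_le_iff[OF Ob_Qw(1)[OF F(1)] Ob_Qw(1)[OF F(2)] F(5) G(5)] F(3,4) G(3,4)
    unfolding holds_def by (simp add: Qw_simps)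
qed

section \<open>Identities and composites of bimodules; arrows defined by predicates\<close>

lemma ident_Qw_hom:
  assumes X: "X \<in> Ob \<Q>"
  shows "ident \<Q> X \<in> hom \<Q> X X"
proof -
  note O = Ob_Qw[OF X]
  have "fst (ident \<Q> X) = X" "fst (snd (ident \<Q> X)) = X" "snd (snd (ident \<Q> X)) = snd X"
    by (simp_all add: Qw_simps)
  then show ?thesis unfolding hom_Qw_iff holds_ident using X O(2,5) by simp
qed

lemma cmp_Qw_hom:
  assumes f: "f \<in> hom \<Q> X Y" and g: "g \<in> hom \<Q> Y Z"
  shows "g \<odot> f \<in> hom \<Q> X Z"
proof -
  note F = Qw_hom[OF f] and G = Qw_hom[OF g]
  let ?gf = "g \<odot> f"
  have h: "holds A ?gf x z \<longleftrightarrow> el A (fst X) (fst Z) (snd (snd ?gf)) x z" for A x z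
    using F(3,4) G(3,4) by (simp add: holds_def Qw_simps)
  have "holds A ?gf x' z" if xx: "le A X x' x" and xz: "holds A ?gf x z" for A x' x z
  proof -
    obtain B e y where e: "so C e" "e \<in> hom C B A" "holds B f (x \<cdot> e) y" "holds B g y (z \<cdot> e)"
      and z: "z \<in> hom C A (fst Z)"
      using holds_compE[OF f g xz] .
    have "holds B ?gf (x' \<cdot> e) (z \<cdot> e)"
      using holds_compI[OF f g F(6)[OF le_restrict[OF xx e(2)] e(3)] e(4)] .
    then show ?thesis using el_local[OF e(1,2) le_typed(1)[OF xx] z] unfolding h by blast
  qed
  moreover have "holds A ?gf x z'" if xz: "holds A ?gf x z" and zz: "le A Z z z'" for A x z z'
  proof -
    obtain B e y where e: "so C e" "e \<in> hom C B A" "holds B f (x \<cdot> e) y" "holds B g y (z \<cdot> e)"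
      and x: "x \<in> hom C A (fst X)"
      using holds_compE[OF f g xz] .
    have "holds B ?gf (x \<cdot> e) (z' \<cdot> e)"
      using holds_compI[OF f g e(3) G(7)[OF e(4) le_restrict[OF zz e(2)]]] .
    then show ?thesis using el_local[OF e(1,2) x le_typed(2)[OF zz]] unfolding h by blast
  qed
  moreover have "snd (snd ?gf) \<in> Rel C (fst X) (fst Z)"
    using rel_comp_Rel[OF F(5) G(5) Ob_Qw(1)[OF F(1)] Ob_Qw(1)[OF F(2)] Ob_Qw(1)[OF G(2)]] F(3,4) G(3,4)
    by (simp add: Qw_simps)
  moreover have "fst ?gf = X" "fst (snd ?gf) = Z" using F G by (simp_all add: Qw_simps)
  ultimately show ?thesis unfolding hom_Qw_iff using F(1) G(2) by blast
qed

text \<open>The predicates \<open>el\<close>, \<open>holds\<close> and \<open>le\<close> take the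
  stage as an argument, those of \<open>representable\<close> do not; the stage is recovered as the
  source of the first element.\<close>

definition repr :: "'o \<Rightarrow> 'o \<Rightarrow> ('o \<Rightarrow> 'a \<Rightarrow> 'a \<Rightarrow> bool) \<Rightarrow> bool" where
  "repr X Y P \<longleftrightarrow> representable X Y (\<lambda>x y. P (src C x) x y)"

definition rel :: "'o \<Rightarrow> 'o \<Rightarrow> ('o \<Rightarrow> 'a \<Rightarrow> 'a \<Rightarrow> bool) \<Rightarrow> 'a set" where
  "rel X Y P = rel_of X Y (\<lambda>x y. P (src C x) x y)"

definition arrow :: "('o, 'a) cong \<Rightarrow> ('o, 'a) cong \<Rightarrow> ('o \<Rightarrow> 'a \<Rightarrow> 'a \<Rightarrow> bool) \<Rightarrow> ('o, 'a) cong_arr" where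
  "arrow X Y P = (X, Y, rel (fst X) (fst Y) P)"

lemma rel_repr:
  assumes "repr X Y P"
  shows "rel X Y P \<in> Rel C X Y"
    "el A X Y (rel X Y P) x y \<longleftrightarrow> x \<in> hom C A X \<and> y \<in> hom C A Y \<and> P A x y"
  using rel_of_representable[OF assms[unfolded repr_def]] unfolding rel_def by (auto simp: hom_def)

lemma repr_el: "\<lbrakk>R \<in> Rel C X Y; X \<in> Ob C; Y \<in> Ob C\<rbrakk> \<Longrightarrow> repr X Y (\<lambda>A. el A X Y R)"
  unfolding repr_def by (rule representable_cong[OF representable_mem]) (auto simp: el_def hom_def)

lemma repr_cong:
  assumes "repr X Y P" "\<And>A x y. \<lbrakk>x \<in> hom C A X; y \<in> hom C A Y\<rbrakk> \<Longrightarrow> P A x y \<longleftrightarrow> P' A x y"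
  shows "repr X Y P'"
  using assms(1) unfolding repr_def by (rule representable_cong) (auto simp: assms(2) hom_src)

lemma repr_holds:
  assumes "f \<in> hom \<Q> X Y"
  shows "repr (fst X) (fst Y) (\<lambda>A. holds A f)"
  unfolding holds_def Qw_hom(3,4)[OF assms]
  using repr_el[OF Qw_hom(5)[OF assms]] Ob_Qw(1) Qw_hom(1,2)[OF assms] by blast

lemma repr_le: "X \<in> Ob \<Q> \<Longrightarrow> repr (fst X) (fst X) (\<lambda>A. le A X)"
  unfolding le_def by (rule repr_el) (use Ob_Qw(1,2) in blast)+

lemma repr_subst:
  assumes "repr X Y P" "f \<in> hom C X' X" "g \<in> hom C Y' Y"
  shows "repr X' Y' (\<lambda>A x y. P A (f \<cdot> x) (g \<cdot> y))"
  using representable_subst[OF assms(1)[unfolded repr_def] assms(2,3)] unfolding repr_def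
  by (rule representable_cong) (use cmp_hom[OF _ assms(2)] in \<open>auto simp: hom_def\<close>)

lemma repr_subst_left:
  assumes "repr X Y P" "f \<in> hom C X' X" "Y \<in> Ob C"
  shows "repr X' Y (\<lambda>A x y. P A (f \<cdot> x) y)"
  by (rule repr_cong[OF repr_subst[OF assms(1,2) ident_hom[OF assms(3)]]]) (simp add: ident_left)

lemma repr_subst_right:
  assumes "repr X Y P" "g \<in> hom C Y' Y" "X \<in> Ob C"
  shows "repr X Y' (\<lambda>A x y. P A x (g \<cdot> y))"
  by (rule repr_cong[OF repr_subst[OF assms(1) ident_hom[OF assms(3)] assms(2)]]) (simp add: ident_left)

lemma repr_conj: "\<lbrakk>repr X Y P; repr X Y P'\<rbrakk> \<Longrightarrow> repr X Y (\<lambda>A x y. P A x y \<and> P' A x y)"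
  unfolding repr_def by (rule representable_conj)

lemma repr_True: "\<lbrakk>X \<in> Ob C; Y \<in> Ob C\<rbrakk> \<Longrightarrow> repr X Y (\<lambda>_ _ _. True)"
  unfolding repr_def by (rule representable_True)

lemma holds_arrow:
  "repr (fst X) (fst Y) P \<Longrightarrow>
    holds A (arrow X Y P) x y \<longleftrightarrow> x \<in> hom C A (fst X) \<and> y \<in> hom C A (fst Y) \<and> P A x y"
  unfolding holds_def arrow_def using rel_repr by simp

lemma arrow_hom:
  assumes "X \<in> Ob \<Q>" "Y \<in> Ob \<Q>" "repr (fst X) (fst Y) P"
    "\<And>A x' x y. \<lbrakk>le A X x' x; y \<in> hom C A (fst Y); P A x y\<rbrakk> \<Longrightarrow> P A x' y"
    "\<And>A x y y'. \<lbrakk>x \<in> hom C A (fst X); P A x y; le A Y y y'\<rbrakk> \<Longrightarrow> P A x y'"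
  shows "arrow X Y P \<in> hom \<Q> X Y"
proof -
  have "fst (arrow X Y P) = X" "fst (snd (arrow X Y P)) = Y" "snd (snd (arrow X Y P)) \<in> Rel C (fst X) (fst Y)"
    using rel_repr(1)[OF assms(3)] by (simp_all add: arrow_def)
  moreover have "holds A (arrow X Y P) x' y" if "le A X x' x" "holds A (arrow X Y P) x y" for A x' x y
    using that assms(4) le_typed(1) unfolding holds_arrow[OF assms(3)] by blast
  moreover have "holds A (arrow X Y P) x y'" if "holds A (arrow X Y P) x y" "le A Y y y'" for A x y y'
    using that assms(5) le_typed(2) unfolding holds_arrow[OF assms(3)] by blast
  ultimately show ?thesis unfolding hom_Qw_iff using assms(1,2) by blast
qed

lemma Ob_rel:
  assumes "X \<in> Ob C" "repr X X P"
    "\<And>A x y. \<lbrakk>x \<in> hom C A X; y \<in> hom C A X; x \<sqsubseteq> y\<rbrakk> \<Longrightarrow> P A x y"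
    "\<And>A x y z. \<lbrakk>x \<in> hom C A X; y \<in> hom C A X; z \<in> hom C A X; P A x y; P A y z\<rbrakk> \<Longrightarrow> P A x z"
  shows "(X, rel X X P) \<in> Ob \<Q>"
    "le A (X, rel X X P) x y \<longleftrightarrow> x \<in> hom C A X \<and> y \<in> hom C A X \<and> P A x y"
proof -
  show le: "le A (X, rel X X P) x y \<longleftrightarrow> x \<in> hom C A X \<and> y \<in> hom C A X \<and> P A x y" for A x y
    using rel_repr(2)[OF assms(2)] by (simp add: le_def)
  show "(X, rel X X P) \<in> Ob \<Q>"
  proof (rule Ob_QwI)
    show "fst (X, rel X X P) \<in> Ob C" "snd (X, rel X X P) \<in> Rel C (fst (X, rel X X P)) (fst (X, rel X X P))"
      using assms(1) rel_repr(1)[OF assms(2)] by simp_all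
    show "le A (X, rel X X P) x y"
      if "x \<in> hom C A (fst (X, rel X X P))" "y \<in> hom C A (fst (X, rel X X P))" "x \<sqsubseteq> y" for A x y
      using that assms(3) unfolding le by simp
    show "le A (X, rel X X P) x z" if "le A (X, rel X X P) x y" "le A (X, rel X X P) y z" for A x y z
      using that assms(4) unfolding le by blast
  qed
qed

section \<open>Adjoint pairs and values\<close>

definition is_adj :: "('o, 'a) cong \<Rightarrow> ('o, 'a) cong \<Rightarrow> ('o, 'a) cong_arr \<Rightarrow> ('o, 'a) cong_arr \<Rightarrow> bool" where
  "is_adj X Y f g \<longleftrightarrow> f \<in> hom \<Q> X Y \<and> g \<in> hom \<Q> Y X \<and>
    (\<forall>A x. x \<in> hom C A (fst X) \<longrightarrow>
      (\<exists>B e y. so C e \<and> e \<in> hom C B A \<and> holds B f (x \<cdot> e) y \<and> holds B g y (x \<cdot> e))) \<and>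
    (\<forall>A y x y'. holds A g y x \<longrightarrow> holds A f x y' \<longrightarrow> le A Y y y')"

text \<open>The unit can be checked on pairs \<open>(x, x)\<close> because the right adjoint absorbs
  the congruence on its codomain; the conclusion of the counit is local, which frees it of
  covers.\<close>

lemma is_adj_iff:
  assumes f: "f \<in> hom \<Q> X Y" and g: "g \<in> hom \<Q> Y X"
  shows "is_adj X Y f g \<longleftrightarrow> ident \<Q> X \<sqsubseteq>\<^bsub>\<Q>\<^esub> g \<odot> f \<and> f \<odot> g \<sqsubseteq>\<^bsub>\<Q>\<^esub> ident \<Q> Y"
proof -
  note F = Qw_hom[OF f] and G = Qw_hom[OF g]
  note OX = Ob_Qw[OF F(1)] and OY = Ob_Qw[OF F(2)]
  have "(\<forall>A x. x \<in> hom C A (fst X) \<longrightarrow>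
      (\<exists>B e y. so C e \<and> e \<in> hom C B A \<and> holds B f (x \<cdot> e) y \<and> holds B g y (x \<cdot> e))) \<longleftrightarrow>
    (\<forall>A x y. le A X x y \<longrightarrow> holds A (g \<odot> f) x y)" (is "?l \<longleftrightarrow> ?r")
  proof
    assume l: ?l
    show ?r
    proof (intro allI impI)
      fix A x x' assume xx: "le A X x x'"
      then obtain B e y where e: "so C e" "e \<in> hom C B A" "holds B f (x \<cdot> e) y" "holds B g y (x \<cdot> e)"
        using l le_typed by blast
      have "holds B (g \<odot> f) (x \<cdot> e) (x' \<cdot> e)"
        using holds_compI[OF f g e(3) G(7)[OF e(4) le_restrict[OF xx e(2)]]] .
      then show "holds A (g \<odot> f) x x'"
        using holds_local[OF cmp_Qw_hom[OF f g] e(1,2)] le_typed[OF xx] by blast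
    qed
  next
    assume r: ?r
    show ?l
    proof (intro allI impI)
      fix A x assume "x \<in> hom C A (fst X)"
      then have "holds A (g \<odot> f) x x" using r OX(4) by blast
      then show "\<exists>B e y. so C e \<and> e \<in> hom C B A \<and> holds B f (x \<cdot> e) y \<and> holds B g y (x \<cdot> e)"
        using holds_compE[OF f g] by metis
    qed
  qed
  moreover have "(\<forall>A y x y'. holds A g y x \<longrightarrow> holds A f x y' \<longrightarrow> le A Y y y') \<longleftrightarrow>
    (\<forall>A y y'. holds A (f \<odot> g) y y' \<longrightarrow> le A Y y y')" (is "?l \<longleftrightarrow> ?r")
  proof
    assume l: ?l
    show ?r
    proof (intro allI impI)
      fix A y y' assume yy: "holds A (f \<odot> g) y y'"
      obtain B e x where e: "so C e" "e \<in> hom C B A" "holds B g (y \<cdot> e) x" "holds B f x (y' \<cdot> e)"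
        and ty: "y \<in> hom C A (fst Y)" "y' \<in> hom C A (fst Y)"
        using holds_compE[OF g f yy] .
      then have "le B Y (y \<cdot> e) (y' \<cdot> e)" using l by blast
      then show "le A Y y y'" using le_local[OF e(1,2) ty] by blast
    qed
  qed (use holds_compI[OF g f] in blast)
  ultimately show ?thesis
    unfolding is_adj_def leq_Qw_iff[OF ident_Qw_hom[OF F(1)] cmp_Qw_hom[OF f g]]
      leq_Qw_iff[OF cmp_Qw_hom[OF g f] ident_Qw_hom[OF F(2)]] holds_ident using f g by simp
qed

lemma hom_src_tgt: "f \<in> hom \<Q> X Y \<Longrightarrow> src \<Q> f = X \<and> tgt \<Q> f = Y"
  by (simp add: hom_def)

lemma hom_ex_reg_iff: "f \<in> hom \<X> X Y \<longleftrightarrow> (\<exists>g. is_adj X Y f g)"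
proof -
  have "f \<in> hom \<X> X Y \<longleftrightarrow> f \<in> hom \<Q> X Y \<and> (\<exists>g \<in> hom \<Q> Y X.
      ident \<Q> X \<sqsubseteq>\<^bsub>\<Q>\<^esub> g \<odot> f \<and> f \<odot> g \<sqsubseteq>\<^bsub>\<Q>\<^esub> ident \<Q> Y)"
    unfolding hom_ex_reg mem_Collect_eq has_right_adjoint_def by (rule conj_cong) (auto simp only: hom_src_tgt)
  also have "\<dots> \<longleftrightarrow> (\<exists>g. is_adj X Y f g)" using is_adj_iff is_adj_def by blast
  finally show ?thesis .
qed

text \<open>The choice does not affect truth values: by \<open>is_adj_ex_reg\<close> any right
  adjoint holds of the same pairs.\<close>

definition adj :: "('o, 'a) cong_arr \<Rightarrow> ('o, 'a) cong_arr" where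
  "adj f = (SOME g. is_adj (fst f) (fst (snd f)) f g)"

text \<open>\<open>val A f x y\<close> says that \<open>f\<close> maps the class of \<open>x\<close> to the class of \<open>y\<close>.\<close>

definition val :: "'o \<Rightarrow> ('o, 'a) cong_arr \<Rightarrow> 'a \<Rightarrow> 'a \<Rightarrow> bool" where
  "val A f x y \<longleftrightarrow> holds A f x y \<and> holds A (adj f) y x"

lemma ex_reg_hom:
  assumes "f \<in> hom \<X> X Y"
  shows "f \<in> hom \<Q> X Y" "adj f \<in> hom \<Q> Y X"
    and val_exists: "\<And>A x. x \<in> hom C A (fst X) \<Longrightarrow> \<exists>B e y. so C e \<and> e \<in> hom C B A \<and> val B f (x \<cdot> e) y"
    and counit: "\<And>A y x y'. \<lbrakk>holds A (adj f) y x; holds A f x y'\<rbrakk> \<Longrightarrow> le A Y y y'"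
    and "X \<in> Ob \<Q>" "Y \<in> Ob \<Q>"
proof -
  have f: "fst f = X" "fst (snd f) = Y" using assms Qw_hom(3,4) unfolding hom_ex_reg by blast+
  have adj: "is_adj X Y f (adj f)"
    using assms unfolding hom_ex_reg_iff adj_def f by (rule someI_ex)
  show "f \<in> hom \<Q> X Y" "adj f \<in> hom \<Q> Y X"
    "\<And>A x. x \<in> hom C A (fst X) \<Longrightarrow> \<exists>B e y. so C e \<and> e \<in> hom C B A \<and> val B f (x \<cdot> e) y"
    "\<And>A y x y'. \<lbrakk>holds A (adj f) y x; holds A f x y'\<rbrakk> \<Longrightarrow> le A Y y y'"
    using adj unfolding is_adj_def val_def by blast+
  then show "X \<in> Ob \<Q>" "Y \<in> Ob \<Q>" using Qw_hom by blast+
qed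

lemma val_typed:
  assumes "f \<in> hom \<X> X Y" "val A f x y"
  shows "x \<in> hom C A (fst X)" "y \<in> hom C A (fst Y)"
  using assms(2) Qw_hom(8,9)[OF ex_reg_hom(1)[OF assms(1)]] unfolding val_def by blast+

lemma val_restrict: "\<lbrakk>val A f x y; h \<in> hom C B A\<rbrakk> \<Longrightarrow> val B f (x \<cdot> h) (y \<cdot> h)"
  unfolding val_def using holds_restrict by blast

lemma val_holds:
  assumes f: "f \<in> hom \<X> X Y" and v: "val A f x y"
  shows "holds A f x y' \<longleftrightarrow> le A Y y y'"
  using v counit[OF f] holds_right[OF ex_reg_hom(1)[OF f]] unfolding val_def by blast

lemma val_adj:
  assumes f: "f \<in> hom \<X> X Y" and v: "val A f x y"
  shows "holds A (adj f) y' x \<longleftrightarrow> le A Y y' y"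
  using v counit[OF f] holds_left[OF ex_reg_hom(2)[OF f]] unfolding val_def by blast

text \<open>Uniqueness of right adjoints: the unit of one adjoint gives a local witness, and the
  counit of the other puts \<open>y\<close> below that witness.\<close>

lemma is_adj_ex_reg:
  assumes a: "is_adj X Y f g"
  shows "f \<in> hom \<X> X Y" "holds A (adj f) y x \<longleftrightarrow> holds A g y x"
proof -
  show f: "f \<in> hom \<X> X Y" using a hom_ex_reg_iff by blast
  have g: "g \<in> hom \<Q> Y X" using a by (simp add: is_adj_def)
  note af = ex_reg_hom(2)[OF f]
  have unit: "\<And>A x. x \<in> hom C A (fst X) \<Longrightarrow> \<exists>B e y. so C e \<and> e \<in> hom C B A \<and> holds B f (x \<cdot> e) y \<and> holds B g y (x \<cdot> e)"
    and co: "\<And>A y x y'. \<lbrakk>holds A g y x; holds A f x y'\<rbrakk> \<Longrightarrow> le A Y y y'"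
    using a unfolding is_adj_def by blast+
  show "holds A (adj f) y x \<longleftrightarrow> holds A g y x"
  proof
    assume h: "holds A (adj f) y x"
    note ty = holds_typed1[OF af h] holds_typed2[OF af h]
    obtain B e z where e: "so C e" "e \<in> hom C B A" "holds B f (x \<cdot> e) z" "holds B g z (x \<cdot> e)"
      using unit ty by blast
    have "le B Y (y \<cdot> e) z" using counit[OF f holds_restrict[OF h e(2)] e(3)] .
    then have "holds B g (y \<cdot> e) (x \<cdot> e)" using holds_left[OF g] e by blast
    then show "holds A g y x" using holds_local[OF g e(1,2)] ty by blast
  next
    assume h: "holds A g y x"
    note ty = holds_typed1[OF g h] holds_typed2[OF g h]
    obtain B e z where e: "so C e" "e \<in> hom C B A" "val B f (x \<cdot> e) z" using val_exists[OF f] ty by blast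
    have "le B Y (y \<cdot> e) z" using co[OF holds_restrict[OF h e(2)]] e(3) by (simp add: val_def)
    then have "holds B (adj f) (y \<cdot> e) (x \<cdot> e)" using val_adj[OF f e(3)] by blast
    then show "holds A (adj f) y x" using holds_local[OF af e(1,2)] ty by blast
  qed
qed

lemma ex_reg_homI:
  assumes "f \<in> hom \<Q> X Y" "g \<in> hom \<Q> Y X"
    "\<And>A x. x \<in> hom C A (fst X) \<Longrightarrow> \<exists>B e y. so C e \<and> e \<in> hom C B A \<and> holds B f (x \<cdot> e) y \<and> holds B g y (x \<cdot> e)"
    "\<And>A y x y'. \<lbrakk>holds A g y x; holds A f x y'\<rbrakk> \<Longrightarrow> le A Y y y'"
  shows "f \<in> hom \<X> X Y" "val A f x y \<longleftrightarrow> holds A f x y \<and> holds A g y x"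
    "holds A (adj f) y x \<longleftrightarrow> holds A g y x"
  using is_adj_ex_reg[of X Y f g] assms unfolding is_adj_def val_def by blast+

text \<open>An arrow of the completion is specified by two predicates, \<open>P\<close> for the
  relation and \<open>P'\<close> for its right adjoint. Besides representability there remain two
  absorption laws for each, a local value and the counit.\<close>

lemma arrow_ex_reg:
  assumes X: "X \<in> Ob \<Q>" and Y: "Y \<in> Ob \<Q>"
    and P: "repr (fst X) (fst Y) P" and P': "repr (fst Y) (fst X) P'"
    and "\<And>A x' x y. \<lbrakk>le A X x' x; y \<in> hom C A (fst Y); P A x y\<rbrakk> \<Longrightarrow> P A x' y"
    and "\<And>A x y y'. \<lbrakk>x \<in> hom C A (fst X); P A x y; le A Y y y'\<rbrakk> \<Longrightarrow> P A x y'"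
    and "\<And>A y' y x. \<lbrakk>le A Y y' y; x \<in> hom C A (fst X); P' A y x\<rbrakk> \<Longrightarrow> P' A y' x"
    and "\<And>A y x x'. \<lbrakk>y \<in> hom C A (fst Y); P' A y x; le A X x x'\<rbrakk> \<Longrightarrow> P' A y x'"
    and unit: "\<And>A x. x \<in> hom C A (fst X) \<Longrightarrow>
      \<exists>B e y. so C e \<and> e \<in> hom C B A \<and> (y \<in> hom C B (fst Y) \<and> P B (x \<cdot> e) y \<and> P' B y (x \<cdot> e))"
    and co: "\<And>A y x y'. \<lbrakk>x \<in> hom C A (fst X); y \<in> hom C A (fst Y); y' \<in> hom C A (fst Y); P' A y x; P A x y'\<rbrakk> \<Longrightarrow> le A Y y y'"
  shows "arrow X Y P \<in> hom \<X> X Y"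
    and "holds A (adj (arrow X Y P)) y x \<longleftrightarrow> x \<in> hom C A (fst X) \<and> y \<in> hom C A (fst Y) \<and> P' A y x"
    and "val A (arrow X Y P) x y \<longleftrightarrow> x \<in> hom C A (fst X) \<and> y \<in> hom C A (fst Y) \<and> P A x y \<and> P' A y x"
proof -
  have f: "arrow X Y P \<in> hom \<Q> X Y" by (rule arrow_hom[OF X Y P]) (fact assms)+
  have g: "arrow Y X P' \<in> hom \<Q> Y X" by (rule arrow_hom[OF Y X P']) (fact assms)+
  have 1: "\<exists>B e y. so C e \<and> e \<in> hom C B A \<and> holds B (arrow X Y P) (x \<cdot> e) y \<and> holds B (arrow Y X P') y (x \<cdot> e)"
    if "x \<in> hom C A (fst X)" for A x
    using unit[OF that] cmp_hom[OF _ that] unfolding holds_arrow[OF P] holds_arrow[OF P'] by blast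
  have 2: "le A Y y y'" if "holds A (arrow Y X P') y x" "holds A (arrow X Y P) x y'" for A y x y'
    using that co unfolding holds_arrow[OF P] holds_arrow[OF P'] by blast
  have h: "arrow X Y P \<in> hom \<X> X Y"
    "val A (arrow X Y P) x y \<longleftrightarrow> holds A (arrow X Y P) x y \<and> holds A (arrow Y X P') y x"
    "holds A (adj (arrow X Y P)) y x \<longleftrightarrow> holds A (arrow Y X P') y x" for A x y
    by (rule ex_reg_homI[OF f g]; fact 1 2)+
  show "arrow X Y P \<in> hom \<X> X Y" using h(1) by blast
  show "holds A (adj (arrow X Y P)) y x \<longleftrightarrow> x \<in> hom C A (fst X) \<and> y \<in> hom C A (fst Y) \<and> P' A y x"
    using h(3)[of A y x] unfolding holds_arrow[OF P'] by blast
  show "val A (arrow X Y P) x y \<longleftrightarrow> x \<in> hom C A (fst X) \<and> y \<in> hom C A (fst Y) \<and> P A x y \<and> P' A y x"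
    using h(2)[of A x y] unfolding holds_arrow[OF P] holds_arrow[OF P'] by blast
qed

text \<open>A value \<open>y\<close> of \<open>f\<close> at \<open>x\<close> is the least
  intermediate element, so it can stand for the quantified one, and no cover is left over.\<close>

lemma holds_comp_val:
  assumes f: "f \<in> hom \<X> X Y" and g: "g \<in> hom \<Q> Y Z" and v: "val A f x y"
  shows "holds A (g \<odot> f) x z \<longleftrightarrow> holds A g y z"
proof
  note fq = ex_reg_hom(1)[OF f]
  show "holds A (g \<odot> f) x z" if "holds A g y z"
    using holds_compI[OF fq g _ that] v by (simp add: val_def)
  assume h: "holds A (g \<odot> f) x z"
  obtain B e y' where e: "so C e" "e \<in> hom C B A" "holds B f (x \<cdot> e) y'" "holds B g y' (z \<cdot> e)"
    and z: "z \<in> hom C A (fst Z)"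
    using holds_compE[OF fq g h] .
  have "le B Y (y \<cdot> e) y'" using val_holds[OF f val_restrict[OF v e(2)]] e(3) by blast
  then have "holds B g (y \<cdot> e) (z \<cdot> e)" using holds_left[OF g _ e(4)] by blast
  then show "holds A g y z" using holds_local[OF g e(1,2) val_typed(2)[OF f v] z] by blast
qed

lemma val_exists_cmp:
  assumes f: "f \<in> hom \<X> X Y" and g: "g \<in> hom \<X> Y Z" and x: "x \<in> hom C A (fst X)"
  obtains B e y z where "so C e" "e \<in> hom C B A" "val B f (x \<cdot> e) y" "val B g y z"
proof -
  obtain B e y where e: "so C e" "e \<in> hom C B A" "val B f (x \<cdot> e) y" using val_exists[OF f x] by blast
  obtain D d z where d: "so C d" "d \<in> hom C D B" "val D g (y \<cdot> d) z"
    using val_exists[OF g val_typed(2)[OF f e(3)]] by blast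
  have "val D f (x \<cdot> (e \<cdot> d)) (y \<cdot> d)"
    using val_restrict[OF e(3) d(2)] cmp_assoc[OF d(2) e(2) x] by simp
  then show ?thesis using that[OF so_cmp[OF d(1) e(1) d(2) e(2)] cmp_hom[OF d(2) e(2)] _ d(3)] by blast
qed

section \<open>The completion as a category enriched in posets\<close>

lemma ident_ex_reg:
  assumes X: "X \<in> Ob \<Q>"
  shows "ident \<Q> X \<in> hom \<X> X X" "val A (ident \<Q> X) x y \<longleftrightarrow> le A X x y \<and> le A X y x"
proof -
  note i = ident_Qw_hom[OF X] and O = Ob_Qw[OF X]
  have 1: "\<exists>B e y. so C e \<and> e \<in> hom C B A \<and> holds B (ident \<Q> X) (x \<cdot> e) y \<and> holds B (ident \<Q> X) y (x \<cdot> e)"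
    if "x \<in> hom C A (fst X)" for A x
    unfolding holds_ident
    using so_ident[OF hom_Ob(1)[OF that]] ident_hom[OF hom_Ob(1)[OF that]] ident_right[OF that] O(4)[OF that] by metis
  have 2: "le A X x y" if "holds A (ident \<Q> X) x z" "holds A (ident \<Q> X) z y" for A x y z
    using that O(5) unfolding holds_ident by blast
  show "ident \<Q> X \<in> hom \<X> X X" using ex_reg_homI(1)[OF i i] 1 2 by blast
  show "val A (ident \<Q> X) x y \<longleftrightarrow> le A X x y \<and> le A X y x"
    using ex_reg_homI(2)[OF i i] 1 2 unfolding holds_ident by blast
qed

text \<open>The right adjoint of the composite is the composite of the adjoints in reverse order,
  and its unit is witnessed by a value of a value.\<close>

lemma cmp_ex_reg:
  assumes f: "f \<in> hom \<X> X Y" and g: "g \<in> hom \<X> Y Z"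
  shows "g \<odot> f \<in> hom \<X> X Z" and val_cmp: "\<lbrakk>val A f x y; val A g y z\<rbrakk> \<Longrightarrow> val A (g \<odot> f) x z"
proof -
  note F = ex_reg_hom[OF f] and G = ex_reg_hom[OF g]
  note gf = cmp_Qw_hom[OF F(1) G(1)] and a = cmp_Qw_hom[OF G(2) F(2)]
  let ?gf = "g \<odot> f" and ?a = "adj f \<odot> adj g"
  have v: "holds A ?gf x z \<and> holds A ?a z x" if "val A f x y" "val A g y z" for A x y z
    using that holds_compI[OF F(1) G(1)] holds_compI[OF G(2) F(2)] unfolding val_def by blast
  have 1: "\<exists>B e z. so C e \<and> e \<in> hom C B A \<and> holds B ?gf (x \<cdot> e) z \<and> holds B ?a z (x \<cdot> e)"
    if "x \<in> hom C A (fst X)" for A x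
    using val_exists_cmp[OF f g that] v by metis
  have 2: "le A Z z z'" if zx: "holds A ?a z x" and xz: "holds A ?gf x z'" for A z x z'
  proof -
    note ty = holds_typed1[OF a zx] holds_typed2[OF gf xz] holds_typed1[OF gf xz]
    \<comment> \<open>Values along the chain are fixed on a first cover, so that both memberships
      can be compared with the single element \<open>w\<close>; the inner cover \<open>d\<close>
      only resolves the composite of the adjoints.\<close>
    obtain B e y w where e: "so C e" "e \<in> hom C B A" "val B f (x \<cdot> e) y" "val B g y w"
      using val_exists_cmp[OF f g ty(3)] .
    have w: "le B Z w (z' \<cdot> e)"
      using holds_comp_val[OF f G(1) e(3)] val_holds[OF g e(4)] holds_restrict[OF xz e(2)] by blast
    obtain D d y' where d: "so C d" "d \<in> hom C D B" "holds D (adj g) ((z \<cdot> e) \<cdot> d) y'" "holds D (adj f) y' ((x \<cdot> e) \<cdot> d)"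
      using holds_compE[OF G(2) F(2) holds_restrict[OF zx e(2)]] .
    have "le D Y y' (y \<cdot> d)" using val_adj[OF f val_restrict[OF e(3) d(2)]] d(4) by blast
    then have "holds D (adj g) ((z \<cdot> e) \<cdot> d) (y \<cdot> d)" using holds_right[OF G(2) d(3)] by blast
    then have "le D Z ((z \<cdot> e) \<cdot> d) (w \<cdot> d)" using val_adj[OF g val_restrict[OF e(4) d(2)]] by blast
    then have "le B Z (z \<cdot> e) w"
      using le_local[OF d(1,2) cmp_hom[OF e(2) ty(1)] le_typed(1)[OF w]] by blast
    then have "le B Z (z \<cdot> e) (z' \<cdot> e)" using le_trans[OF G(6) _ w] by blast
    then show ?thesis using le_local[OF e(1,2) ty(1,2)] by blast
  qed
  show "?gf \<in> hom \<X> X Z" using ex_reg_homI(1)[OF gf a] 1 2 by blast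
  show "val A ?gf x z" if "val A f x y" "val A g y z"
    using ex_reg_homI(2)[OF gf a] 1 2 v[OF that] by blast
qed

text \<open>The elements related to \<open>x\<close> by \<open>f\<close> form the up-set of its
  value, which shrinks as the value grows; hence the reversal.\<close>

lemma leq_ex_reg_iff:
  assumes "f \<in> hom \<X> X Y" "g \<in> hom \<X> X Y"
  shows "f \<sqsubseteq>\<^bsub>\<X>\<^esub> g \<longleftrightarrow> (\<forall>A x y. holds A g x y \<longrightarrow> holds A f x y)"
  using leq_Qw_iff[OF ex_reg_hom(1)[OF assms(2)] ex_reg_hom(1)[OF assms(1)]] by (simp add: ex_reg_simps)

text \<open>A common value determines both relations at \<open>x\<close> on the cover, and locality
  carries the agreement down. Equations such as associativity are reduced to this form.\<close>

lemma ex_reg_eqI: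
  assumes f: "f \<in> hom \<X> X Y" and g: "g \<in> hom \<X> X Y"
    and ex: "\<And>A x. x \<in> hom C A (fst X) \<Longrightarrow>
      \<exists>B e y. so C e \<and> e \<in> hom C B A \<and> val B f (x \<cdot> e) y \<and> val B g (x \<cdot> e) y"
  shows "f = g"
proof (rule holds_eqI[OF ex_reg_hom(1)[OF f] ex_reg_hom(1)[OF g]])
  note F = ex_reg_hom(1)[OF f] and G = ex_reg_hom(1)[OF g]
  fix A x z
  have "holds A f x z \<longleftrightarrow> holds A g x z" if xz: "x \<in> hom C A (fst X)" "z \<in> hom C A (fst Y)"
  proof -
    obtain B e y where e: "so C e" "e \<in> hom C B A" "val B f (x \<cdot> e) y" "val B g (x \<cdot> e) y" using ex xz(1) by blast
    show ?thesis
      using holds_local[OF F e(1,2) xz] holds_local[OF G e(1,2) xz] holds_restrict[OF _ e(2)]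
        val_holds[OF f e(3)] val_holds[OF g e(4)] by blast
  qed
  then show "holds A f x z \<longleftrightarrow> holds A g x z" using Qw_hom(8,9)[OF F] Qw_hom(8,9)[OF G] by blast
qed

lemma cmp_assoc_ex_reg:
  assumes f: "f \<in> hom \<X> W X" and g: "g \<in> hom \<X> X Y" and h: "h \<in> hom \<X> Y Z"
  shows "(h \<odot> g) \<odot> f = h \<odot> (g \<odot> f)"
proof (rule ex_reg_eqI)
  note gf = cmp_ex_reg(1)[OF f g] and hg = cmp_ex_reg(1)[OF g h]
  show "(h \<odot> g) \<odot> f \<in> hom \<X> W Z" "h \<odot> (g \<odot> f) \<in> hom \<X> W Z"
    using cmp_ex_reg(1)[OF f hg] cmp_ex_reg(1)[OF gf h] .
  fix A w assume w: "w \<in> hom C A (fst W)"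
  obtain B e x y where e: "so C e" "e \<in> hom C B A" "val B f (w \<cdot> e) x" "val B g x y"
    using val_exists_cmp[OF f g w] .
  obtain D d z where d: "so C d" "d \<in> hom C D B" "val D h (y \<cdot> d) z"
    using val_exists[OF h val_typed(2)[OF g e(4)]] by blast
  note r = val_restrict[OF e(3) d(2)] val_restrict[OF e(4) d(2)]
  have "val D ((h \<odot> g) \<odot> f) (w \<cdot> (e \<cdot> d)) z" "val D (h \<odot> (g \<odot> f)) (w \<cdot> (e \<cdot> d)) z"
    using val_cmp[OF f hg r(1) val_cmp[OF g h r(2) d(3)]] val_cmp[OF gf h val_cmp[OF f g r] d(3)]
      cmp_assoc[OF d(2) e(2) w] by simp_all
  then show "\<exists>B e z. so C e \<and> e \<in> hom C B A \<and> val B ((h \<odot> g) \<odot> f) (w \<cdot> e) z \<and>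
      val B (h \<odot> (g \<odot> f)) (w \<cdot> e) z"
    using so_cmp[OF d(1) e(1) d(2) e(2)] cmp_hom[OF d(2) e(2)] by blast
qed

lemma ident_cmp_ex_reg:
  assumes f: "f \<in> hom \<X> X Y"
  shows "f \<odot> ident \<Q> X = f" "ident \<Q> Y \<odot> f = f"
proof -
  note F = ex_reg_hom[OF f]
  note iX = ident_ex_reg[OF F(5)] and iY = ident_ex_reg[OF F(6)]
  have v: "val A (ident \<Q> X) x x" "val A (ident \<Q> Y) y y" if "val A f x y" for A x y
    using iX(2) iY(2) le_refl[OF F(5)] le_refl[OF F(6)] val_typed[OF f that] by blast+
  show "f \<odot> ident \<Q> X = f"
    by (rule ex_reg_eqI[OF cmp_ex_reg(1)[OF iX(1) f] f]) (meson val_exists[OF f] v val_cmp[OF iX(1) f])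
  show "ident \<Q> Y \<odot> f = f"
    by (rule ex_reg_eqI[OF cmp_ex_reg(1)[OF f iY(1)] f]) (meson val_exists[OF f] v val_cmp[OF f iY(1)])
qed

lemma pos_category_ex_reg: "pos_category \<X>"
proof (unfold_locales, goal_cases)
  case (1 f) then show ?case using ex_reg_hom(5)[OF homI[OF 1]] by (simp add: ex_reg_simps)
next
  case (2 f) then show ?case using ex_reg_hom(6)[OF homI[OF 2]] by (simp add: ex_reg_simps)
next
  case (3 X) then show ?case using ident_ex_reg(1) by (simp add: ex_reg_simps)
next
  case (4 f X Y g Z) then show ?case using cmp_ex_reg(1) by (simp add: ex_reg_simps)
next
  case (5 f X Y) then show ?case using ident_cmp_ex_reg(1)[OF 5] by (simp add: ex_reg_simps)
next
  case (6 f X Y) then show ?case using ident_cmp_ex_reg(2)[OF 6] by (simp add: ex_reg_simps)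
next
  case (7 f W X g Y h Z)
  then show ?case using cmp_assoc_ex_reg by (simp add: ex_reg_simps)
next
  case (8 f X Y) then show ?case using leq_ex_reg_iff by blast
next
  case (9 f X Y g) then show ?case using leq_ex_reg_iff[OF 9(1,2)] leq_ex_reg_iff[OF 9(2,1)] holds_eqI ex_reg_hom(1) by metis
next
  case (10 f X Y g h)
  then show ?case using leq_ex_reg_iff[OF 10(1,2)] leq_ex_reg_iff[OF 10(2,3)] leq_ex_reg_iff[OF 10(1,3)] by blast
next
  case (11 f X Y f' g Z g')
  note q = 11(1-4)[THEN ex_reg_hom(1)]
  note gf = cmp_ex_reg(1)[OF 11(1,3)] and gf' = cmp_ex_reg(1)[OF 11(2,4)]
  show ?case unfolding ex_reg_simps(5) leq_ex_reg_iff[OF gf gf']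
  proof (intro allI impI)
    fix A x z assume xz: "holds A (g' \<odot> f') x z"
    obtain B e y where e: "so C e" "e \<in> hom C B A" "holds B f' (x \<cdot> e) y" "holds B g' y (z \<cdot> e)"
      and ty: "x \<in> hom C A (fst X)" "z \<in> hom C A (fst Z)"
      using holds_compE[OF q(2,4) xz] .
    have "holds B f (x \<cdot> e) y" "holds B g y (z \<cdot> e)"
      using e 11(5,6) leq_ex_reg_iff[OF 11(1,2)] leq_ex_reg_iff[OF 11(3,4)] by blast+
    then have "holds B (g \<odot> f) (x \<cdot> e) (z \<cdot> e)" using holds_compI[OF q(1,3)] by blast
    then show "holds A (g \<odot> f) x z" using holds_local[OF ex_reg_hom(1)[OF gf] e(1,2) ty] by blast
  qed
qed

end

sublocale regular_poset_category \<subseteq> ex_reg: poset_category "ex_reg C"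
  by (rule poset_category.intro[OF pos_category_ex_reg])

context regular_poset_category
begin

text \<open>When a witness exists without restriction, the identity serves as cover.\<close>

lemma trivial_cover:
  assumes "x \<in> hom C A Z" "P A x y"
  shows "\<exists>B e y. so C e \<and> e \<in> hom C B A \<and> P B (x \<cdot> e) y"
  using so_ident[OF hom_Ob(1)[OF assms(1)]] ident_hom[OF hom_Ob(1)[OF assms(1)]] ident_right[OF assms(1)] assms(2)
  by metis

lemma val_cong:
  assumes "f \<in> hom \<X> X Y" "val A f x y" "le A Y y y'" "le A Y y' y"
  shows "val A f x y'"
  using assms holds_right[OF ex_reg_hom(1)[OF assms(1)]] holds_left[OF ex_reg_hom(2)[OF assms(1)]]
  unfolding val_def by blast

section \<open>Arrows induced by arrows of the base category\<close>

text \<open>The bimodule represented by \<open>p\<close>, its companion in categorical terms. The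
  right adjoint is obtained by exchanging the two sides of the inequality.\<close>

definition lift :: "('o, 'a) cong \<Rightarrow> ('o, 'a) cong \<Rightarrow> 'a \<Rightarrow> ('o, 'a) cong_arr" where
  "lift Z X p = arrow Z X (\<lambda>A u x. le A X (p \<cdot> u) x)"

text \<open>Values exist globally here: \<open>p\<close> applied to \<open>u\<close> is one, so the
  cover in the unit is the identity.\<close>

lemma lift:
  assumes Z: "Z \<in> Ob \<Q>" and X: "X \<in> Ob \<Q>" and p: "p \<in> hom C (fst Z) (fst X)"
    and mono: "\<And>A u v. le A Z u v \<Longrightarrow> le A X (p \<cdot> u) (p \<cdot> v)"
  shows lift_hom: "lift Z X p \<in> hom \<X> Z X"
    and holds_lift: "holds A (lift Z X p) u x \<longleftrightarrow> u \<in> hom C A (fst Z) \<and> le A X (p \<cdot> u) x"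
    and val_lift: "u \<in> hom C A (fst Z) \<Longrightarrow> val A (lift Z X p) u (p \<cdot> u)"
proof -
  note OX = Ob_Qw[OF X] and OZ = Ob_Qw[OF Z]
  let ?P = "\<lambda>A u x. le A X (p \<cdot> u) x" and ?P' = "\<lambda>A x u. le A X x (p \<cdot> u)"
  have r: "repr (fst Z) (fst X) ?P" "repr (fst X) (fst Z) ?P'"
    using repr_subst_left[OF repr_le[OF X] p OX(1)] repr_subst_right[OF repr_le[OF X] p OX(1)] .
  have pu: "le A X (p \<cdot> u) (p \<cdot> u)" if "u \<in> hom C A (fst Z)" for A u
    using OX(4)[OF cmp_hom[OF that p]] .
  have unit: "\<exists>B e y. so C e \<and> e \<in> hom C B A \<and> (y \<in> hom C B (fst X) \<and> le B X (p \<cdot> (u \<cdot> e)) y \<and> le B X y (p \<cdot> (u \<cdot> e)))"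
    if u: "u \<in> hom C A (fst Z)" for A u
    by (rule trivial_cover[OF u, of "\<lambda>B u y. y \<in> hom C B (fst X) \<and> le B X (p \<cdot> u) y \<and> le B X y (p \<cdot> u)"])
      (use pu[OF u] cmp_hom[OF u p] in blast)
  have l: "lift Z X p \<in> hom \<X> Z X"
    "val A (lift Z X p) u x \<longleftrightarrow> u \<in> hom C A (fst Z) \<and> x \<in> hom C A (fst X) \<and> le A X (p \<cdot> u) x \<and> le A X x (p \<cdot> u)"
    for A u x
    unfolding lift_def by (rule arrow_ex_reg[OF Z X r]; (rule unit)?; use mono OX(5) in blast)+
  show "lift Z X p \<in> hom \<X> Z X" by (rule l(1))
  show "holds A (lift Z X p) u x \<longleftrightarrow> u \<in> hom C A (fst Z) \<and> le A X (p \<cdot> u) x"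
    unfolding lift_def holds_arrow[OF r(1)] using le_typed(2) by blast
  show "val A (lift Z X p) u (p \<cdot> u)" if "u \<in> hom C A (fst Z)"
    unfolding l(2) using pu[OF that] cmp_hom[OF that p] that by blast
qed

abbreviation \<Gamma>ob :: "'o \<Rightarrow> ('o, 'a) cong" where "\<Gamma>ob A \<equiv> (A, id_rel C A)"

lemma Gamma_ob:
  assumes "A \<in> Ob C"
  shows "\<Gamma>ob A \<in> Ob \<Q>" "le B (\<Gamma>ob A) a b \<longleftrightarrow> a \<in> hom C B A \<and> b \<in> hom C B A \<and> a \<sqsubseteq> b"
proof -
  show le: "le B (\<Gamma>ob A) a b \<longleftrightarrow> a \<in> hom C B A \<and> b \<in> hom C B A \<and> a \<sqsubseteq> b" for B a b
    by (simp add: le_def el_id_rel[OF assms])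
  show "\<Gamma>ob A \<in> Ob \<Q>"
  proof (rule Ob_QwI)
    show "le B (\<Gamma>ob A) x z" if "le B (\<Gamma>ob A) x y" "le B (\<Gamma>ob A) y z" for B x y z
      using that leq_trans unfolding le by blast
  qed (use assms id_rel_Rel le in simp_all)
qed

text \<open>A generalized element \<open>x : A \<rightarrow> X\<close> of the carrier of \<open>X\<close> as an arrow from \<open>\<Gamma> A\<close>.\<close>

abbreviation point :: "'o \<Rightarrow> ('o, 'a) cong \<Rightarrow> 'a \<Rightarrow> ('o, 'a) cong_arr" where
  "point A X x \<equiv> lift (\<Gamma>ob A) X x"

text \<open>Every arrow into the carrier is admissible since the congruence of
  \<open>\<Gamma>ob A\<close> is only the order of elements, which composition preserves.\<close>

lemma point:
  assumes X: "X \<in> Ob \<Q>" and x: "x \<in> hom C A (fst X)"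
  shows point_hom: "point A X x \<in> hom \<X> (\<Gamma>ob A) X"
    and holds_point: "holds B (point A X x) a y \<longleftrightarrow> a \<in> hom C B A \<and> le B X (x \<cdot> a) y"
    and val_point: "a \<in> hom C B A \<Longrightarrow> val B (point A X x) a (x \<cdot> a)"
proof -
  have A: "A \<in> Ob C" using hom_Ob x by blast
  have m: "le B X (x \<cdot> u) (x \<cdot> v)" if "le B (\<Gamma>ob A) u v" for B u v
  proof -
    have uv: "u \<in> hom C B A" "v \<in> hom C B A" "u \<sqsubseteq> v" using that unfolding Gamma_ob(2)[OF A] by blast+
    show ?thesis using Ob_Qw(3)[OF X cmp_hom[OF uv(1) x] cmp_hom[OF uv(2) x]] cmp_mono_right[OF uv(1,2) x uv(3)] .
  qed
  have xh: "x \<in> hom C (fst (\<Gamma>ob A)) (fst X)" using x by simp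
  note l = lift[OF Gamma_ob(1)[OF A] X xh m]
  show "point A X x \<in> hom \<X> (\<Gamma>ob A) X" using l(1) by blast
  show "holds B (point A X x) a y \<longleftrightarrow> a \<in> hom C B A \<and> le B X (x \<cdot> a) y" using l(2) by simp
  show "a \<in> hom C B A \<Longrightarrow> val B (point A X x) a (x \<cdot> a)" using l(3)[of a B] by simp
qed

lemma holds_cmp_point:
  assumes f: "f \<in> hom \<X> X Y" and x: "x \<in> hom C A (fst X)" and a: "a \<in> hom C B A"
  shows "holds B (f \<odot> point A X x) a y \<longleftrightarrow> holds B f (x \<cdot> a) y"
proof -
  note F = ex_reg_hom[OF f]
  show ?thesis using holds_comp_val[OF point_hom[OF F(5) x] F(1) val_point[OF F(5) x a]] .
qed

section \<open>Characterization of ff- and so-morphisms\<close>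

text \<open>The condition is the inclusion of the kernel of \<open>m\<close> in the congruence, the
  reverse inclusion being the unit. Elements are compared through the points they define, so an
  \<open>ff\<close>-morphism is tested against points.\<close>

lemma ff_ex_reg_iff:
  assumes m: "m \<in> hom \<X> X Y"
  shows "ff \<X> m \<longleftrightarrow> (\<forall>A x w x'. holds A m x w \<longrightarrow> holds A (adj m) w x' \<longrightarrow> le A X x x')" (is "_ \<longleftrightarrow> ?r")
proof
  note M = ex_reg_hom[OF m]
  show "ff \<X> m" if r: ?r
  proof (rule ex_reg.ffI[OF m])
    fix Z f g assume f: "f \<in> hom \<X> Z X" and g: "g \<in> hom \<X> Z X" and mfg: "m \<cdot>\<^bsub>\<X>\<^esub> f \<sqsubseteq>\<^bsub>\<X>\<^esub> m \<cdot>\<^bsub>\<X>\<^esub> g"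
    note F = ex_reg_hom[OF f] and G = ex_reg_hom[OF g]
    show "f \<sqsubseteq>\<^bsub>\<X>\<^esub> g" unfolding leq_ex_reg_iff[OF f g]
    proof (intro allI impI)
      fix A z x assume zx: "holds A g z x"
      note ty = holds_typed1[OF G(1) zx] holds_typed2[OF G(1) zx]
      obtain B e x1 where e: "so C e" "e \<in> hom C B A" "val B f (z \<cdot> e) x1" using val_exists[OF f ty(1)] by blast
      note xe = cmp_hom[OF e(2) ty(2)]
      obtain D d w where d: "so C d" "d \<in> hom C D B" "val D m ((x \<cdot> e) \<cdot> d) w" using val_exists[OF m xe] by blast
      have "holds D (m \<odot> g) ((z \<cdot> e) \<cdot> d) w"
        using holds_compI[OF G(1) M(1) holds_restrict[OF holds_restrict[OF zx e(2)] d(2)]] d(3) by (simp add: val_def)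
      then have "holds D (m \<odot> f) ((z \<cdot> e) \<cdot> d) w"
        using mfg leq_ex_reg_iff[OF cmp_ex_reg(1)[OF f m] cmp_ex_reg(1)[OF g m]] by (simp add: ex_reg_simps(5))
      then have "holds D m (x1 \<cdot> d) w" using holds_comp_val[OF f M(1) val_restrict[OF e(3) d(2)]] by blast
      then have "le D X (x1 \<cdot> d) ((x \<cdot> e) \<cdot> d)" using r d(3) unfolding val_def by blast
      then have "le B X x1 (x \<cdot> e)" using le_local[OF d(1,2) val_typed(2)[OF f e(3)] xe] by blast
      then have "holds B f (z \<cdot> e) (x \<cdot> e)" using val_holds[OF f e(3)] by blast
      then show "holds A f z x" using holds_local[OF F(1) e(1,2) ty] by blast
    qed
  qed
  show ?r if ff: "ff \<X> m"
  proof (intro allI impI)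
    fix A x w x' assume xw: "holds A m x w" and wx: "holds A (adj m) w x'"
    have x: "x \<in> hom C A (fst X)" and x': "x' \<in> hom C A (fst X)"
      using holds_typed1[OF M(1) xw] holds_typed2[OF M(2) wx] .
    note p = point[OF M(5) x] and p' = point[OF M(5) x']
    \<comment> \<open>The element \<open>w\<close> mediates: the counit puts it below every element
      that \<open>m\<close> relates to \<open>x'\<close>, so composing \<open>m\<close> with the two
      points gives comparable arrows.\<close>
    have "holds B (m \<odot> point A X x) a v" if h: "holds B (m \<odot> point A X x') a v" for B a v
    proof -
      have a: "a \<in> hom C B A" using holds_typed1[OF ex_reg_hom(1)[OF cmp_ex_reg(1)[OF p'(1) m]] h] by simp
      have "holds B m (x' \<cdot> a) v" using h holds_cmp_point[OF m x' a] by blast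
      then have "le B Y (w \<cdot> a) v" using counit[OF m holds_restrict[OF wx a]] by blast
      then have "holds B m (x \<cdot> a) v" using holds_right[OF M(1) holds_restrict[OF xw a]] by blast
      then show ?thesis using holds_cmp_point[OF m x a] by blast
    qed
    then have "m \<cdot>\<^bsub>\<X>\<^esub> point A X x \<sqsubseteq>\<^bsub>\<X>\<^esub> m \<cdot>\<^bsub>\<X>\<^esub> point A X x'"
      using leq_ex_reg_iff[OF cmp_ex_reg(1)[OF p(1) m] cmp_ex_reg(1)[OF p'(1) m]] by (simp add: ex_reg_simps(5))
    then have "point A X x \<sqsubseteq>\<^bsub>\<X>\<^esub> point A X x'" using ex_reg.ffD[OF ff m p(1) p'(1)] by blast
    moreover have id: "ident C A \<in> hom C A A" using ident_hom hom_Ob(1)[OF x] by blast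
    \<comment> \<open>Evaluation at the generic element of the stage turns the inequality of points
      into one of elements.\<close>
    moreover have "holds A (point A X x') (ident C A) x'"
      using p'(2) id le_refl[OF M(5) x'] ident_right[OF x'] by simp
    ultimately have "holds A (point A X x) (ident C A) x'" using leq_ex_reg_iff[OF p(1) p'(1)] by blast
    then show "le A X x x'" using p(2) ident_right[OF x] by simp
  qed
qed

definition locally_surj :: "('o, 'a) cong_arr \<Rightarrow> bool" where
  "locally_surj f \<longleftrightarrow> (\<forall>A y. y \<in> hom C A (fst (fst (snd f))) \<longrightarrow>
    (\<exists>B e x. so C e \<and> e \<in> hom C B A \<and> val B f x (y \<cdot> e)))"

lemma locally_surj_iff:
  assumes "f \<in> hom \<X> X Y"
  shows "locally_surj f \<longleftrightarrow> (\<forall>A y. y \<in> hom C A (fst Y) \<longrightarrow>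
    (\<exists>B e x. so C e \<and> e \<in> hom C B A \<and> val B f x (y \<cdot> e)))"
  using Qw_hom(4)[OF ex_reg_hom(1)[OF assms]] by (simp add: locally_surj_def)

text \<open>At a local value of \<open>e\<close>, precomposition with \<open>e\<close> is
  evaluation, so equal composites agree on a cover.\<close>

lemma locally_surj_epi:
  assumes e: "e \<in> hom \<X> X Y" "locally_surj e" and f: "f \<in> hom \<Q> Y Z" and g: "g \<in> hom \<Q> Y Z"
    and eq: "f \<odot> e = g \<odot> e"
  shows "f = g"
proof (rule holds_eqI[OF f g])
  fix A y z
  have "holds A g y z" if h: "holds A f y z" and f: "f \<in> hom \<Q> Y Z" and g: "g \<in> hom \<Q> Y Z"
    and eq: "f \<odot> e = g \<odot> e" for f g
  proof -
    note ty = holds_typed1[OF f h] holds_typed2[OF f h]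
    obtain B d x where d: "so C d" "d \<in> hom C B A" "val B e x (y \<cdot> d)"
      using e(2) ty(1) unfolding locally_surj_iff[OF e(1)] by blast
    have "holds B g (y \<cdot> d) (z \<cdot> d)"
      using holds_comp_val[OF e(1) f d(3)] holds_comp_val[OF e(1) g d(3)] holds_restrict[OF h d(2)] eq by simp
    then show ?thesis using holds_local[OF g d(1,2) ty] by blast
  qed
  then show "holds A f y z \<longleftrightarrow> holds A g y z" using f g eq by metis
qed

text \<open>The image of \<open>f : X \<rightarrow> Y\<close> is the carrier of \<open>X\<close> with the congruence \<open>f\<^sup>* f\<^sub>*\<close>.\<close>

lemma ex_reg_image:
  assumes f: "f \<in> hom \<X> X Y"
  obtains Z e m where "e \<in> hom \<X> X Z" "m \<in> hom \<X> Z Y" "m \<odot> e = f" "ff \<X> m" "locally_surj e"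
    "\<And>A x y. val A m x y \<longleftrightarrow> val A f x y"
proof -
  note F = ex_reg_hom[OF f]
  note OX = Ob_Qw[OF F(5)]
  let ?K = "adj f \<odot> f" and ?Z = "(fst X, snd (snd (adj f \<odot> f)))"
  note K = cmp_Qw_hom[OF F(1,2)]
  note KQ = Qw_hom[OF K]
  have leZ: "le A ?Z x x' \<longleftrightarrow> holds A ?K x x'" for A x x'
    by (simp add: le_def holds_def KQ(3,4))
  have val_K: "holds A ?K x x' \<longleftrightarrow> holds A (adj f) y x'" if "val A f x y" for A x y x'
    using holds_comp_val[OF f F(2) that] .
  have K_le: "holds A ?K x x'" if "le A X x x'" for A x x'
  proof -
    note ty = le_typed[OF that]
    obtain B e y where e: "so C e" "e \<in> hom C B A" "val B f (x \<cdot> e) y" using val_exists[OF f ty(1)] by blast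
    have "holds B ?K (x \<cdot> e) (x' \<cdot> e)"
      using val_K[OF e(3)] holds_right[OF F(2) _ le_restrict[OF that e(2)]] e(3) by (auto simp: val_def)
    then show ?thesis using holds_local[OF K e(1,2) ty] by blast
  qed
  \<comment> \<open>Both \<open>f\<close> and its adjoint absorb even the larger congruence of the
    image, which lets the same relations be read as arrows out of and into
    \<open>?Z\<close>.\<close>
  have f_left: "holds A f x' y" if "holds A ?K x' x" "holds A f x y" for A x' x y
  proof -
    note ty = holds_typed1[OF K that(1)] holds_typed2[OF F(1) that(2)]
    obtain B e y' where e: "so C e" "e \<in> hom C B A" "val B f (x' \<cdot> e) y'" using val_exists[OF f ty(1)] by blast
    have "holds B (adj f) y' (x \<cdot> e)" using val_K[OF e(3)] holds_restrict[OF that(1) e(2)] by blast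
    then have "le B Y y' (y \<cdot> e)" using counit[OF f _ holds_restrict[OF that(2) e(2)]] by blast
    then have "holds B f (x' \<cdot> e) (y \<cdot> e)" using val_holds[OF f e(3)] by blast
    then show ?thesis using holds_local[OF F(1) e(1,2) ty] by blast
  qed
  have adj_right: "holds A (adj f) y x'" if "holds A (adj f) y x" "holds A ?K x x'" for A y x x'
  proof -
    note ty = holds_typed1[OF F(2) that(1)] holds_typed2[OF K that(2)] holds_typed1[OF K that(2)]
    obtain B e y' where e: "so C e" "e \<in> hom C B A" "val B f (x \<cdot> e) y'" using val_exists[OF f ty(3)] by blast
    have "le B Y (y \<cdot> e) y'" using val_adj[OF f e(3)] holds_restrict[OF that(1) e(2)] by blast
    moreover have "holds B (adj f) y' (x' \<cdot> e)" using val_K[OF e(3)] holds_restrict[OF that(2) e(2)] by blast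
    ultimately have "holds B (adj f) (y \<cdot> e) (x' \<cdot> e)" using holds_left[OF F(2)] by blast
    then show ?thesis using holds_local[OF F(2) e(1,2) ty(1,2)] by blast
  qed
  have K_trans: "holds A ?K x x''" if "holds A ?K x x'" "holds A ?K x' x''" for A x x' x''
  proof -
    note ty = holds_typed1[OF K that(1)] holds_typed2[OF K that(2)]
    obtain B e y where e: "so C e" "e \<in> hom C B A" "val B f (x \<cdot> e) y" using val_exists[OF f ty(1)] by blast
    have "holds B (adj f) y (x' \<cdot> e)" using val_K[OF e(3)] holds_restrict[OF that(1) e(2)] by blast
    then have "holds B (adj f) y (x'' \<cdot> e)" using adj_right holds_restrict[OF that(2) e(2)] by blast
    then have "holds B ?K (x \<cdot> e) (x'' \<cdot> e)" using val_K[OF e(3)] by blast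
    then show ?thesis using holds_local[OF K e(1,2) ty] by blast
  qed
  have Z: "?Z \<in> Ob \<Q>"
  proof (rule Ob_QwI)
    show "le A ?Z x y" if "x \<in> hom C A (fst ?Z)" "y \<in> hom C A (fst ?Z)" "x \<sqsubseteq> y" for A x y
      using K_le OX(3) that unfolding leZ by simp
    show "le A ?Z x z" if "le A ?Z x y" "le A ?Z y z" for A x y z using that K_trans unfolding leZ by blast
  qed (use OX(1) KQ(5) in simp_all)
  have m_mono: "le A ?Z (ident C (fst X) \<cdot> u) (ident C (fst X) \<cdot> v)" if "le A X u v" for A u v
    using K_le[OF that] le_typed[OF that] ident_left unfolding leZ by simp
  have idh: "ident C (fst X) \<in> hom C (fst X) (fst ?Z)" using ident_hom[OF OX(1)] by simp
  \<comment> \<open>The \<open>so\<close>-part is carried by the identity and merely enlarges the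
    congruence.\<close>
  note e = lift[OF F(5) Z idh m_mono]
  let ?e = "lift X ?Z (ident C (fst X))"
  have e_val: "val A ?e x x" if "x \<in> hom C A (fst X)" for A x
    using e(3)[OF _ that] ident_left[OF that] by simp
  have rm: "repr (fst ?Z) (fst Y) (\<lambda>A. holds A f)" and ra: "repr (fst Y) (fst ?Z) (\<lambda>A. holds A (adj f))"
    using repr_holds[OF F(1)] repr_holds[OF F(2)] by simp_all
  let ?m = "arrow ?Z Y (\<lambda>A. holds A f)"
  have unit: "\<exists>B e y. so C e \<and> e \<in> hom C B A \<and> (y \<in> hom C B (fst Y) \<and> holds B f (x \<cdot> e) y \<and> holds B (adj f) y (x \<cdot> e))"
    if "x \<in> hom C A (fst ?Z)" for A x
    using val_exists[OF f] val_typed(2)[OF f] that unfolding val_def by simp blast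
  have mX: "?m \<in> hom \<X> ?Z Y" and
    a: "holds A (adj ?m) y x \<longleftrightarrow> x \<in> hom C A (fst ?Z) \<and> y \<in> hom C A (fst Y) \<and> holds A (adj f) y x" for A x y
    by (rule arrow_ex_reg[OF Z F(6) rm ra];
      (unfold leZ)?; ((rule unit; assumption) | erule f_left holds_right[OF F(1)] holds_left[OF F(2)] adj_right counit[OF f]; assumption))+
  have hm: "holds A ?m x y \<longleftrightarrow> holds A f x y" for A x y
    unfolding holds_arrow[OF rm] using Qw_hom(8,9)[OF F(1)] by auto
  have m_adj: "holds A (adj ?m) y x \<longleftrightarrow> holds A (adj f) y x" for A x y
    using a Qw_hom(8,9)[OF F(2)] by auto
  have m_val: "val A ?m x y \<longleftrightarrow> val A f x y" for A x y unfolding val_def hm m_adj ..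
  have eX: "?e \<in> hom \<X> X ?Z" using e(1) .
  have "?m \<odot> ?e = f"
  proof (rule ex_reg_eqI[OF cmp_ex_reg(1)[OF eX mX] f])
    fix A x assume "x \<in> hom C A (fst X)"
    then obtain B d y where d: "so C d" "d \<in> hom C B A" "val B f (x \<cdot> d) y" using val_exists[OF f] by blast
    have "val B (?m \<odot> ?e) (x \<cdot> d) y"
      using val_cmp[OF eX mX e_val[OF val_typed(1)[OF f d(3)]]] m_val d(3) by blast
    then show "\<exists>B e y. so C e \<and> e \<in> hom C B A \<and> val B (?m \<odot> ?e) (x \<cdot> e) y \<and> val B f (x \<cdot> e) y"
      using d by blast
  qed
  moreover have "ff \<X> ?m"
    unfolding ff_ex_reg_iff[OF mX] hm m_adj leZ using holds_compI[OF F(1,2)] by blast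
  moreover have "locally_surj ?e"
    unfolding locally_surj_iff[OF eX]
  proof (intro allI impI)
    fix A y assume y: "y \<in> hom C A (fst ?Z)"
    have "val A ?e y y" using e_val y by simp
    then show "\<exists>B d x. so C d \<and> d \<in> hom C B A \<and> val B ?e x (y \<cdot> d)"
      using trivial_cover[OF y, of "\<lambda>B y x. val B ?e x y"] by blast
  qed
  ultimately show ?thesis using that[OF eX mX] m_val by blast
qed

text \<open>The diagonal is \<open>f\<close> after the right adjoint of \<open>e\<close>, with
  \<open>e\<close> after the right adjoint of \<open>f\<close> as its own adjoint. Its counit
  requires that elements ordered by \<open>e\<close> are ordered by \<open>f\<close>; this is where
  the \<open>ff\<close>-morphism enters, since \<open>m\<close> after \<open>f\<close> factors
  through \<open>e\<close>.\<close>

lemma locally_surj_fill: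
  assumes e: "e \<in> hom \<X> X Y" "locally_surj e" and m: "ff \<X> m" "m \<in> hom \<X> V W"
    and f: "f \<in> hom \<X> X V" and g: "g \<in> hom \<X> Y W" and eq: "m \<odot> f = g \<odot> e"
  shows "\<exists>h \<in> hom \<X> Y V. h \<odot> e = f \<and> m \<odot> h = g"
proof -
  note E = ex_reg_hom[OF e(1)] and M = ex_reg_hom[OF m(2)] and F = ex_reg_hom[OF f] and G = ex_reg_hom[OF g]
  let ?h = "f \<odot> adj e" and ?a = "e \<odot> adj f"
  note h = cmp_Qw_hom[OF E(2) F(1)] and a = cmp_Qw_hom[OF F(2) E(1)]
  note mf = cmp_Qw_hom[OF F(1) M(1)] and ge = cmp_Qw_hom[OF E(1) G(1)]
  \<comment> \<open>The kernel of \<open>e\<close> is transported along \<open>g\<close> to an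
    inequality after \<open>m\<close>, and \<open>m\<close> reflects it. Values of \<open>f\<close>
    and \<open>m\<close> are assumed here and removed in \<open>claim\<close> by passing to
    covers.\<close>
  have step: "holds A f x z'" if xy: "holds A e x y" "holds A (adj e) y x'"
    and v: "val A f x z" "val A f x' z'" "val A m z' w" for A x y x' z z' w
  proof -
    have "holds A (m \<odot> f) x' w" using holds_comp_val[OF f M(1) v(2)] v(3) by (simp add: val_def)
    then have xw': "holds A (g \<odot> e) x' w" by (simp add: eq)
    obtain B d y' where d: "so C d" "d \<in> hom C B A" "holds B e (x' \<cdot> d) y'" "holds B g y' (w \<cdot> d)"
      using holds_compE[OF E(1) G(1) xw'] .
    have "le B Y (y \<cdot> d) y'" using counit[OF e(1) holds_restrict[OF xy(2) d(2)] d(3)] .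
    then have "holds B e (x \<cdot> d) y'" using holds_right[OF E(1) holds_restrict[OF xy(1) d(2)]] by blast
    then have "holds B (g \<odot> e) (x \<cdot> d) (w \<cdot> d)" using holds_compI[OF E(1) G(1)] d(4) by blast
    then have "holds A (m \<odot> f) x w"
      using holds_local[OF ge d(1,2) holds_typed1[OF E(1) xy(1)] holds_typed2[OF ge xw']] eq by simp
    then have "holds A m z w" using holds_comp_val[OF f M(1) v(1)] by blast
    then have "le A V z z'" using m(1) v(3) unfolding ff_ex_reg_iff[OF m(2)] val_def by blast
    then show ?thesis using val_holds[OF f v(1)] by blast
  qed
  have claim: "holds A f x z" if xy: "holds A e x y" "holds A (adj e) y x'" and xz: "holds A f x' z" for A x y x' z
  proof -
    note ty = holds_typed1[OF E(1) xy(1)] holds_typed1[OF F(1) xz] holds_typed2[OF F(1) xz]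
    obtain B d z' w where d: "so C d" "d \<in> hom C B A" "val B f (x' \<cdot> d) z'" "val B m z' w"
      using val_exists_cmp[OF f m(2) ty(2)] .
    obtain D c z1 where c: "so C c" "c \<in> hom C D B" "val D f ((x \<cdot> d) \<cdot> c) z1"
      using val_exists[OF f cmp_hom[OF d(2) ty(1)]] by blast
    have "holds D f ((x \<cdot> d) \<cdot> c) (z' \<cdot> c)"
      using step[OF holds_restrict[OF holds_restrict[OF xy(1) d(2)] c(2)] holds_restrict[OF holds_restrict[OF xy(2) d(2)] c(2)]
          c(3) val_restrict[OF d(3) c(2)] val_restrict[OF d(4) c(2)]] .
    then have "holds B f (x \<cdot> d) z'" using holds_local[OF F(1) c(1,2) cmp_hom[OF d(2) ty(1)] val_typed(2)[OF f d(3)]] by blast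
    moreover have "le B V z' (z \<cdot> d)" using val_holds[OF f d(3)] holds_restrict[OF xz d(2)] by blast
    ultimately have "holds B f (x \<cdot> d) (z \<cdot> d)" using holds_right[OF F(1)] by blast
    then show ?thesis using holds_local[OF F(1) d(1,2) ty(1,3)] by blast
  qed
  have unit: "\<exists>B d z. so C d \<and> d \<in> hom C B A \<and> holds B ?h (y \<cdot> d) z \<and> holds B ?a z (y \<cdot> d)"
    if y: "y \<in> hom C A (fst Y)" for A y
  proof -
    obtain B d x where d: "so C d" "d \<in> hom C B A" "val B e x (y \<cdot> d)"
      using e(2) y unfolding locally_surj_iff[OF e(1)] by blast
    obtain D c z where c: "so C c" "c \<in> hom C D B" "val D f (x \<cdot> c) z"
      using val_exists[OF f val_typed(1)[OF e(1) d(3)]] by blast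
    have v: "val D e (x \<cdot> c) (y \<cdot> (d \<cdot> c))"
      using val_restrict[OF d(3) c(2)] cmp_assoc[OF c(2) d(2) y] by simp
    have "holds D ?h (y \<cdot> (d \<cdot> c)) z" "holds D ?a z (y \<cdot> (d \<cdot> c))"
      using holds_compI[OF E(2) F(1)] holds_compI[OF F(2) E(1)] v c(3) unfolding val_def by blast+
    then show ?thesis using so_cmp[OF c(1) d(1) c(2) d(2)] cmp_hom[OF c(2) d(2)] by blast
  qed
  \<comment> \<open>There is one cover for each composite; on the finer one the element
    \<open>x\<close> behind \<open>z\<close> and the element \<open>x'\<close> behind
    \<open>z'\<close> are related by the kernel of \<open>e\<close>, and \<open>claim\<close>
    applies.\<close>
  have co: "le A V z z'" if zy: "holds A ?a z y" and yz: "holds A ?h y z'" for A z y z'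
  proof -
    obtain B d x where d: "so C d" "d \<in> hom C B A" "holds B (adj f) (z \<cdot> d) x" "holds B e x (y \<cdot> d)"
      and z: "z \<in> hom C A (fst V)"
      using holds_compE[OF F(2) E(1) zy] .
    note yz' = holds_restrict[OF yz d(2)]
    obtain D c x' where c: "so C c" "c \<in> hom C D B" "holds D (adj e) ((y \<cdot> d) \<cdot> c) x'" "holds D f x' ((z' \<cdot> d) \<cdot> c)"
      and z': "z' \<cdot> d \<in> hom C B (fst V)"
      using holds_compE[OF E(2) F(1) yz'] .
    have "holds D f (x \<cdot> c) ((z' \<cdot> d) \<cdot> c)" using claim[OF holds_restrict[OF d(4) c(2)] c(3,4)] .
    then have "le D V ((z \<cdot> d) \<cdot> c) ((z' \<cdot> d) \<cdot> c)" using counit[OF f holds_restrict[OF d(3) c(2)]] by blast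
    then have "le B V (z \<cdot> d) (z' \<cdot> d)" using le_local[OF c(1,2) cmp_hom[OF d(2) z] z'] by blast
    then show ?thesis using le_local[OF d(1,2) z holds_typed2[OF h yz]] by blast
  qed
  have hX: "?h \<in> hom \<X> Y V" using ex_reg_homI(1)[OF h a] unit co by blast
  have hval: "val A ?h y z" if "val A e x y" "val A f x z" for A x y z
    using ex_reg_homI(2)[OF h a, of A y z] unit co that holds_compI[OF E(2) F(1)] holds_compI[OF F(2) E(1)]
    unfolding val_def by blast
  have he_eq: "?h \<odot> e = f"
  proof (rule ex_reg_eqI[OF cmp_ex_reg(1)[OF e(1) hX] f])
    fix A x assume x: "x \<in> hom C A (fst X)"
    obtain B d y where d: "so C d" "d \<in> hom C B A" "val B e (x \<cdot> d) y" using val_exists[OF e(1) x] by blast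
    obtain D c z where c: "so C c" "c \<in> hom C D B" "val D f ((x \<cdot> d) \<cdot> c) z"
      using val_exists[OF f cmp_hom[OF d(2) x]] by blast
    note dc = val_restrict[OF d(3) c(2)]
    have "val D (?h \<odot> e) (x \<cdot> (d \<cdot> c)) z" "val D f (x \<cdot> (d \<cdot> c)) z"
      using val_cmp[OF e(1) hX dc hval[OF dc c(3)]] c(3) cmp_assoc[OF c(2) d(2) x] by simp_all
    then show "\<exists>B d z. so C d \<and> d \<in> hom C B A \<and> val B (?h \<odot> e) (x \<cdot> d) z \<and> val B f (x \<cdot> d) z"
      using so_cmp[OF c(1) d(1) c(2) d(2)] cmp_hom[OF c(2) d(2)] by blast
  qed
  have "(m \<odot> ?h) \<odot> e = g \<odot> e"
    using cmp_assoc_ex_reg[OF e(1) hX m(2)] he_eq eq by simp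
  then have "m \<odot> ?h = g" using locally_surj_epi[OF e cmp_Qw_hom[OF h M(1)] G(1)] by blast
  then show ?thesis using hX he_eq by blast
qed

text \<open>An \<open>so\<close>-morphism is orthogonal to the \<open>ff\<close>-part of its own
  image, which therefore gets a section; the section provides locally for each \<open>y\<close> an
  element with value \<open>y\<close>, and \<open>m\<close> has the same values as
  \<open>e\<close>.\<close>

lemma so_ex_reg_iff:
  assumes e: "e \<in> hom \<X> X Y"
  shows "so \<X> e \<longleftrightarrow> locally_surj e"
proof
  show "so \<X> e" if "locally_surj e"
    unfolding ex_reg.so_iff[OF e] ex_reg_simps(5) using locally_surj_fill[OF e that] by blast
  assume so: "so \<X> e"
  note E = ex_reg_hom[OF e]
  obtain Z d m where d: "d \<in> hom \<X> X Z" and m: "m \<in> hom \<X> Z Y" "ff \<X> m" and md: "m \<odot> d = e"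
    and v: "\<And>A x y. val A m x y \<longleftrightarrow> val A e x y"
    by (rule ex_reg_image[OF e]) (rule that)
  have eq: "m \<cdot>\<^bsub>\<X>\<^esub> d = ident \<Q> Y \<cdot>\<^bsub>\<X>\<^esub> e"
    using md ident_cmp_ex_reg(2)[OF e] by (simp add: ex_reg_simps(5))
  obtain h where h: "h \<in> hom \<X> Y Z" "m \<cdot>\<^bsub>\<X>\<^esub> h = ident \<Q> Y"
    using ex_reg.so_fill[OF so e m(2,1) d ident_ex_reg(1)[OF E(6)] eq] by blast
  show "locally_surj e"
    unfolding locally_surj_iff[OF e]
  proof (intro allI impI)
    fix A y assume y: "y \<in> hom C A (fst Y)"
    obtain B c x w where c: "so C c" "c \<in> hom C B A" "val B h (y \<cdot> c) x" "val B m x w"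
      using val_exists_cmp[OF h(1) m(1) y] .
    have "val B (ident \<Q> Y) (y \<cdot> c) w"
      using val_cmp[OF h(1) m(1) c(3,4)] h(2) by (simp add: ex_reg_simps(5))
    then have "val B m x (y \<cdot> c)"
      using val_cong[OF m(1) c(4)] ident_ex_reg(2)[OF E(6)] by blast
    then show "\<exists>B c x. so C c \<and> c \<in> hom C B A \<and> val B e x (y \<cdot> c)" using c(1,2) v by blast
  qed
qed

section \<open>Limits\<close>

text \<open>All elements of \<open>T\<close> at a stage are comparable, so the relation that always
  holds serves both as arrow and as right adjoint.\<close>

lemma terminal_ex_reg:
  assumes T: "is_terminal C T"
  shows "is_terminal \<X> (\<Gamma>ob T)"
proof -
  have O: "T \<in> Ob C" using T by (simp add: is_terminal_def)
  note G = Gamma_ob[OF O]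
  have leT: "le A (\<Gamma>ob T) s t" if "s \<in> hom C A T" "t \<in> hom C A T" for A s t
    using T that hom_Ob(1)[OF that(1)] unfolding G(2) is_terminal_def by blast
  have ex: "\<exists>h. h \<in> hom \<X> X (\<Gamma>ob T)" if X: "X \<in> Ob \<Q>" for X
  proof -
    note OX = Ob_Qw[OF X]
    have r: "repr (fst X) (fst (\<Gamma>ob T)) (\<lambda>_ _ _. True)" "repr (fst (\<Gamma>ob T)) (fst X) (\<lambda>_ _ _. True)"
      using repr_True OX(1) O by simp_all
    have u: "\<exists>B e y. so C e \<and> e \<in> hom C B A \<and> (y \<in> hom C B (fst (\<Gamma>ob T)) \<and> True \<and> True)"
      if x: "x \<in> hom C A (fst X)" for A x
      using T so_ident[OF hom_Ob(1)[OF x]] ident_hom[OF hom_Ob(1)[OF x]] hom_Ob(1)[OF x]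
      unfolding is_terminal_def by simp blast
    have "arrow X (\<Gamma>ob T) (\<lambda>_ _ _. True) \<in> hom \<X> X (\<Gamma>ob T)"
      by (rule arrow_ex_reg(1)[OF X G(1) r]; (rule u)?) (use leT in auto)
    then show ?thesis by blast
  qed
  have "h \<sqsubseteq>\<^bsub>\<X>\<^esub> k" if h: "h \<in> hom \<X> X (\<Gamma>ob T)" and k: "k \<in> hom \<X> X (\<Gamma>ob T)" for X h k
    unfolding leq_ex_reg_iff[OF h k]
  proof (intro allI impI)
    fix A x t assume xt: "holds A k x t"
    note K = ex_reg_hom[OF k] and H = ex_reg_hom[OF h]
    note ty = holds_typed1[OF K(1) xt] holds_typed2[OF K(1) xt]
    obtain B e s where e: "so C e" "e \<in> hom C B A" "val B h (x \<cdot> e) s" using val_exists[OF h ty(1)] by blast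
    have "holds B h (x \<cdot> e) (t \<cdot> e)"
      using val_holds[OF h e(3)] leT val_typed(2)[OF h e(3)] cmp_hom[OF e(2) ty(2)] by simp
    then show "holds A h x t" using holds_local[OF H(1) e(1,2) ty] by blast
  qed
  then show ?thesis unfolding is_terminal_def ex_reg_simps(1) using G(1) ex by blast
qed

text \<open>An object whose congruence is pulled back along \<open>p\<close> and \<open>q\<close> has the universal property of a
  subobject of a product. Taking \<open>p = q\<close> gives subobjects of a single object.\<close>

lemma lift_pair:
  assumes X: "X \<in> Ob \<Q>" and Y: "Y \<in> Ob \<Q>" and Z: "Z \<in> Ob \<Q>"
    and p: "p \<in> hom C (fst Z) (fst X)" and q: "q \<in> hom C (fst Z) (fst Y)"
    and leZ: "\<And>A u v. le A Z u v \<longleftrightarrow> u \<in> hom C A (fst Z) \<and> v \<in> hom C A (fst Z) \<and>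
      le A X (p \<cdot> u) (p \<cdot> v) \<and> le A Y (q \<cdot> u) (q \<cdot> v)"
  shows lift_pair_hom: "lift Z X p \<in> hom \<X> Z X" "lift Z Y q \<in> hom \<X> Z Y"
    and lift_pair_val: "\<And>A u. u \<in> hom C A (fst Z) \<Longrightarrow> val A (lift Z X p) u (p \<cdot> u)"
      "\<And>A u. u \<in> hom C A (fst Z) \<Longrightarrow> val A (lift Z Y q) u (q \<cdot> u)"
    and lift_pair_leq: "\<And>V h k. \<lbrakk>h \<in> hom \<X> V Z; k \<in> hom \<X> V Z;
        lift Z X p \<cdot>\<^bsub>\<X>\<^esub> h \<sqsubseteq>\<^bsub>\<X>\<^esub> lift Z X p \<cdot>\<^bsub>\<X>\<^esub> k; lift Z Y q \<cdot>\<^bsub>\<X>\<^esub> h \<sqsubseteq>\<^bsub>\<X>\<^esub> lift Z Y q \<cdot>\<^bsub>\<X>\<^esub> k\<rbrakk>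
      \<Longrightarrow> h \<sqsubseteq>\<^bsub>\<X>\<^esub> k"
    and lift_pair_factor: "\<And>V f g. \<lbrakk>f \<in> hom \<X> V X; g \<in> hom \<X> V Y;
        \<And>A w. w \<in> hom C A (fst V) \<Longrightarrow> \<exists>B e u. so C e \<and> e \<in> hom C B A \<and>
          (u \<in> hom C B (fst Z) \<and> val B f (w \<cdot> e) (p \<cdot> u) \<and> val B g (w \<cdot> e) (q \<cdot> u))\<rbrakk>
      \<Longrightarrow> \<exists>h \<in> hom \<X> V Z. lift Z X p \<cdot>\<^bsub>\<X>\<^esub> h = f \<and> lift Z Y q \<cdot>\<^bsub>\<X>\<^esub> h = g"
proof -
  have m: "le A X (p \<cdot> u) (p \<cdot> v)" "le A Y (q \<cdot> u) (q \<cdot> v)" if "le A Z u v" for A u v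
    using that leZ by blast+
  note P = lift[OF Z X p m(1)] and R = lift[OF Z Y q m(2)]
  let ?p = "lift Z X p" and ?q = "lift Z Y q"
  show ph: "?p \<in> hom \<X> Z X" and qh: "?q \<in> hom \<X> Z Y"
    and pv: "\<And>A u. u \<in> hom C A (fst Z) \<Longrightarrow> val A ?p u (p \<cdot> u)"
    and qv: "\<And>A u. u \<in> hom C A (fst Z) \<Longrightarrow> val A ?q u (q \<cdot> u)"
    using P(1,3) R(1,3) by blast+
  show "h \<sqsubseteq>\<^bsub>\<X>\<^esub> k" if h: "h \<in> hom \<X> V Z" and k: "k \<in> hom \<X> V Z"
    and hk: "?p \<cdot>\<^bsub>\<X>\<^esub> h \<sqsubseteq>\<^bsub>\<X>\<^esub> ?p \<cdot>\<^bsub>\<X>\<^esub> k" "?q \<cdot>\<^bsub>\<X>\<^esub> h \<sqsubseteq>\<^bsub>\<X>\<^esub> ?q \<cdot>\<^bsub>\<X>\<^esub> k" for V h k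
    unfolding leq_ex_reg_iff[OF h k]
  proof (intro allI impI)
    fix A w u assume wu: "holds A k w u"
    note K = ex_reg_hom[OF k] and H = ex_reg_hom[OF h]
    note ty = holds_typed1[OF K(1) wu] holds_typed2[OF K(1) wu]
    obtain B e v where e: "so C e" "e \<in> hom C B A" "val B h (w \<cdot> e) v" using val_exists[OF h ty(1)] by blast
    note ue = cmp_hom[OF e(2) ty(2)] and v = val_typed(2)[OF h e(3)]
    \<comment> \<open>One argument covers both legs: \<open>t\<close> stands for the lifted arrow
      and \<open>s\<close> for the arrow of the base that computes its values.\<close>
    have le: "le B S (s \<cdot> v) (s \<cdot> (u \<cdot> e))"
      if s: "\<And>A u. u \<in> hom C A (fst Z) \<Longrightarrow> val A t u (s \<cdot> u)" "t \<in> hom \<X> Z S" "t \<cdot>\<^bsub>\<X>\<^esub> h \<sqsubseteq>\<^bsub>\<X>\<^esub> t \<cdot>\<^bsub>\<X>\<^esub> k" for S s t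
    proof -
      note t = ex_reg_hom(1)[OF s(2)]
      have "holds B (t \<odot> k) (w \<cdot> e) (s \<cdot> (u \<cdot> e))"
        using holds_compI[OF K(1) t holds_restrict[OF wu e(2)]] s(1)[OF ue] by (simp add: val_def)
      then have "holds B (t \<odot> h) (w \<cdot> e) (s \<cdot> (u \<cdot> e))"
        using s(3) leq_ex_reg_iff[OF cmp_ex_reg(1)[OF h s(2)] cmp_ex_reg(1)[OF k s(2)]] by (simp add: ex_reg_simps(5))
      then show ?thesis using holds_comp_val[OF h t e(3)] val_holds[OF s(2) s(1)[OF v]] by blast
    qed
    have "le B Z v (u \<cdot> e)" using le[OF pv ph hk(1)] le[OF qv qh hk(2)] v ue leZ by blast
    then have "holds B h (w \<cdot> e) (u \<cdot> e)" using val_holds[OF h e(3)] by blast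
    then show "holds A h w u" using holds_local[OF H(1) e(1,2) ty] by blast
  qed
  show "\<exists>h \<in> hom \<X> V Z. ?p \<cdot>\<^bsub>\<X>\<^esub> h = f \<and> ?q \<cdot>\<^bsub>\<X>\<^esub> h = g"
    if f: "f \<in> hom \<X> V X" and g: "g \<in> hom \<X> V Y"
      and ex: "\<And>A w. w \<in> hom C A (fst V) \<Longrightarrow> \<exists>B e u. so C e \<and> e \<in> hom C B A \<and>
        (u \<in> hom C B (fst Z) \<and> val B f (w \<cdot> e) (p \<cdot> u) \<and> val B g (w \<cdot> e) (q \<cdot> u))" for V f g
  proof -
    note F = ex_reg_hom[OF f] and G = ex_reg_hom[OF g]
    note OV = Ob_Qw[OF F(5)]
    \<comment> \<open>The mediating arrow relates \<open>w\<close> to those \<open>u\<close> whose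
      two images lie above the values of \<open>f\<close> and \<open>g\<close>; its right adjoint is
      the same condition with the adjoints of \<open>f\<close> and \<open>g\<close>.\<close>
    let ?P = "\<lambda>A w u. holds A f w (p \<cdot> u) \<and> holds A g w (q \<cdot> u)"
      and ?P' = "\<lambda>A u w. holds A (adj f) (p \<cdot> u) w \<and> holds A (adj g) (q \<cdot> u) w"
    have r: "repr (fst V) (fst Z) ?P" "repr (fst Z) (fst V) ?P'"
      using repr_conj[OF repr_subst_right[OF repr_holds[OF F(1)] p OV(1)] repr_subst_right[OF repr_holds[OF G(1)] q OV(1)]]
        repr_conj[OF repr_subst_left[OF repr_holds[OF F(2)] p OV(1)] repr_subst_left[OF repr_holds[OF G(2)] q OV(1)]] .
    have unit: "\<exists>B e u. so C e \<and> e \<in> hom C B A \<and> (u \<in> hom C B (fst Z) \<and> ?P B (w \<cdot> e) u \<and> ?P' B u (w \<cdot> e))"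
      if "w \<in> hom C A (fst V)" for A w
      using ex[OF that] unfolding val_def by blast
    have c: "?P A w' u" if "le A V w' w" "u \<in> hom C A (fst Z)" "?P A w u" for A w' w u
      using that holds_left[OF F(1)] holds_left[OF G(1)] by blast
    have c': "?P A w u'" if "w \<in> hom C A (fst V)" "?P A w u" "le A Z u u'" for A w u u'
      using that holds_right[OF F(1)] holds_right[OF G(1)] m by blast
    have d: "?P' A u' w" if "le A Z u' u" "w \<in> hom C A (fst V)" "?P' A u w" for A u' u w
      using that holds_left[OF F(2)] holds_left[OF G(2)] m by blast
    have d': "?P' A u w'" if "u \<in> hom C A (fst Z)" "?P' A u w" "le A V w w'" for A u w w'
      using that holds_right[OF F(2)] holds_right[OF G(2)] by blast
    have co: "le A Z u v" if "w \<in> hom C A (fst V)" "u \<in> hom C A (fst Z)" "v \<in> hom C A (fst Z)" "?P' A u w" "?P A w v" for A u w v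
      using that counit[OF f] counit[OF g] leZ by blast
    let ?h = "arrow V Z ?P"
    have h: "?h \<in> hom \<X> V Z"
      "val A ?h w u \<longleftrightarrow> w \<in> hom C A (fst V) \<and> u \<in> hom C A (fst Z) \<and> ?P A w u \<and> ?P' A u w" for A w u
      by (rule arrow_ex_reg[OF F(5) Z r]; fact c c' d d' unit co)+
    have vals: "\<exists>B e u. so C e \<and> e \<in> hom C B A \<and> val B (?p \<odot> ?h) (w \<cdot> e) (p \<cdot> u) \<and> val B f (w \<cdot> e) (p \<cdot> u) \<and>
        val B (?q \<odot> ?h) (w \<cdot> e) (q \<cdot> u) \<and> val B g (w \<cdot> e) (q \<cdot> u)" if w: "w \<in> hom C A (fst V)" for A w
    proof -
      obtain B e u where e: "so C e" "e \<in> hom C B A" "u \<in> hom C B (fst Z)" "val B f (w \<cdot> e) (p \<cdot> u)" "val B g (w \<cdot> e) (q \<cdot> u)"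
        using ex[OF w] by blast
      then have "val B ?h (w \<cdot> e) u" using h(2) cmp_hom[OF e(2) w] unfolding val_def by blast
      then show ?thesis using e val_cmp[OF h(1) ph _ pv[OF e(3)]] val_cmp[OF h(1) qh _ qv[OF e(3)]] by blast
    qed
    have "?p \<odot> ?h = f" by (rule ex_reg_eqI[OF cmp_ex_reg(1)[OF h(1) ph] f]) (use vals in blast)
    moreover have "?q \<odot> ?h = g" by (rule ex_reg_eqI[OF cmp_ex_reg(1)[OF h(1) qh] g]) (use vals in blast)
    ultimately show ?thesis using h(1) by (auto simp: ex_reg_simps(5))
  qed
qed

text \<open>The object \<open>Z\<close> is left open up to its carrier and the description of its
  congruence, so that the result covers both the product constructed in the completion and the image
  under \<open>Gamma\<close> of a product in the base.\<close>

lemma product_ex_reg: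
  assumes pq: "is_product C (fst X) (fst Y) p q" and X: "X \<in> Ob \<Q>" and Y: "Y \<in> Ob \<Q>"
    and Z: "Z \<in> Ob \<Q>" "fst Z = src C p"
    and leZ: "\<And>A u v. le A Z u v \<longleftrightarrow> u \<in> hom C A (fst Z) \<and> v \<in> hom C A (fst Z) \<and>
      le A X (p \<cdot> u) (p \<cdot> v) \<and> le A Y (q \<cdot> u) (q \<cdot> v)"
  shows "is_product \<X> X Y (lift Z X p) (lift Z Y q)"
proof -
  have p: "p \<in> hom C (fst Z) (fst X)" and q: "q \<in> hom C (fst Z) (fst Y)"
    using pq Z(2) by (auto simp: is_product_def jointly_order_mono_def hom_def)
  note L = lift_pair[OF X Y Z(1) p q leZ]
  have "\<exists>h \<in> hom \<X> V Z. lift Z X p \<cdot>\<^bsub>\<X>\<^esub> h = f \<and> lift Z Y q \<cdot>\<^bsub>\<X>\<^esub> h = g"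
    if f: "f \<in> hom \<X> V X" and g: "g \<in> hom \<X> V Y" for V f g
  proof (rule L(6)[OF f g])
    fix A w assume w: "w \<in> hom C A (fst V)"
    obtain B e x where e: "so C e" "e \<in> hom C B A" "val B f (w \<cdot> e) x" using val_exists[OF f w] by blast
    obtain D d y where d: "so C d" "d \<in> hom C D B" "val D g ((w \<cdot> e) \<cdot> d) y"
      using val_exists[OF g cmp_hom[OF e(2) w]] by blast
    note xd = val_restrict[OF e(3) d(2)]
    obtain u where u: "u \<in> hom C D (fst Z)" "p \<cdot> u = x \<cdot> d" "q \<cdot> u = y"
      using pq val_typed(2)[OF f xd] val_typed(2)[OF g d(3)] hom_Ob(1)[OF d(2)] unfolding is_product_def Z(2) by blast
    have "val D f (w \<cdot> (e \<cdot> d)) (p \<cdot> u)" "val D g (w \<cdot> (e \<cdot> d)) (q \<cdot> u)"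
      using xd d(3) u cmp_assoc[OF d(2) e(2) w] by simp_all
    then show "\<exists>B e u. so C e \<and> e \<in> hom C B A \<and>
        (u \<in> hom C B (fst Z) \<and> val B f (w \<cdot> e) (p \<cdot> u) \<and> val B g (w \<cdot> e) (q \<cdot> u))"
      using so_cmp[OF d(1) e(1) d(2) e(2)] cmp_hom[OF d(2) e(2)] u(1) by blast
  qed
  then show ?thesis unfolding is_product_def jointly_order_mono_def
      ex_reg.hom_src[OF L(1)] ex_reg.hom_src[OF L(2)] ex_reg.hom_tgt[OF L(1)] ex_reg.hom_tgt[OF L(2)]
    using ex_reg.hom_Arr[OF L(1)] ex_reg.hom_Arr[OF L(2)] L(5) by blast
qed

text \<open>With values \<open>y'\<close> of \<open>f\<close> and \<open>y''\<close> of
  \<open>g\<close> at \<open>x\<close>, the diagonal condition on \<open>adj g \<odot> f\<close>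
  says that \<open>y'\<close> lies below \<open>y''\<close>. As for products, \<open>Z\<close> is
  kept general to serve \<open>Gamma\<close> as well.\<close>

lemma inserter_ex_reg:
  assumes f: "f \<in> hom \<X> X Y" and g: "g \<in> hom \<X> X Y" and i: "i \<in> hom C (fst Z) (fst X)"
    and i_iff: "\<And>A x. x \<in> hom C A (fst X) \<Longrightarrow>
      (\<exists>h \<in> hom C A (fst Z). i \<cdot> h = x) \<longleftrightarrow> holds A (adj g \<odot> f) x x"
    and Z: "Z \<in> Ob \<Q>"
    and leZ: "\<And>A u v. le A Z u v \<longleftrightarrow> u \<in> hom C A (fst Z) \<and> v \<in> hom C A (fst Z) \<and> le A X (i \<cdot> u) (i \<cdot> v)"
  shows "is_inserter \<X> f g (lift Z X i)"
proof -
  note F = ex_reg_hom[OF f] and G = ex_reg_hom[OF g]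
  have leZ2: "le A Z u v \<longleftrightarrow> u \<in> hom C A (fst Z) \<and> v \<in> hom C A (fst Z) \<and>
      le A X (i \<cdot> u) (i \<cdot> v) \<and> le A X (i \<cdot> u) (i \<cdot> v)" for A u v using leZ by blast
  note L = lift_pair[OF F(5) F(5) Z i i leZ2]
  let ?i = "lift Z X i"
  note ih = L(1)
  have gf_val: "holds A (adj g \<odot> f) x x \<longleftrightarrow> (\<forall>y. holds A g x y \<longrightarrow> holds A f x y)"
    if v: "val A f x y'" "val A g x y''" for A x y' y''
    using holds_comp_val[OF f G(2) v(1)] val_adj[OF g v(2)] val_holds[OF f v(1)] val_holds[OF g v(2)]
      Ob_Qw(5)[OF F(6)] Ob_Qw(4)[OF F(6) val_typed(2)[OF g v(2)]] by blast
  have fg: "holds A f (i \<cdot> u) y" if u: "u \<in> hom C A (fst Z)" and y: "holds A g (i \<cdot> u) y" for A u y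
  proof -
    note x = cmp_hom[OF u i]
    obtain B e y' where e: "so C e" "e \<in> hom C B A" "val B f ((i \<cdot> u) \<cdot> e) y'" using val_exists[OF f x] by blast
    obtain D d y'' where d: "so C d" "d \<in> hom C D B" "val D g (((i \<cdot> u) \<cdot> e) \<cdot> d) y''"
      using val_exists[OF g cmp_hom[OF e(2) x]] by blast
    have "holds A (adj g \<odot> f) (i \<cdot> u) (i \<cdot> u)" using i_iff[OF x] u by blast
    then have "holds D (adj g \<odot> f) (((i \<cdot> u) \<cdot> e) \<cdot> d) (((i \<cdot> u) \<cdot> e) \<cdot> d)"
      using holds_restrict e(2) d(2) by blast
    then have "holds D f (((i \<cdot> u) \<cdot> e) \<cdot> d) ((y \<cdot> e) \<cdot> d)"
      using gf_val[OF val_restrict[OF e(3) d(2)] d(3)] holds_restrict[OF holds_restrict[OF y e(2)] d(2)] by blast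
    then have "holds B f ((i \<cdot> u) \<cdot> e) (y \<cdot> e)"
      using holds_local[OF F(1) d(1,2) cmp_hom[OF e(2) x] cmp_hom[OF e(2) holds_typed2[OF G(1) y]]] by blast
    then show ?thesis using holds_local[OF F(1) e(1,2) x holds_typed2[OF G(1) y]] by blast
  qed
  have le: "f \<cdot>\<^bsub>\<X>\<^esub> ?i \<sqsubseteq>\<^bsub>\<X>\<^esub> g \<cdot>\<^bsub>\<X>\<^esub> ?i"
    unfolding ex_reg_simps(5) leq_ex_reg_iff[OF cmp_ex_reg(1)[OF ih f] cmp_ex_reg(1)[OF ih g]]
  proof (intro allI impI)
    fix A u y assume uy: "holds A (g \<odot> ?i) u y"
    have u: "u \<in> hom C A (fst Z)" using holds_typed1[OF ex_reg_hom(1)[OF cmp_ex_reg(1)[OF ih g]] uy] .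
    show "holds A (f \<odot> ?i) u y"
      using uy fg[OF u] holds_comp_val[OF ih F(1) L(3)[OF u]] holds_comp_val[OF ih G(1) L(3)[OF u]] by blast
  qed
  have ff: "ff \<X> ?i" by (rule ex_reg.ffI[OF ih]) (use L(5) in blast)
  \<comment> \<open>Elements of \<open>Z\<close> are found for values of \<open>h\<close> on a
    cover; there the hypothesis on \<open>h\<close> becomes the diagonal condition, and
    \<open>i_iff\<close> yields the element.\<close>
  have uni: "\<exists>k \<in> hom \<X> V Z. ?i \<cdot>\<^bsub>\<X>\<^esub> k = h"
    if h: "h \<in> hom \<X> V X" and fgh: "f \<cdot>\<^bsub>\<X>\<^esub> h \<sqsubseteq>\<^bsub>\<X>\<^esub> g \<cdot>\<^bsub>\<X>\<^esub> h" for V h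
  proof -
    have "\<exists>B e u. so C e \<and> e \<in> hom C B A \<and>
        (u \<in> hom C B (fst Z) \<and> val B h (w \<cdot> e) (i \<cdot> u) \<and> val B h (w \<cdot> e) (i \<cdot> u))"
      if w: "w \<in> hom C A (fst V)" for A w
    proof -
      obtain B e x y where e: "so C e" "e \<in> hom C B A" "val B h (w \<cdot> e) x" "val B f x y"
        using val_exists_cmp[OF h f w] .
      note x = val_typed(2)[OF h e(3)]
      obtain D d y' where d: "so C d" "d \<in> hom C D B" "val D g (x \<cdot> d) y'" using val_exists[OF g x] by blast
      note hd = val_restrict[OF e(3) d(2)]
      have "holds D f (x \<cdot> d) z" if z: "holds D g (x \<cdot> d) z" for z
      proof -
        have "holds D (f \<odot> h) ((w \<cdot> e) \<cdot> d) z"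
          using z holds_comp_val[OF h G(1) hd] fgh leq_ex_reg_iff[OF cmp_ex_reg(1)[OF h f] cmp_ex_reg(1)[OF h g]]
          by (simp add: ex_reg_simps(5))
        then show ?thesis using holds_comp_val[OF h F(1) hd] by blast
      qed
      then have "holds D (adj g \<odot> f) (x \<cdot> d) (x \<cdot> d)" using gf_val[OF val_restrict[OF e(4) d(2)] d(3)] by blast
      then obtain u where u: "u \<in> hom C D (fst Z)" "i \<cdot> u = x \<cdot> d" using i_iff[OF cmp_hom[OF d(2) x]] by blast
      have "val D h (w \<cdot> (e \<cdot> d)) (i \<cdot> u)" using hd u(2) cmp_assoc[OF d(2) e(2) w] by simp
      then show ?thesis using so_cmp[OF d(1) e(1) d(2) e(2)] cmp_hom[OF d(2) e(2)] u(1) by blast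
    qed
    then show ?thesis using L(6)[OF h h] by blast
  qed
  show ?thesis unfolding is_inserter_def ex_reg.hom_tgt[OF ih] ex_reg.hom_src[OF ih] ex_reg.hom_src[OF f]
    using ff le uni by blast
qed

section \<open>Existence of limits and regularity of the completion\<close>

lemma ex_reg_has_product:
  assumes X: "X \<in> Ob \<Q>" and Y: "Y \<in> Ob \<Q>"
  shows "\<exists>p q. is_product \<X> X Y p q"
proof -
  note OX = Ob_Qw[OF X] and OY = Ob_Qw[OF Y]
  obtain p q where pq: "is_product C (fst X) (fst Y) p q" using has_product OX(1) OY(1) by blast
  have p: "p \<in> hom C (src C p) (fst X)" and q: "q \<in> hom C (src C p) (fst Y)"
    using pq by (auto simp: is_product_def jointly_order_mono_def hom_def)
  let ?P = "\<lambda>A u v. le A X (p \<cdot> u) (p \<cdot> v) \<and> le A Y (q \<cdot> u) (q \<cdot> v)"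
  have "repr (src C p) (src C p) ?P"
    using repr_conj[OF repr_subst[OF repr_le[OF X] p p] repr_subst[OF repr_le[OF Y] q q]] .
  note Z = Ob_rel[OF hom_Ob(1)[OF p] this]
  have refl: "?P A u v" if "u \<in> hom C A (src C p)" "v \<in> hom C A (src C p)" "u \<sqsubseteq> v" for A u v
    using OX(3)[OF cmp_hom[OF that(1) p] cmp_hom[OF that(2) p] cmp_mono_right[OF that(1,2) p that(3)]]
      OY(3)[OF cmp_hom[OF that(1) q] cmp_hom[OF that(2) q] cmp_mono_right[OF that(1,2) q that(3)]] by blast
  have trans: "?P A u w" if "?P A u v" "?P A v w" for A u v w using that OX(5) OY(5) by blast
  let ?Z = "(src C p, rel (src C p) (src C p) ?P)"
  have "?Z \<in> Ob \<Q>" "fst ?Z = src C p"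
    "\<And>A u v. le A ?Z u v \<longleftrightarrow> u \<in> hom C A (fst ?Z) \<and> v \<in> hom C A (fst ?Z) \<and> ?P A u v"
    using Z[OF refl trans] by simp_all
  then show ?thesis using product_ex_reg[OF pq X Y] by blast
qed

lemma ex_reg_has_inserter:
  assumes f: "f \<in> hom \<X> X Y" and g: "g \<in> hom \<X> X Y"
  shows "\<exists>i. is_inserter \<X> f g i"
proof -
  note F = ex_reg_hom[OF f] and G = ex_reg_hom[OF g]
  note OX = Ob_Qw[OF F(5)]
  note K = Qw_hom[OF cmp_Qw_hom[OF F(1) G(2)]]
  obtain I i where i: "ff C i" "i \<in> hom C I (fst X)"
    "\<And>A x. x \<in> hom C A (fst X) \<Longrightarrow> (\<exists>h \<in> hom C A I. i \<cdot> h = x) \<longleftrightarrow>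
      el A (fst X) (fst X) (snd (snd (adj g \<odot> f))) x x"
    by (rule representable_diagonal[OF K(5) OX(1)]) (rule that)
  let ?P = "\<lambda>A u v. le A X (i \<cdot> u) (i \<cdot> v)"
  have "repr I I ?P" using repr_subst[OF repr_le[OF F(5)] i(2) i(2)] .
  note Z = Ob_rel[OF hom_Ob(1)[OF i(2)] this]
  have refl: "?P A u v" if "u \<in> hom C A I" "v \<in> hom C A I" "u \<sqsubseteq> v" for A u v
    using OX(3)[OF cmp_hom[OF that(1) i(2)] cmp_hom[OF that(2) i(2)] cmp_mono_right[OF that(1,2) i(2) that(3)]] .
  let ?Z = "(I, rel I I ?P)"
  have Z': "?Z \<in> Ob \<Q>"
    "\<And>A u v. le A ?Z u v \<longleftrightarrow> u \<in> hom C A (fst ?Z) \<and> v \<in> hom C A (fst ?Z) \<and> ?P A u v"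
    using Z[OF refl OX(5)] by simp_all
  have ih: "i \<in> hom C (fst ?Z) (fst X)" using i(2) by simp
  have iff: "(\<exists>h \<in> hom C A (fst ?Z). i \<cdot> h = x) \<longleftrightarrow> holds A (adj g \<odot> f) x x" if "x \<in> hom C A (fst X)" for A x
    using i(3)[OF that] by (simp add: holds_def K(3,4))
  show ?thesis using inserter_ex_reg[OF f g ih iff Z'] by blast
qed

text \<open>The pullback is known only through its universal property, so its elements are produced
  by mapping points into it. An element \<open>z\<close> and a local preimage \<open>x\<close> of
  its value give two points that agree over the common codomain, and the induced arrow into the
  pullback has a local value lying over \<open>z\<close>.\<close>

lemma so_stable_ex_reg:
  assumes pb: "is_pullback \<X> e g p q" and so: "so \<X> e"
  shows "so \<X> q"
proof -
  let ?X = "src \<X> e" and ?Y = "tgt \<X> e" and ?W = "src \<X> g" and ?P = "src \<X> p"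
  have e: "e \<in> hom \<X> ?X ?Y" and g: "g \<in> hom \<X> ?W ?Y" and p: "p \<in> hom \<X> ?P ?X" and q: "q \<in> hom \<X> ?P ?W"
    using pb by (auto simp: is_pullback_def jointly_order_mono_def hom_def)
  note E = ex_reg_hom[OF e] and G = ex_reg_hom[OF g] and R = ex_reg_hom[OF q]
  have surj: "locally_surj e" using so so_ex_reg_iff[OF e] by blast
  have "locally_surj q"
    unfolding locally_surj_iff[OF q]
  proof (intro allI impI)
    fix A z assume z: "z \<in> hom C A (fst ?W)"
    obtain B d y where d: "so C d" "d \<in> hom C B A" "val B g (z \<cdot> d) y" using val_exists[OF g z] by blast
    obtain D c x where c: "so C c" "c \<in> hom C D B" "val D e x (y \<cdot> c)"
      using surj val_typed(2)[OF g d(3)] unfolding locally_surj_iff[OF e] by blast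
    let ?z = "(z \<cdot> d) \<cdot> c"
    note zv = val_restrict[OF d(3) c(2)]
    have x: "x \<in> hom C D (fst ?X)" and zh: "?z \<in> hom C D (fst ?W)"
      using val_typed(1)[OF e c(3)] val_typed(1)[OF g zv] .
    note px = point[OF E(5) x] and pz = point[OF G(5) zh]
    note ex = cmp_ex_reg(1)[OF px(1) e] and gz = cmp_ex_reg(1)[OF pz(1) g]
    \<comment> \<open>Both composites have as value the restriction along \<open>a\<close> of the
      common value \<open>y \<cdot> c\<close>.\<close>
    have "e \<odot> point D ?X x = g \<odot> point D ?W ?z"
    proof (rule ex_reg_eqI[OF ex gz])
      fix H a assume "a \<in> hom C H (fst (\<Gamma>ob D))"
      then have a: "a \<in> hom C H D" by simp
      show "\<exists>B b v. so C b \<and> b \<in> hom C B H \<and> val B (e \<odot> point D ?X x) (a \<cdot> b) v \<and>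
          val B (g \<odot> point D ?W ?z) (a \<cdot> b) v"
        by (rule trivial_cover[OF a]) (use val_cmp[OF px(1) e px(3)[OF a] val_restrict[OF c(3) a]]
          val_cmp[OF pz(1) g pz(3)[OF a] val_restrict[OF zv a]] in blast)
    qed
    then have "e \<cdot>\<^bsub>\<X>\<^esub> point D ?X x = g \<cdot>\<^bsub>\<X>\<^esub> point D ?W ?z" by (simp add: ex_reg_simps(5))
    then obtain h where h: "h \<in> hom \<X> (\<Gamma>ob D) ?P" "q \<cdot>\<^bsub>\<X>\<^esub> h = point D ?W ?z"
      using pb px(1) pz(1) ex_reg.hom_Ob(1)[OF px(1)] unfolding is_pullback_def by blast
    \<comment> \<open>The generic element of \<open>D\<close> is fed to \<open>h\<close>; a value
      \<open>w\<close> in the pullback is obtained on a further cover \<open>b\<close>.\<close>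
    have id: "ident C D \<in> hom C D (fst (\<Gamma>ob D))" using ident_hom[OF hom_Ob(1)[OF x]] by simp
    obtain H b w v where b: "so C b" "b \<in> hom C H D" "val H h (ident C D \<cdot> b) w" "val H q w v"
      using val_exists_cmp[OF h(1) q id] .
    have "val H (point D ?W ?z) b v"
      using val_cmp[OF h(1) q b(3,4)] h(2) ident_left[OF b(2)] by (simp add: ex_reg_simps(5))
    then have 1: "le H ?W (?z \<cdot> b) v"
      using val_holds[OF pz(1) pz(3)[OF b(2)]] by (simp add: val_def)
    have "holds H (adj (point D ?W ?z)) v b" using \<open>val H (point D ?W ?z) b v\<close> by (simp add: val_def)
    then have "le H ?W v (?z \<cdot> b)" using val_adj[OF pz(1) pz(3)[OF b(2)]] by blast
    \<comment> \<open>Values are determined only up to the congruence, so \<open>v\<close> may be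
      replaced by the required element.\<close>
    then have "val H q w (?z \<cdot> b)" using val_cong[OF q b(4) _ 1] by blast
    moreover have "?z \<cdot> b = z \<cdot> (d \<cdot> (c \<cdot> b))"
      using cmp_assoc[OF b(2) c(2) cmp_hom[OF d(2) z]] cmp_assoc[OF cmp_hom[OF b(2) c(2)] d(2) z] by simp
    moreover have "so C (d \<cdot> (c \<cdot> b))" "d \<cdot> (c \<cdot> b) \<in> hom C H A"
      using so_cmp[OF so_cmp[OF b(1) c(1) b(2) c(2)] d(1) cmp_hom[OF b(2) c(2)] d(2)]
        cmp_hom[OF cmp_hom[OF b(2) c(2)] d(2)] .
    ultimately show "\<exists>B e x. so C e \<and> e \<in> hom C B A \<and> val B q x (z \<cdot> e)" by metis
  qed
  then show ?thesis using so_ex_reg_iff[OF q] by blast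
qed

lemma regular_ex_reg: "regular_category \<X>"
proof (unfold_locales)
  show "has_finite_weighted_limits \<X>"
  proof (rule ex_reg.has_finite_weighted_limitsI)
    show "\<exists>T. is_terminal \<X> T" using has_terminal terminal_ex_reg by blast
    show "\<exists>p q. is_product \<X> X Y p q" if "X \<in> Ob \<X>" "Y \<in> Ob \<X>" for X Y
      using that ex_reg_has_product by (simp add: ex_reg_simps)
    show "\<exists>i. is_inserter \<X> f g i" if "f \<in> hom \<X> X Y" "g \<in> hom \<X> X Y" for X Y f g
      using that ex_reg_has_inserter by blast
  qed
  show "so \<X> q" if "is_pullback \<X> e g p q" "so \<X> e" for e g p q using so_stable_ex_reg that by blast
  fix f assume "f \<in> Arr \<X>"
  then have f: "f \<in> hom \<X> (src \<X> f) (tgt \<X> f)" by (rule homI)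
  obtain Z e m where em: "e \<in> hom \<X> (src \<X> f) Z" "m \<in> hom \<X> Z (tgt \<X> f)" "m \<odot> e = f" "ff \<X> m" "locally_surj e"
    by (rule ex_reg_image[OF f]) (rule that)
  have "so \<X> e" using em(5) so_ex_reg_iff[OF em(1)] by blast
  then show "\<exists>e m. so \<X> e \<and> ff \<X> m \<and> src \<X> e = src \<X> f \<and> tgt \<X> e = src \<X> m \<and> tgt \<X> m = tgt \<X> f \<and>
      m \<cdot>\<^bsub>\<X>\<^esub> e = f"
    using em ex_reg.hom_src[OF em(1)] ex_reg.hom_tgt[OF em(1)] ex_reg.hom_src[OF em(2)] ex_reg.hom_tgt[OF em(2)]
    by (intro exI[of _ e] exI[of _ m]) (simp add: ex_reg_simps(5))
qed

section \<open>The functor into the exact completion\<close>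

abbreviation \<Gamma>ar :: "'a \<Rightarrow> ('o, 'a) cong_arr" where "\<Gamma>ar \<equiv> far (Gamma C)"

text \<open>Identifies the comma relation in the definition of \<open>Gamma\<close> with the arrow
  induced by \<open>f\<close>, so that the facts on \<open>lift\<close> become available.\<close>

lemma Gamma_arr:
  assumes f: "f \<in> hom C X Y"
  shows "\<Gamma>ar f = lift (\<Gamma>ob X) (\<Gamma>ob Y) f" "\<Gamma>ar f \<in> hom \<X> (\<Gamma>ob X) (\<Gamma>ob Y)"
    and holds_Gamma: "holds A (\<Gamma>ar f) x y \<longleftrightarrow> x \<in> hom C A X \<and> y \<in> hom C A Y \<and> f \<cdot> x \<sqsubseteq> y"
    and val_Gamma: "x \<in> hom C A X \<Longrightarrow> val A (\<Gamma>ar f) x (f \<cdot> x)"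
proof -
  note O = hom_Ob[OF f]
  note GX = Gamma_ob[OF O(1)] and GY = Gamma_ob[OF O(2)]
  have fh: "f \<in> hom C (fst (\<Gamma>ob X)) (fst (\<Gamma>ob Y))" using f by simp
  have l: "lift (\<Gamma>ob X) (\<Gamma>ob Y) f \<in> hom \<X> (\<Gamma>ob X) (\<Gamma>ob Y)"
    "holds A (lift (\<Gamma>ob X) (\<Gamma>ob Y) f) x y \<longleftrightarrow> x \<in> hom C A X \<and> le A (\<Gamma>ob Y) (f \<cdot> x) y"
    "x \<in> hom C A X \<Longrightarrow> val A (lift (\<Gamma>ob X) (\<Gamma>ob Y) f) x (f \<cdot> x)" for A x y
    using point[OF GY(1), of f X] f by simp_all
  show h: "holds A (\<Gamma>ar f) x y \<longleftrightarrow> x \<in> hom C A X \<and> y \<in> hom C A Y \<and> f \<cdot> x \<sqsubseteq> y" for A x y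
    using el_lower_star[OF f] hom_src[OF f] hom_tgt[OF f] by (simp add: holds_def Gamma_def)
  have iff: "holds A (\<Gamma>ar f) x y \<longleftrightarrow> holds A (lift (\<Gamma>ob X) (\<Gamma>ob Y) f) x y" for A x y
    unfolding h l(2) GY(2) using cmp_hom[OF _ f] by blast
  note lQ = ex_reg_hom(1)[OF l(1)]
  have fs: "fst (\<Gamma>ar f) = \<Gamma>ob X" "fst (snd (\<Gamma>ar f)) = \<Gamma>ob Y" "snd (snd (\<Gamma>ar f)) = lower_star C f"
    using hom_src[OF f] hom_tgt[OF f] by (simp_all add: Gamma_def)
  have "\<Gamma>ar f \<in> hom \<Q> (\<Gamma>ob X) (\<Gamma>ob Y)"
    unfolding hom_Qw_iff iff fs using GX(1) GY(1) lower_star_Rel[OF f] Qw_hom(6,7)[OF lQ] by simp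
  then show eq: "\<Gamma>ar f = lift (\<Gamma>ob X) (\<Gamma>ob Y) f" using holds_eqI[OF _ lQ] iff by blast
  show "\<Gamma>ar f \<in> hom \<X> (\<Gamma>ob X) (\<Gamma>ob Y)" "x \<in> hom C A X \<Longrightarrow> val A (\<Gamma>ar f) x (f \<cdot> x)"
    using l(1,3) by (simp_all add: eq)
qed

text \<open>The image of \<open>g\<close> relates the generic element, the identity of
  \<open>X\<close>, to \<open>g\<close>; this single instance reflects the order.\<close>

lemma Gamma_leq_iff:
  assumes f: "f \<in> hom C X Y" and g: "g \<in> hom C X Y"
  shows "\<Gamma>ar f \<sqsubseteq>\<^bsub>\<X>\<^esub> \<Gamma>ar g \<longleftrightarrow> f \<sqsubseteq> g"
  unfolding leq_ex_reg_iff[OF Gamma_arr(2)[OF f] Gamma_arr(2)[OF g]] holds_Gamma[OF f] holds_Gamma[OF g]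
proof
  assume l: "\<forall>A x y. x \<in> hom C A X \<and> y \<in> hom C A Y \<and> g \<cdot> x \<sqsubseteq> y \<longrightarrow> x \<in> hom C A X \<and> y \<in> hom C A Y \<and> f \<cdot> x \<sqsubseteq> y"
  have id: "ident C X \<in> hom C X X" using ident_hom hom_Ob(1)[OF f] by blast
  show "f \<sqsubseteq> g" using l id g ident_right[OF f] ident_right[OF g] leq_refl[OF g] by metis
next
  assume fg: "f \<sqsubseteq> g"
  have "f \<cdot> x \<sqsubseteq> y" if x: "x \<in> hom C A X" "y \<in> hom C A Y" "g \<cdot> x \<sqsubseteq> y" for A x y
    using leq_trans[OF cmp_hom[OF x(1) f] cmp_hom[OF x(1) g] x(2) cmp_mono_left[OF x(1) f g fg] x(3)] .
  then show "\<forall>A x y. x \<in> hom C A X \<and> y \<in> hom C A Y \<and> g \<cdot> x \<sqsubseteq> y \<longrightarrow> x \<in> hom C A X \<and> y \<in> hom C A Y \<and> f \<cdot> x \<sqsubseteq> y"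
    by blast
qed

lemma fob_Gamma: "fob (Gamma C) X = \<Gamma>ob X"
  by (simp add: Gamma_def)

lemma Gamma_functor: "pos_functor C \<X> (Gamma C)"
proof (unfold_locales, unfold fob_Gamma, goal_cases)
  case (1 X) then show ?case using Gamma_ob(1) by (simp add: ex_reg_simps)
next
  case (2 f X Y) then show ?case using Gamma_arr(2) by blast
next
  case (3 X)
  then show ?case
    using hom_src[OF ident_hom[OF 3]] hom_tgt[OF ident_hom[OF 3]]
    by (simp add: Gamma_def ex_reg_simps Qw_simps id_rel_def lower_star_def)
next
  case (4 f X Y g Z)
  note f = Gamma_arr[OF 4(1)] and g = Gamma_arr[OF 4(2)] and gf = Gamma_arr[OF cmp_hom[OF 4]]
  note c = cmp_ex_reg(1)[OF f(2) g(2)]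
  have "\<Gamma>ar (g \<cdot> f) = \<Gamma>ar g \<odot> \<Gamma>ar f"
  proof (rule ex_reg_eqI[OF gf(2) c])
    fix A x assume "x \<in> hom C A (fst (\<Gamma>ob X))"
    then have x: "x \<in> hom C A X" by simp
    show "\<exists>B e y. so C e \<and> e \<in> hom C B A \<and> val B (\<Gamma>ar (g \<cdot> f)) (x \<cdot> e) y \<and> val B (\<Gamma>ar g \<odot> \<Gamma>ar f) (x \<cdot> e) y"
      by (rule trivial_cover[OF x])
        (use gf(4)[OF x] val_cmp[OF f(2) g(2) f(4)[OF x] g(4)[OF cmp_hom[OF x 4(1)]]] cmp_assoc[OF x 4] in simp)
  qed
  then show ?case by (simp add: ex_reg_simps(5))
next
  case (5 f X Y g) then show ?case using Gamma_leq_iff by blast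
qed

section \<open>Preservation of limits and of so-morphisms; fullness\<close>

lemma Gamma_terminal: "\<exists>T. is_terminal C T \<and> is_terminal \<X> (fob (Gamma C) T)"
  unfolding fob_Gamma using has_terminal terminal_ex_reg by blast

text \<open>Joint order-monomorphy of the projections says that the order on elements of the product
  is pulled back from the two factors, which is the congruence required by
  \<open>product_ex_reg\<close>.\<close>

lemma Gamma_product:
  assumes X: "X \<in> Ob C" and Y: "Y \<in> Ob C"
  shows "\<exists>p q. is_product C X Y p q \<and> is_product \<X> (fob (Gamma C) X) (fob (Gamma C) Y) (\<Gamma>ar p) (\<Gamma>ar q)"
proof -
  obtain p q where pq: "is_product C X Y p q" using has_product X Y by blast
  let ?P = "src C p"
  have p: "p \<in> hom C ?P X" and q: "q \<in> hom C ?P Y"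
    using pq by (auto simp: is_product_def jointly_order_mono_def hom_def)
  note G = Gamma_ob[OF hom_Ob(1)[OF p]]
  have "le A (\<Gamma>ob ?P) u v \<longleftrightarrow> u \<in> hom C A (fst (\<Gamma>ob ?P)) \<and> v \<in> hom C A (fst (\<Gamma>ob ?P)) \<and>
      le A (\<Gamma>ob X) (p \<cdot> u) (p \<cdot> v) \<and> le A (\<Gamma>ob Y) (q \<cdot> u) (q \<cdot> v)" for A u v
  proof -
    have "u \<sqsubseteq> v \<longleftrightarrow> p \<cdot> u \<sqsubseteq> p \<cdot> v \<and> q \<cdot> u \<sqsubseteq> q \<cdot> v" if uv: "u \<in> hom C A ?P" "v \<in> hom C A ?P"
      using pq uv hom_Ob(1)[OF uv(1)] cmp_mono_right[OF uv p] cmp_mono_right[OF uv q]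
      unfolding is_product_def jointly_order_mono_def by blast
    then show ?thesis unfolding G(2) Gamma_ob(2)[OF X] Gamma_ob(2)[OF Y] fst_conv
      using cmp_hom[OF _ p] cmp_hom[OF _ q] by blast
  qed
  moreover have "is_product C (fst (\<Gamma>ob X)) (fst (\<Gamma>ob Y)) p q" "fst (\<Gamma>ob ?P) = ?P" using pq by simp_all
  ultimately have "is_product \<X> (\<Gamma>ob X) (\<Gamma>ob Y) (\<Gamma>ar p) (\<Gamma>ar q)"
    unfolding Gamma_arr(1)[OF p] Gamma_arr(1)[OF q]
    using product_ex_reg[OF _ Gamma_ob(1)[OF X] Gamma_ob(1)[OF Y] G(1)] by blast
  then show ?thesis unfolding fob_Gamma using pq by blast
qed

text \<open>For images of \<open>f\<close> and \<open>g\<close> the diagonal condition reads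
  \<open>f \<cdot> x \<sqsubseteq> g \<cdot> x\<close>, the defining inequality of the inserter;
  \<open>i\<close> being an \<open>ff\<close>-morphism, the order on elements of its domain is the
  one pulled back along \<open>i\<close>.\<close>

lemma Gamma_inserter:
  assumes f: "f \<in> hom C X Y" and g: "g \<in> hom C X Y"
  shows "\<exists>i. is_inserter C f g i \<and> is_inserter \<X> (\<Gamma>ar f) (\<Gamma>ar g) (\<Gamma>ar i)"
proof -
  obtain i where ins: "is_inserter C f g i" using has_inserter f g by blast
  let ?I = "src C i"
  have i: "i \<in> hom C ?I X" "ff C i" "f \<cdot> i \<sqsubseteq> g \<cdot> i"
    using is_inserterD[OF ins f] ins by (auto simp: is_inserter_def)
  note F = Gamma_arr[OF f] and G = Gamma_arr[OF g]
  note O = Gamma_ob[OF hom_Ob(1)[OF i(1)]] and OX = Gamma_ob[OF hom_Ob(1)[OF f]] and OY = Gamma_ob[OF hom_Ob(2)[OF f]]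
  have iff: "(\<exists>h \<in> hom C A ?I. i \<cdot> h = x) \<longleftrightarrow> holds A (adj (\<Gamma>ar g) \<odot> \<Gamma>ar f) x x" if x: "x \<in> hom C A X" for A x
  proof -
    have "holds A (adj (\<Gamma>ar g) \<odot> \<Gamma>ar f) x x \<longleftrightarrow> holds A (adj (\<Gamma>ar g)) (f \<cdot> x) x"
      using holds_comp_val[OF F(2) ex_reg_hom(2)[OF G(2)] F(4)[OF x]] .
    also have "\<dots> \<longleftrightarrow> f \<cdot> x \<sqsubseteq> g \<cdot> x"
      using val_adj[OF G(2) G(4)[OF x]] OY(2) cmp_hom[OF x f] cmp_hom[OF x g] by blast
    also have "\<dots> \<longleftrightarrow> (\<exists>h \<in> hom C A ?I. i \<cdot> h = x)"
    proof
      show "\<exists>h \<in> hom C A ?I. i \<cdot> h = x" if "f \<cdot> x \<sqsubseteq> g \<cdot> x"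
        using ins x that hom_Ob(1)[OF x] hom_src[OF f] unfolding is_inserter_def by blast
      assume "\<exists>h \<in> hom C A ?I. i \<cdot> h = x"
      then obtain h where h: "h \<in> hom C A ?I" "i \<cdot> h = x" by blast
      show "f \<cdot> x \<sqsubseteq> g \<cdot> x"
        using cmp_mono_left[OF h(1) cmp_hom[OF i(1) f] cmp_hom[OF i(1) g] i(3)]
          cmp_assoc[OF h(1) i(1) f] cmp_assoc[OF h(1) i(1) g] h(2) by simp
    qed
    finally show ?thesis by blast
  qed
  have leI: "le A (\<Gamma>ob ?I) u v \<longleftrightarrow> u \<in> hom C A ?I \<and> v \<in> hom C A ?I \<and> le A (\<Gamma>ob X) (i \<cdot> u) (i \<cdot> v)" for A u v
    unfolding O(2) OX(2)
    using cmp_mono_right[OF _ _ i(1)] ffD[OF i(2,1)] cmp_hom[OF _ i(1)] by blast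
  have "is_inserter \<X> (\<Gamma>ar f) (\<Gamma>ar g) (\<Gamma>ar i)"
    unfolding Gamma_arr(1)[OF i(1)]
    by (rule inserter_ex_reg[OF F(2) G(2) _ _ O(1)]) (use i(1) iff leI in simp_all)
  then show ?thesis using ins by blast
qed

lemma Gamma_so:
  assumes "so C e"
  shows "so \<X> (\<Gamma>ar e)"
proof -
  have e: "e \<in> hom C (src C e) (tgt C e)" using assms by (simp add: so_def homI)
  note G = Gamma_arr[OF e]
  have "locally_surj (\<Gamma>ar e)"
    unfolding locally_surj_iff[OF G(2)]
  proof (intro allI impI)
    fix A y assume y: "y \<in> hom C A (fst (\<Gamma>ob (tgt C e)))"
    have y': "y \<in> hom C A (tgt C e)" using y by simp
    obtain B d h where d: "so C d" "d \<in> hom C B A" "h \<in> hom C B (src C e)" "e \<cdot> h = y \<cdot> d"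
      using so_pullback[OF assms e y'] .
    then show "\<exists>B d x. so C d \<and> d \<in> hom C B A \<and> val B (\<Gamma>ar e) x (y \<cdot> d)" using G(4)[OF d(3)] by metis
  qed
  then show ?thesis using so_ex_reg_iff[OF G(2)] by blast
qed

text \<open>The image of the pair of \<open>e\<close> and \<open>y\<close> is the graph of the arrow
  sought. Its projection to \<open>X\<close> is an \<open>ff\<close>-morphism by compatibility of
  \<open>y\<close> with the kernel of \<open>e\<close>, and as \<open>e\<close> factors through it,
  orthogonality provides a section.\<close>

lemma so_effective:
  assumes e: "so C e" "e \<in> hom C B X" and y: "y \<in> hom C B Y"
    and comp: "\<And>A b b'. \<lbrakk>b \<in> hom C A B; b' \<in> hom C A B; e \<cdot> b \<sqsubseteq> e \<cdot> b'\<rbrakk> \<Longrightarrow> y \<cdot> b \<sqsubseteq> y \<cdot> b'"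
  obtains f where "f \<in> hom C X Y" "f \<cdot> e = y"
proof -
  note XY = hom_Ob(2)[OF e(2)] hom_Ob(2)[OF y]
  note pr = prj_hom[OF XY] and pa = pairing[OF e(2) y]
  obtain T d m where d: "so C d" "ff C m" "d \<in> hom C B T" "m \<in> hom C T (prod_ob C X Y)" "m \<cdot> d = pairing C X Y e y"
    using image_factorization[OF pa(1)] .
  let ?s = "prj0 C X Y \<cdot> m" and ?t = "prj1 C X Y \<cdot> m"
  note s = cmp_hom[OF d(4) pr(1)] and t = cmp_hom[OF d(4) pr(2)]
  have sd: "?s \<cdot> d = e" and td: "?t \<cdot> d = y"
    using cmp_assoc[OF d(3,4) pr(1)] cmp_assoc[OF d(3,4) pr(2)] d(5) pa by simp_all
  have "ff C ?s"
  proof (rule ffI[OF s])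
    fix A u v assume u: "u \<in> hom C A T" and v: "v \<in> hom C A T" and uv: "?s \<cdot> u \<sqsubseteq> ?s \<cdot> v"
    \<comment> \<open>Compatibility speaks of elements of \<open>B\<close>, so \<open>u\<close> and
      \<open>v\<close> are lifted along \<open>d\<close>, one after the other, to a common
      cover.\<close>
    obtain W c b where c: "so C c" "c \<in> hom C W A" "b \<in> hom C W B" "d \<cdot> b = u \<cdot> c"
      using so_pullback[OF d(1,3) u] .
    obtain W' c' b' where c': "so C c'" "c' \<in> hom C W' W" "b' \<in> hom C W' B" "d \<cdot> b' = (v \<cdot> c) \<cdot> c'"
      using so_pullback[OF d(1,3) cmp_hom[OF c(2) v]] .
    let ?b = "b \<cdot> c'" and ?u = "(u \<cdot> c) \<cdot> c'" and ?v = "(v \<cdot> c) \<cdot> c'"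
    note b = cmp_hom[OF c'(2) c(3)]
    have ud: "d \<cdot> ?b = ?u" using cmp_assoc[OF c'(2) c(3) d(3)] c(4) by simp
    note uh = cmp_hom[OF c'(2) cmp_hom[OF c(2) u]] and vh = cmp_hom[OF c'(2) cmp_hom[OF c(2) v]]
    have restr: "?s \<cdot> ((w \<cdot> c) \<cdot> c') = ((?s \<cdot> w) \<cdot> c) \<cdot> c'" if w: "w \<in> hom C A T" for w
      using cmp_assoc[OF c'(2) cmp_hom[OF c(2) w] s] cmp_assoc[OF c(2) w s] by simp
    note su = cmp_hom[OF u s] and sv = cmp_hom[OF v s]
    have suv: "?s \<cdot> ?u \<sqsubseteq> ?s \<cdot> ?v"
      unfolding restr[OF u] restr[OF v]
      using cmp_mono_left[OF c'(2) cmp_hom[OF c(2) su] cmp_hom[OF c(2) sv] cmp_mono_left[OF c(2) su sv uv]] .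
    have "e \<cdot> ?b = ?s \<cdot> ?u" "e \<cdot> b' = ?s \<cdot> ?v" "y \<cdot> ?b = ?t \<cdot> ?u" "y \<cdot> b' = ?t \<cdot> ?v"
      using cmp_assoc[OF b d(3) s] cmp_assoc[OF c'(3) d(3) s] cmp_assoc[OF b d(3) t] cmp_assoc[OF c'(3) d(3) t]
        ud c'(4) sd td by simp_all
    then have tuv: "?t \<cdot> ?u \<sqsubseteq> ?t \<cdot> ?v" using comp[OF b c'(3)] suv by simp
    have "m \<cdot> ?u \<sqsubseteq> m \<cdot> ?v"
      by (rule prod_leqI[OF XY cmp_hom[OF uh d(4)] cmp_hom[OF vh d(4)]])
        (use suv tuv cmp_assoc[OF uh d(4) pr(1)] cmp_assoc[OF vh d(4) pr(1)]
          cmp_assoc[OF uh d(4) pr(2)] cmp_assoc[OF vh d(4) pr(2)] in simp_all)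
    then have "?u \<sqsubseteq> ?v" using ffD[OF d(2,4) uh vh] by blast
    \<comment> \<open>The two covers are cancelled in reverse order, \<open>so\<close>-morphisms
      being epimorphic for the order.\<close>
    then have "u \<cdot> c \<sqsubseteq> v \<cdot> c" using so_order_epi[OF c'(1,2) cmp_hom[OF c(2) u] cmp_hom[OF c(2) v]] by blast
    then show "u \<sqsubseteq> v" using so_order_epi[OF c(1,2) u v] by blast
  qed
  then obtain h where h: "h \<in> hom C X T" "h \<cdot> e = d"
    using so_fill[OF e _ s d(3) ident_hom[OF XY(1)]] sd ident_left[OF e(2)] by metis
  have "(?t \<cdot> h) \<cdot> e = y" using cmp_assoc[OF e(2) h(1) t] h(2) td by simp
  then show ?thesis using that cmp_hom[OF h(1) t] by blast
qed

text \<open>The generic element of \<open>X\<close> has a value \<open>y\<close> under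
  \<open>k\<close> on a cover \<open>e\<close>, and the task is to descend \<open>y\<close> along
  \<open>e\<close>. Descent is \<open>so_effective\<close>, whose compatibility condition is the
  absorption of the order by \<open>k\<close>.\<close>

lemma Gamma_full:
  assumes X: "X \<in> Ob C" and Y: "Y \<in> Ob C" and k: "k \<in> hom \<X> (\<Gamma>ob X) (\<Gamma>ob Y)"
  shows "\<exists>f \<in> hom C X Y. \<Gamma>ar f = k"
proof -
  note K = ex_reg_hom[OF k]
  note GX = Gamma_ob[OF X] and GY = Gamma_ob[OF Y]
  have id: "ident C X \<in> hom C X (fst (\<Gamma>ob X))" using ident_hom[OF X] by simp
  obtain B e y where e: "so C e" "e \<in> hom C B X" "val B k (ident C X \<cdot> e) y" using val_exists[OF k id] by blast
  then have v: "val B k e y" using ident_left by simp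
  have y: "y \<in> hom C B Y" using val_typed(2)[OF k v] by simp
  have "y \<cdot> b \<sqsubseteq> y \<cdot> b'" if b: "b \<in> hom C A B" "b' \<in> hom C A B" "e \<cdot> b \<sqsubseteq> e \<cdot> b'" for A b b'
  proof -
    have "le A (\<Gamma>ob X) (e \<cdot> b) (e \<cdot> b')" using b cmp_hom[OF _ e(2)] unfolding GX(2) by blast
    moreover have "holds A k (e \<cdot> b') (y \<cdot> b')" using val_restrict[OF v b(2)] by (simp add: val_def)
    ultimately have "holds A k (e \<cdot> b) (y \<cdot> b')" using holds_left[OF K(1)] by blast
    then show ?thesis using val_holds[OF k val_restrict[OF v b(1)]] GY(2) by blast
  qed
  then obtain f where f: "f \<in> hom C X Y" "f \<cdot> e = y" using so_effective[OF e(1,2) y] by blast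
  note G = Gamma_arr[OF f(1)]
  have "\<Gamma>ar f = k"
  proof (rule ex_reg_eqI[OF G(2) k])
    fix A x assume "x \<in> hom C A (fst (\<Gamma>ob X))"
    then have x: "x \<in> hom C A X" by simp
    \<comment> \<open>An arbitrary \<open>x\<close> lifts locally along \<open>e\<close> to some
      \<open>b\<close>, where both arrows have the value \<open>y \<cdot> b\<close>.\<close>
    obtain W d b where d: "so C d" "d \<in> hom C W A" "b \<in> hom C W B" "e \<cdot> b = x \<cdot> d"
      using so_pullback[OF e(1,2) x] .
    have "y \<cdot> b = f \<cdot> (x \<cdot> d)" using cmp_assoc[OF d(3) e(2) f(1)] f(2) d(4) by simp
    then show "\<exists>B e y. so C e \<and> e \<in> hom C B A \<and> val B (\<Gamma>ar f) (x \<cdot> e) y \<and> val B k (x \<cdot> e) y"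
      using val_restrict[OF v d(3)] G(4)[OF cmp_hom[OF d(2) x]] d by metis
  qed
  then show ?thesis using f(1) by blast
qed

lemma Gamma_fully_order_faithful: "fully_order_faithful C \<X> (Gamma C)"
  unfolding fully_order_faithful_def fob_Gamma using Gamma_full Gamma_leq_iff by blast

lemma Gamma_regular: "regular_functor C \<X> (Gamma C)"
proof -
  interpret \<Gamma>: pos_functor C \<X> "Gamma C" by (rule Gamma_functor)
  interpret R: regular_category \<X> by (rule regular_ex_reg)
  show ?thesis
  proof (unfold_locales)
    show "preserves_finite_weighted_limits C \<X> (Gamma C)"
      using \<Gamma>.preserves_finite_weighted_limitsI(2)[OF Gamma_terminal Gamma_product Gamma_inserter] .
  qed (rule Gamma_so)
qed

end

theorem corollary4p14:
  fixes \<E> :: "('o, 'a) pos_cat"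
  assumes "regular_category \<E>"
  shows "regular_category (ex_reg \<E>) \<and>
    regular_functor \<E> (ex_reg \<E>) (Gamma \<E>) \<and>
    fully_order_faithful \<E> (ex_reg \<E>) (Gamma \<E>)"
proof -
  interpret regular_poset_category \<E> by (rule regular_poset_category.intro[OF assms])
  show ?thesis using regular_ex_reg Gamma_regular Gamma_fully_order_faithful by blast
qed

end
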